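(* Let $d\ge2$, $\mathcal{C}>0$, $\beta>1/2$, and let $X$ be a $p_n$-ERW in direction $\ell\in\mathbb{S}^{d-1}$ on $\mathbb{Z}^d$ with $p_n=\mathcal{C}n^{-\beta}\wedge1$. For $n\ge1$ and $t\ge0$ let $$\hat B_t^n=\frac{X_{\lfloor nt\rfloor}}{n^{1/2}}+(nt-\lfloor nt\rfloor)\frac{X_{\lfloor nt\rfloor+1}-X_{\lfloor nt\rfloor}}{n^{1/2}}.$$ Then $\{\hat B^n_\cdot\}_{n\ge1}$ converges in distribution in $C_{\mathbb{R}^d}[0,\infty)$ to a $d$-dimensional Brownian motion with covariance matrix $\Sigma=\mathbb{E}[\xi_1\xi_1^T]$.
   Context: Definition of the $p_n$-ERW in direction $\ell$ on $\mathbb{Z}^d$. Let $d\ge 2$, let $\ell\in\mathbb{S}^{d-1}$ (the unit sphere of $\mathbb{R}^d$), let $\|\cdot\|$ be the Euclidean norm, and let $\{p_n\}_{n\ge1}\subset(0,1]$. Let $\{\xi_i\}_{i\ge1}$ and $\{\gamma_i\}_{i\ge1}$ be sequences of $\mathbb{Z}^d$-valued random vectors on a probability space $(\Omega,\mathcal{F},\mathbb{P})$, adapted to a filtration $\{\mathcal{F}_n\}_{n\ge0}$ (with $\mathcal{F}_0$ containing all null sets), such that: (i) there is a constant $K>0$ with $\sup_{n}\|\xi_n\|\le K$ and $\sup_n\|\gamma_n\|\le K$ on every realization; (ii) there is a constant $\lambda>0$ such that for all $n\ge1$, $\mathbb{E}[\xi_n\mid\mathcal{F}_{n-1}]=0$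 and $\mathbb{E}[\gamma_n\cdot\ell\mid\mathcal{F}_{n-1}]\ge\lambda$; (iii) $\{\xi_i\}$ is i.i.d. with zero mean vector and finite covariance matrix, and $\mathbb{P}[\xi_i\cdot\ell'=0]<1$ for all $\ell'\in\mathbb{S}^{d-1}$; (iv) $\{\gamma_i\}$ is i.i.d., and the sequences $\{\xi_i\}$ and $\{\gamma_i\}$ are independent of each other. Let $\{U_i\}_{i\ge1}$ be i.i.d. uniform on $[0,1]$, independent of $(\{\xi_i\},\{\gamma_i\})$. Set $X_0=0$, $E_0=\emptyset$, and for $n\ge1$ let $E_n=\{\exists k<n:\ X_k=X_n\}$. The process $X=\{X_n\}_{n\ge0}$ is defined by $$X_n=\sum_{i=1}^n\Big(\mathbf{1}_{E_{i-1}}\xi_i+\mathbf{1}_{E_{i-1}^c\cap\{U_i>p_i\}}\xi_i+\mathbf{1}_{E_{i-1}^c\cap\{U_i\le p_i\}}\gamma_i\Big),\quad n\ge1.$$ $C_{\mathbb{R}^d}[0,\infty)$ is the space of continuous functions $[0,\infty)\to\mathbb{R}^d$ with the metric $\rho(f,g)=\sum_{k\ge1}2^{-k}\sup_{0\le t\le k}(\|f(t)-g(t)\|\wedge1)$. Vectors are column vectors, $a^T$ is the transpose, and $a\wedge b=\min(a,b)$. *)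

theory Defs
  imports "HOL-Probability.Probability"
begin

section \<open>The path space \<open>C[0,\<infinity>)\<close>\<close>

text \<open>A path is a function on all of \<open>real\<close> that takes the value \<open>undefined\<close> at negative times,
  so that equality of paths is equality on \<open>[0,\<infinity>)\<close>.\<close>

definition cont_paths :: "(real \<Rightarrow> real ^ 'd) set" where
  "cont_paths = {f \<in> extensional {0..}. continuous_on {0..} f}"

text \<open>The sum over \<open>k \<ge> 1\<close> is shifted to start at \<open>0\<close>.\<close>

definition path_dist :: "(real \<Rightarrow> real ^ 'd) \<Rightarrow> (real \<Rightarrow> real ^ 'd) \<Rightarrow> real" where
  "path_dist f g =
     (\<Sum>k. (1 / 2) ^ Suc k * (SUP t\<in>{0..real (Suc k)}. min (norm (f t - g t)) 1))"

lemma Metric_space_cont_paths: "Metric_space (cont_paths :: (real \<Rightarrow> real ^ 'd) set) path_dist"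
proof -
  define S where "S k f g = (SUP t\<in>{0..real (Suc k)}. min (norm (f t - g t)) 1)"
    for k and f g :: "real \<Rightarrow> real ^ 'd"
  have bdd: "bdd_above ((\<lambda>t. min (norm (f t - g t)) 1) ` {0..real (Suc k)})"
    for k and f g :: "real \<Rightarrow> real ^ 'd"
    by (rule bdd_aboveI[of _ 1]) auto
  have upper: "min (norm (f t - g t)) 1 \<le> S k f g" if "t \<in> {0..real (Suc k)}" for t k f g
    unfolding S_def using that by (rule cSUP_upper[OF _ bdd])
  have S_nonneg: "0 \<le> S k f g" for k f g
    using upper[of 0 k f g] by (smt (verit) atLeastAtMost_iff norm_ge_zero of_nat_0_le_iff)
  have S_le: "S k f g \<le> 1" for k f g
    unfolding S_def by (rule cSUP_least) auto
  have S_tri: "S k f h \<le> S k f g + S k g h" for k f g h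
    unfolding S_def[of k f h]
  proof (rule cSUP_least)
    fix t assume t: "t \<in> {0..real (Suc k)}"
    have "norm (f t - h t) \<le> norm (f t - g t) + norm (g t - h t)"
      by (metis norm_diff_triangle_ineq diff_add_cancel add_diff_eq norm_triangle_ineq)
    then show "min (norm (f t - h t)) 1 \<le> S k f g + S k g h"
      using upper[OF t, of f g] upper[OF t, of g h] by (smt (verit) norm_ge_zero)
  qed auto
  have geo: "summable (\<lambda>k. (1 / 2 :: real) ^ Suc k)"
    by (simp add: summable_geometric)
  have summ: "summable (\<lambda>k. (1 / 2) ^ Suc k * S k f g)" for f g
    by (rule summable_comparison_test'[OF geo, of 0])
       (use S_nonneg S_le in \<open>auto simp: abs_mult mult_left_le\<close>)
  have pd: "path_dist f g = (\<Sum>k. (1 / 2) ^ Suc k * S k f g)" for f g :: "real \<Rightarrow> real ^ 'd"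
    by (simp add: path_dist_def S_def)
  show ?thesis
  proof
    fix f g :: "real \<Rightarrow> real ^ 'd"
    show "0 \<le> path_dist f g"
      unfolding pd by (intro suminf_nonneg summ) (simp add: S_nonneg)
    show "path_dist f g = path_dist g f"
      unfolding path_dist_def by (simp add: norm_minus_commute)
    assume f: "f \<in> cont_paths" and g: "g \<in> cont_paths"
    show "path_dist f g = 0 \<longleftrightarrow> f = g"
    proof
      assume "path_dist f g = 0"
      then have S0: "S k f g = 0" for k
        unfolding pd using suminf_eq_zero_iff[OF summ, of f g] S_nonneg by simp
      have "f t = g t" if "t \<ge> 0" for t
      proof -
        obtain k where "t \<le> real k" using real_arch_simple by blast
        then have "t \<in> {0..real (Suc k)}" using that by auto
        from upper[OF this, of f g] S0 show ?thesis by (auto simp: min_def split: if_splits)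
      qed
      then show "f = g"
        using f g by (auto simp: cont_paths_def intro!: extensionalityI[of f "{0..}" g])
    next
      assume "f = g"
      then show "path_dist f g = 0" by (simp add: path_dist_def)
    qed
  next
    fix f g h :: "real \<Rightarrow> real ^ 'd"
    have "path_dist f h \<le> (\<Sum>k. (1 / 2) ^ Suc k * S k f g + (1 / 2) ^ Suc k * S k g h)"
      unfolding pd
      by (intro suminf_le summ summable_add)
         (metis S_tri distrib_left mult_left_mono zero_le_power zero_le_divide_1_iff zero_le_numeral)
    then show "path_dist f h \<le> path_dist f g + path_dist g h"
      unfolding pd using suminf_add[OF summ summ, of f g g h] by simp
  qed
qed

abbreviation path_topology :: "(real \<Rightarrow> real ^ 'd) topology" where
  "path_topology \<equiv> Metric_space.mtopology cont_paths path_dist"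


section \<open>Convergence in distribution\<close>

definition borel_of :: "'p topology \<Rightarrow> 'p measure" where
  "borel_of T = sigma (topspace T) {U. openin T U}"

text \<open>The sequence is indexed by \<open>n \<ge> 1\<close>. The maps are required to be random elements of \<open>T\<close>,
  since otherwise the integrals would be meaningless.\<close>

definition converges_in_distribution ::
  "'p topology \<Rightarrow> 'a measure \<Rightarrow> (nat \<Rightarrow> 'a \<Rightarrow> 'p) \<Rightarrow> 'b measure \<Rightarrow> ('b \<Rightarrow> 'p) \<Rightarrow> bool" where
  "converges_in_distribution T M Y N Z \<longleftrightarrow>
     (\<forall>n\<ge>1. Y n \<in> measurable M (borel_of T)) \<and> Z \<in> measurable N (borel_of T) \<and>
     (\<forall>h. continuous_map T euclideanreal h \<and> bounded (h ` topspace T) \<longrightarrow>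
        (\<lambda>n. \<integral>\<omega>. h (Y n \<omega>) \<partial>M) \<longlonglongrightarrow> (\<integral>\<omega>. h (Z \<omega>) \<partial>N))"


section \<open>Brownian motion\<close>

definition normal_law :: "real \<Rightarrow> real \<Rightarrow> real measure" where
  "normal_law m v =
     (if v = 0 then return borel m else density lborel (normal_density m (sqrt v)))"

text \<open>Gaussian vectors are defined through their one-dimensional projections; the covariance
  matrix may be singular.\<close>

definition gaussian_vector :: "'b measure \<Rightarrow> real ^ 'd ^ 'd \<Rightarrow> ('b \<Rightarrow> real ^ 'd) \<Rightarrow> bool" where
  "gaussian_vector N S Z \<longleftrightarrow> Z \<in> borel_measurable N \<and>
     (\<forall>u. distr N borel (\<lambda>\<omega>. u \<bullet> Z \<omega>) = normal_law 0 (u \<bullet> (S *v u)))"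

locale brownian_motion = prob_space N
  for N :: "'b measure" and S :: "real ^ 'd ^ 'd" and W :: "real \<Rightarrow> 'b \<Rightarrow> real ^ 'd" +
  assumes measurable_W: "\<And>t. 0 \<le> t \<Longrightarrow> W t \<in> borel_measurable N"
    and start: "AE \<omega> in N. W 0 \<omega> = 0"
    and continuous_W: "\<And>\<omega>. \<omega> \<in> space N \<Longrightarrow> continuous_on {0..} (\<lambda>t. W t \<omega>)"
    and indep_increments: "\<And>(k::nat) t. 0 \<le> t 0 \<Longrightarrow> mono_on {..k} t \<Longrightarrow>
      indep_vars (\<lambda>_. borel) (\<lambda>i \<omega>. W (t (Suc i)) \<omega> - W (t i) \<omega>) {..<k}"
    and gaussian_increments: "\<And>s t. 0 \<le> s \<Longrightarrow> s \<le> t \<Longrightarrow>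
      gaussian_vector N ((t - s) *\<^sub>R S) (\<lambda>\<omega>. W t \<omega> - W s \<omega>)"


section \<open>The \<open>p\<^sub>n\<close>-ERW in direction \<open>\<ell>\<close>\<close>

definition int_lattice :: "(real ^ 'd) set" where
  "int_lattice = {x. \<forall>j. x $ j \<in> \<int>}"

definition revisit :: "'a measure \<Rightarrow> (nat \<Rightarrow> 'a \<Rightarrow> real ^ 'd) \<Rightarrow> nat \<Rightarrow> 'a set" where
  "revisit M X n = {\<omega> \<in> space M. \<exists>k<n. X k \<omega> = X n \<omega>}"

text \<open>The sequences \<open>\<xi>\<close>, \<open>\<gamma>\<close>, \<open>U\<close> and \<open>p\<close> are indexed by \<open>n \<ge> 1\<close>; their values at \<open>0\<close> are
  irrelevant. Conditional expectations of vectors are taken coordinatewise. Independence of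
  \<open>U\<close> from \<open>(\<xi>, \<gamma>)\<close> is stated for the generated sigma-algebras because \<open>indep_var\<close> requires
  both random variables to have values of the same type.\<close>

locale pn_erw = prob_space M + filtration "space M" F
  for M :: "'a measure" and F :: "nat \<Rightarrow> 'a measure"
    and p :: "nat \<Rightarrow> real" and dir :: "real ^ 'd"
    and \<xi> \<gamma> :: "nat \<Rightarrow> 'a \<Rightarrow> real ^ 'd" and U :: "nat \<Rightarrow> 'a \<Rightarrow> real"
    and X :: "nat \<Rightarrow> 'a \<Rightarrow> real ^ 'd" +
  assumes direction: "norm dir = 1"
    and p_range: "\<And>n. 1 \<le> n \<Longrightarrow> 0 < p n \<and> p n \<le> 1"
    and subalgebra_F: "\<And>n. subalgebra M (F n)"
    and null_sets_F: "null_sets M \<subseteq> sets (F 0)"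
    and adapted_\<xi>: "\<And>n. 1 \<le> n \<Longrightarrow> \<xi> n \<in> borel_measurable (F n)"
    and adapted_\<gamma>: "\<And>n. 1 \<le> n \<Longrightarrow> \<gamma> n \<in> borel_measurable (F n)"
    and lattice_\<xi>: "\<And>n \<omega>. 1 \<le> n \<Longrightarrow> \<omega> \<in> space M \<Longrightarrow> \<xi> n \<omega> \<in> int_lattice"
    and lattice_\<gamma>: "\<And>n \<omega>. 1 \<le> n \<Longrightarrow> \<omega> \<in> space M \<Longrightarrow> \<gamma> n \<omega> \<in> int_lattice"
    and bounded_steps: "\<exists>K>0. \<forall>n\<ge>1. \<forall>\<omega>\<in>space M. norm (\<xi> n \<omega>) \<le> K \<and> norm (\<gamma> n \<omega>) \<le> K"
    and cond_exp_\<xi>: "\<And>n j. 1 \<le> n \<Longrightarrow>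
      AE \<omega> in M. real_cond_exp M (F (n - 1)) (\<lambda>\<omega>. \<xi> n \<omega> $ j) \<omega> = 0"
    and cond_exp_\<gamma>: "\<exists>drift>0. \<forall>n\<ge>1.
      AE \<omega> in M. real_cond_exp M (F (n - 1)) (\<lambda>\<omega>. \<gamma> n \<omega> \<bullet> dir) \<omega> \<ge> drift"
    and indep_\<xi>: "indep_vars (\<lambda>_. borel) \<xi> {1..}"
    and ident_\<xi>: "\<And>n. 1 \<le> n \<Longrightarrow> distr M borel (\<xi> n) = distr M borel (\<xi> 1)"
    and mean_\<xi>: "\<And>n. 1 \<le> n \<Longrightarrow> integrable M (\<xi> n) \<and> expectation (\<xi> n) = 0"
    and covariance_\<xi>: "\<And>n i j. 1 \<le> n \<Longrightarrow> integrable M (\<lambda>\<omega>. \<xi> n \<omega> $ i * \<xi> n \<omega> $ j)"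
    and nondegenerate_\<xi>: "\<And>n v. 1 \<le> n \<Longrightarrow> norm v = 1 \<Longrightarrow>
      prob {\<omega> \<in> space M. \<xi> n \<omega> \<bullet> v = 0} < 1"
    and indep_\<gamma>: "indep_vars (\<lambda>_. borel) \<gamma> {1..}"
    and ident_\<gamma>: "\<And>n. 1 \<le> n \<Longrightarrow> distr M borel (\<gamma> n) = distr M borel (\<gamma> 1)"
    and indep_\<xi>_\<gamma>: "indep_var
      (PiM {1..} (\<lambda>_. borel)) (\<lambda>\<omega>. \<lambda>i\<in>{1..}. \<xi> i \<omega>)
      (PiM {1..} (\<lambda>_. borel)) (\<lambda>\<omega>. \<lambda>i\<in>{1..}. \<gamma> i \<omega>)"
    and indep_U: "indep_vars (\<lambda>_. borel) U {1..}"
    and uniform_U: "\<And>n. 1 \<le> n \<Longrightarrow> distr M borel (U n) = uniform_measure lborel {0..1}"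
    and indep_U_\<xi>\<gamma>: "indep_set
      (sets (vimage_algebra (space M) (\<lambda>\<omega>. \<lambda>i\<in>{1..}. U i \<omega>) (PiM {1..} (\<lambda>_. borel))))
      (sets (vimage_algebra (space M) (\<lambda>\<omega>. (\<lambda>i\<in>{1..}. \<xi> i \<omega>, \<lambda>i\<in>{1..}. \<gamma> i \<omega>))
        (PiM {1..} (\<lambda>_. borel) \<Otimes>\<^sub>M PiM {1..} (\<lambda>_. borel))))"
    and walk: "\<And>n \<omega>. \<omega> \<in> space M \<Longrightarrow> X n \<omega> = (\<Sum>i = 1..n.
        indicator (revisit M X (i - 1)) \<omega> *\<^sub>R \<xi> i \<omega>
      + indicator ((space M - revisit M X (i - 1)) \<inter> {\<omega> \<in> space M. U i \<omega> > p i}) \<omega> *\<^sub>R \<xi> i \<omega>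
      + indicator ((space M - revisit M X (i - 1)) \<inter> {\<omega> \<in> space M. U i \<omega> \<le> p i}) \<omega> *\<^sub>R \<gamma> i \<omega>)"

definition second_moment_matrix :: "'a measure \<Rightarrow> ('a \<Rightarrow> real ^ 'd) \<Rightarrow> real ^ 'd ^ 'd" where
  "second_moment_matrix M Z = (\<chi> i j. \<integral>\<omega>. Z \<omega> $ i * Z \<omega> $ j \<partial>M)"

definition rescaled_walk :: "(nat \<Rightarrow> 'a \<Rightarrow> real ^ 'd) \<Rightarrow> nat \<Rightarrow> real \<Rightarrow> 'a \<Rightarrow> real ^ 'd" where
  "rescaled_walk X n t \<omega> =
     (let m = nat \<lfloor>real n * t\<rfloor> in
        X m \<omega> /\<^sub>R sqrt (real n)
        + (real n * t - real m) *\<^sub>R ((X (m + 1) \<omega> - X m \<omega>) /\<^sub>R sqrt (real n)))"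

end

theory Submission
  imports Defs
begin

text \<open>
  Write \<open>S n = \<xi> 1 + \<dots> + \<xi> n\<close>. The \<open>i\<close>-th step of the walk differs from \<open>\<xi> i\<close> only on the event
  \<open>U i \<le> p i\<close>, and then by at most \<open>2 * K\<close>, where \<open>K\<close> bounds the steps. Up to time \<open>n * T\<close> the
  distance between \<open>X\<close> and \<open>S\<close> therefore has expectation of order \<open>(\<Sum>i\<le>n * T. i powr - \<beta>)\<close>,
  which is \<open>o(sqrt n)\<close> because \<open>\<beta> > 1 / 2\<close>. So the rescaled paths of \<open>X\<close> and of \<open>S\<close> become
  uniformly close on compact time intervals (\<open>erw_walk_comparison\<close>), and what remains is Donsker's
  theorem for the sums \<open>S\<close> of bounded, centred, independent, identically distributed vectors
  (\<open>donsker_lipschitz\<close>).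

  For the convergence it suffices to test with bounded Lipschitz functionals
  (\<open>converges_in_distribution_lipschitzI\<close>), since a bounded continuous function is the increasing
  limit of its Lipschitz minorants. Replacing a path by its interpolation at the times \<open>k / 2 ^ l\<close>
  changes the expectation of such a functional by an amount that tends to \<open>0\<close> with \<open>l\<close>, uniformly
  in \<open>n\<close>: this is a chaining estimate from fourth moments of the dyadic deviations
  (\<open>dyadic_approximation_error\<close>, \<open>walk_path_dyadic_process\<close>). The interpolation is a continuous
  function of the sequence of its nodes, so it is enough that these sequences converge in
  distribution. That follows from tightness and from the convergence of characteristic functions
  (\<open>weak_convergence_of_char\<close>, \<open>sequence_weak_convergence\<close>), the latter by comparing each factor of
  the characteristic function of a sum with its Gaussian counterpart (\<open>walk_path_iexp_limit\<close>).

  The limit is built by Levy's midpoint construction (\<open>increment\<close>), and the same chaining estimate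
  makes its paths continuous (\<open>continuous_extension\<close>). The step \<open>\<xi> 1\<close> takes only finitely many values
  \<open>x\<close>, with probabilities \<open>q x\<close>, say. With independent standard normal variables \<open>Z x\<close>, the sum
  \<open>\<Sum>x. (sqrt (q x) * Z x) *\<^sub>R x\<close> is then a Gaussian vector with the covariance matrix of \<open>\<xi> 1\<close>, and
  vectors of this form are the noise of the construction. Joint characteristic functions give the
  laws of the increments, and their independence because the characteristic function determines
  the law (\<open>sequence_law_eq\<close>, \<open>brownian_motion_exists\<close>).
\<close>

section \<open>Weak convergence from characteristic functions\<close>

inductive trig_poly :: "('x \<Rightarrow> real) set \<Rightarrow> ('x \<Rightarrow> real) \<Rightarrow> bool" for A where
  trig_cos: "L \<in> A \<Longrightarrow> trig_poly A (\<lambda>x. cos (L x))"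
| trig_sin: "L \<in> A \<Longrightarrow> trig_poly A (\<lambda>x. sin (L x))"
| trig_add: "trig_poly A f \<Longrightarrow> trig_poly A g \<Longrightarrow> trig_poly A (\<lambda>x. f x + g x)"
| trig_scale: "trig_poly A f \<Longrightarrow> trig_poly A (\<lambda>x. c * f x)"

text \<open>By the addition theorems, the trigonometric polynomials with frequencies in a linear space of
  functions form an algebra. Separation of points by the frequencies carries over to this algebra,
  which makes the Stone-Weierstrass theorem applicable on compact sets.\<close>

locale frequency_space =
  fixes A :: "('x::t2_space \<Rightarrow> real) set"
  assumes zero: "(\<lambda>_. 0) \<in> A"
    and add: "\<And>L K. L \<in> A \<Longrightarrow> K \<in> A \<Longrightarrow> (\<lambda>x. L x + K x) \<in> A"
    and scale: "\<And>L c. L \<in> A \<Longrightarrow> (\<lambda>x. c * L x) \<in> A"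
    and cont: "\<And>L. L \<in> A \<Longrightarrow> continuous_on UNIV L"
    and separating: "\<And>x y. x \<noteq> y \<Longrightarrow> \<exists>L\<in>A. L x \<noteq> L y"
begin

lemma diff: "L \<in> A \<Longrightarrow> K \<in> A \<Longrightarrow> (\<lambda>x. L x - K x) \<in> A"
  using add[of L "\<lambda>x. (-1) * K x"] scale[of K "-1"] by simp

lemma trig_const: "trig_poly A (\<lambda>_. c)"
  using trig_scale[OF trig_cos[OF zero], of c] by simp

lemma trig_half_add: "trig_poly A f \<Longrightarrow> trig_poly A g \<Longrightarrow> trig_poly A (\<lambda>x. (f x + g x) / 2)"
  using trig_scale[OF trig_add, of A f g "1/2"] by simp

lemma trig_half_diff: "trig_poly A f \<Longrightarrow> trig_poly A g \<Longrightarrow> trig_poly A (\<lambda>x. (f x - g x) / 2)"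
  using trig_half_add[OF _ trig_scale, of f g "-1"] by simp

lemma trig_mult_cos:
  assumes "trig_poly A f" "L \<in> A"
  shows "trig_poly A (\<lambda>x. f x * cos (L x))"
  using assms
proof induction
  case (trig_cos K)
  then show ?case
    by (auto simp: cos_times_cos intro!: trig_half_add trig_poly.trig_cos add diff)
next
  case (trig_sin K)
  then show ?case
    by (auto simp: sin_times_cos intro!: trig_half_add trig_poly.trig_sin add diff)
next
  case (trig_add f g)
  then show ?case by (auto simp: distrib_right intro!: trig_poly.trig_add)
next
  case (trig_scale f c)
  then show ?case by (auto simp: mult.assoc intro!: trig_poly.trig_scale)
qed

lemma trig_mult_sin:
  assumes "trig_poly A f" "L \<in> A"
  shows "trig_poly A (\<lambda>x. f x * sin (L x))"
  using assms
proof induction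
  case (trig_cos K)
  then show ?case
    by (auto simp: cos_times_sin intro!: trig_half_diff trig_poly.trig_sin add diff)
next
  case (trig_sin K)
  then show ?case
    by (auto simp: sin_times_sin intro!: trig_half_diff trig_poly.trig_cos add diff)
next
  case (trig_add f g)
  then show ?case by (auto simp: distrib_right intro!: trig_poly.trig_add)
next
  case (trig_scale f c)
  then show ?case by (auto simp: mult.assoc intro!: trig_poly.trig_scale)
qed

lemma trig_mult:
  assumes "trig_poly A g" "trig_poly A f"
  shows "trig_poly A (\<lambda>x. f x * g x)"
  using assms
proof induction
  case (trig_add g h)
  then show ?case by (auto simp: distrib_left intro!: trig_poly.trig_add)
next
  case (trig_scale g c)
  then show ?case
    using trig_poly.trig_scale[of A "\<lambda>x. f x * g x" c] by (simp add: mult.left_commute)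
qed (auto intro: trig_mult_cos trig_mult_sin)

lemma trig_cont: "trig_poly A f \<Longrightarrow> continuous_on UNIV f"
  by (induction rule: trig_poly.induct) (auto intro!: continuous_intros dest: cont)

lemma trig_bounded: "trig_poly A f \<Longrightarrow> \<exists>B. \<forall>x. \<bar>f x\<bar> \<le> B"
proof (induction rule: trig_poly.induct)
  case (trig_add f g)
  then obtain B C where "\<forall>x. \<bar>f x\<bar> \<le> B" "\<forall>x. \<bar>g x\<bar> \<le> C" by auto
  then show ?case by (intro exI[of _ "B + C"]) (meson abs_triangle_ineq add_mono order_trans)
next
  case (trig_scale f c)
  then obtain B where "\<forall>x. \<bar>f x\<bar> \<le> B" by auto
  then show ?case by (intro exI[of _ "\<bar>c\<bar> * B"]) (auto simp: abs_mult intro: mult_left_mono)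
qed (auto intro: exI[of _ 1])

lemma trig_polynomial:
  assumes "real_polynomial_function q" "trig_poly A f"
  shows "trig_poly A (\<lambda>x. q (f x))"
  using assms(1)
proof induction
  case (linear q)
  then obtain c where "q = (\<lambda>x. x * c)" using real_bounded_linear by auto
  then show ?case using trig_scale[OF assms(2), of c] by (simp add: mult.commute)
qed (auto intro!: trig_const trig_add trig_mult)

lemma trig_separating:
  assumes "x \<noteq> y"
  shows "\<exists>f. trig_poly A f \<and> f x \<noteq> f y"
proof (rule ccontr)
  assume neg: "\<not> ?thesis"
  obtain L where L: "L \<in> A" "L x \<noteq> L y" using separating[OF assms] by auto
  \<comment> \<open>The scaled frequency has values at \<open>x\<close> and \<open>y\<close> that differ by \<open>1\<close>, which is not a period.\<close>
  define K where "K = (\<lambda>z. (1 / (L x - L y)) * L z)"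
  have K: "K \<in> A" unfolding K_def by (rule scale[OF L(1)])
  have "K x - K y = 1" using L(2) by (simp add: K_def diff_divide_distrib[symmetric])
  moreover have "cos (K x) = cos (K y)" "sin (K x) = sin (K y)"
    using neg trig_cos[OF K] trig_sin[OF K] by auto
  then have "cos (K x - K y) = 1" by (simp add: cos_diff flip: power2_eq_square)
  ultimately have "cos (1::real) = 1" by simp
  then show False using cos_monotone_0_pi[of 0 1] pi_gt3 by simp
qed

text \<open>Stone-Weierstrass only controls the approximation on \<open>S\<close>. Clamping the approximant to
  \<open>[-B, B]\<close> keeps it bounded elsewhere, and the clamped function is again a uniform limit of
  trigonometric polynomials, by Weierstrass' theorem on the (bounded) range of the approximant.\<close>

lemma trig_approximation:
  fixes f :: "'x \<Rightarrow> real"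
  assumes f: "continuous_on UNIV f" and B: "\<And>x. \<bar>f x\<bar> \<le> B" and S: "compact S" and e: "e > 0"
  shows "\<exists>g. trig_poly A g \<and> (\<forall>x\<in>S. \<bar>f x - g x\<bar> \<le> 2 * e) \<and> (\<forall>x. \<bar>f x - g x\<bar> \<le> 2 * B + e)"
proof -
  have "\<exists>g. trig_poly A g \<and> (\<forall>x\<in>S. \<bar>f x - g x\<bar> < e)"
  proof (rule Stone_Weierstrass_HOL[OF S])
    show "continuous_on S g" if "trig_poly A g" for g
      using trig_cont[OF that] by (rule continuous_on_subset) simp
    show "continuous_on S f" using f by (rule continuous_on_subset) simp
    show "\<exists>g. trig_poly A g \<and> g x \<noteq> g y" if "x \<in> S \<and> y \<in> S \<and> x \<noteq> y" for x y
      using that trig_separating by simp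
  qed (use e in \<open>simp_all add: trig_const trig_add trig_mult\<close>)
  then obtain g where g: "trig_poly A g" "\<And>x. x \<in> S \<Longrightarrow> \<bar>f x - g x\<bar> < e" by auto
  obtain C where C: "\<And>x. \<bar>g x\<bar> \<le> C" using trig_bounded[OF g(1)] by auto
  define \<phi> where "\<phi> = (\<lambda>y::real. max (- B) (min B y))"
  obtain q where q: "real_polynomial_function q" "\<And>y. y \<in> {-C..C} \<Longrightarrow> \<bar>\<phi> y - q y\<bar> < e"
    by (rule Stone_Weierstrass_real_polynomial_function[of "{-C..C}" \<phi> e])
       (auto simp: \<phi>_def e intro!: continuous_intros)
  have *: "\<bar>\<phi> (g x) - q (g x)\<bar> < e" for x
    using C[of x] by (intro q) auto
  have "\<bar>f x - q (g x)\<bar> \<le> 2 * e" if "x \<in> S" for x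
  proof -
    have "\<bar>f x - \<phi> (g x)\<bar> \<le> \<bar>f x - g x\<bar>" using B[of x] by (auto simp: \<phi>_def)
    then show ?thesis using *[of x] g(2)[OF that] by linarith
  qed
  moreover have "\<bar>f x - q (g x)\<bar> \<le> 2 * B + e" for x
  proof -
    have "\<bar>\<phi> (g x)\<bar> \<le> B" using B[of x] by (auto simp: \<phi>_def)
    then show ?thesis using *[of x] B[of x] by linarith
  qed
  ultimately show ?thesis using trig_polynomial[OF q(1) g(1)] by blast
qed

lemma trig_measurable: "trig_poly A f \<Longrightarrow> f \<in> borel_measurable borel"
  by (intro borel_measurable_continuous_onI trig_cont)

lemma integral_approx_off_small_set:
  fixes f g :: "'x \<Rightarrow> real" and V :: "'a \<Rightarrow> 'x"
  assumes M: "prob_space M" and V: "V \<in> borel_measurable M" and S: "compact S"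
    and f: "f \<in> borel_measurable borel" and g: "g \<in> borel_measurable borel"
    and bf: "\<And>x. \<bar>f x\<bar> \<le> B" and bg: "\<And>x. \<bar>g x\<bar> \<le> C"
    and near: "\<And>x. x \<in> S \<Longrightarrow> \<bar>f x - g x\<bar> \<le> a" and far: "\<And>x. \<bar>f x - g x\<bar> \<le> b"
    and a: "0 \<le> a"
    and small: "measure M {\<omega> \<in> space M. V \<omega> \<notin> S} \<le> e"
  shows "\<bar>(\<integral>\<omega>. f (V \<omega>) \<partial>M) - (\<integral>\<omega>. g (V \<omega>) \<partial>M)\<bar> \<le> a + b * e"
proof -
  interpret prob_space M by fact
  note [measurable] = V f g
  have [measurable]: "S \<in> sets borel" by (rule borel_closed[OF compact_imp_closed[OF S]])
  have b: "0 \<le> b" using far[of undefined] by linarith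
  have if_: "integrable M (\<lambda>\<omega>. f (V \<omega>))" by (rule integrable_const_bound[of _ B]) (auto simp: bf)
  have ig: "integrable M (\<lambda>\<omega>. g (V \<omega>))" by (rule integrable_const_bound[of _ C]) (auto simp: bg)
  let ?E = "{\<omega> \<in> space M. V \<omega> \<notin> S}"
  have iE: "integrable M (\<lambda>\<omega>. b * indicator ?E \<omega> :: real)"
    by (intro integrable_mult_right integrable_real_indicator) (auto simp: less_top[symmetric])
  have "\<bar>(\<integral>\<omega>. f (V \<omega>) \<partial>M) - (\<integral>\<omega>. g (V \<omega>) \<partial>M)\<bar> = \<bar>\<integral>\<omega>. f (V \<omega>) - g (V \<omega>) \<partial>M\<bar>"
    using if_ ig by simp
  also have "\<dots> \<le> (\<integral>\<omega>. \<bar>f (V \<omega>) - g (V \<omega>)\<bar> \<partial>M)"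
    using integral_norm_bound[of M "\<lambda>\<omega>. f (V \<omega>) - g (V \<omega>)"] by simp
  also have "\<dots> \<le> (\<integral>\<omega>. a + b * indicator ?E \<omega> \<partial>M)"
  proof (rule integral_mono)
    fix \<omega> assume "\<omega> \<in> space M"
    then show "\<bar>f (V \<omega>) - g (V \<omega>)\<bar> \<le> a + b * indicator ?E \<omega>"
      using near[of "V \<omega>"] far[of "V \<omega>"] a by (auto simp: indicator_def)
  qed (use if_ ig iE in auto)
  also have "\<dots> = a + b * measure M ?E"
    by (subst Bochner_Integration.integral_add[OF _ iE]) (auto simp: prob_space)
  also have "\<dots> \<le> a + b * e" by (intro add_left_mono mult_left_mono small b)
  finally show ?thesis .
qed

lemma abs_diff_three_steps:
  fixes a b c d :: real
  assumes "\<bar>a - b\<bar> \<le> \<eta>" "\<bar>b - c\<bar> < r / 3" "\<bar>d - c\<bar> \<le> \<eta>" "\<eta> < r / 3"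
  shows "\<bar>a - d\<bar> < r"
  using assms by linarith

text \<open>For trigonometric polynomials the convergence is the hypothesis on characteristic functions.
  A general \<open>f\<close> is approximated by one of them up to \<open>2 * e\<close> on a compact set that carries all but
  the mass \<open>e\<close> of every law, and with a bounded error elsewhere.\<close>

theorem weak_convergence_of_char:
  fixes V :: "nat \<Rightarrow> 'a \<Rightarrow> 'x" and Z :: "'b \<Rightarrow> 'x" and f :: "'x \<Rightarrow> real"
  assumes M: "prob_space M" and N: "prob_space N"
    and V: "\<And>n. V n \<in> borel_measurable M" and Z: "Z \<in> borel_measurable N"
    and char: "\<And>L. L \<in> A \<Longrightarrow>
      (\<lambda>n. CLINT \<omega>|M. iexp (L (V n \<omega>))) \<longlonglongrightarrow> (CLINT \<omega>|N. iexp (L (Z \<omega>)))"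
    and tight: "\<And>e. e > 0 \<Longrightarrow> \<exists>S. compact S \<and> (\<forall>n. measure M {\<omega> \<in> space M. V n \<omega> \<notin> S} \<le> e) \<and>
      measure N {\<omega> \<in> space N. Z \<omega> \<notin> S} \<le> e"
    and f: "continuous_on UNIV f" and B: "\<And>x. \<bar>f x\<bar> \<le> B"
  shows "(\<lambda>n. \<integral>\<omega>. f (V n \<omega>) \<partial>M) \<longlonglongrightarrow> (\<integral>\<omega>. f (Z \<omega>) \<partial>N)"
proof -
  interpret M: prob_space M by fact
  interpret N: prob_space N by fact
  note [measurable] = V Z
  have [measurable]: "L \<in> borel_measurable borel" if "L \<in> A" for L
    using cont[OF that] by (rule borel_measurable_continuous_onI)
  have trig: "(\<lambda>n. \<integral>\<omega>. g (V n \<omega>) \<partial>M) \<longlonglongrightarrow> (\<integral>\<omega>. g (Z \<omega>) \<partial>N)" if "trig_poly A g" for g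
    using that
  proof induction
    case (trig_cos L)
    have iM: "integrable M (\<lambda>\<omega>. iexp (L (V n \<omega>)))" for n
      using trig_cos by (intro M.integrable_iexp) auto
    have iN: "integrable N (\<lambda>\<omega>. iexp (L (Z \<omega>)))"
      using trig_cos by (intro N.integrable_iexp) auto
    have "(\<lambda>n. Re (CLINT \<omega>|M. iexp (L (V n \<omega>)))) \<longlonglongrightarrow> Re (CLINT \<omega>|N. iexp (L (Z \<omega>)))"
      by (intro tendsto_Re char trig_cos)
    then show ?case
      by (simp add: integral_Re[OF iM, symmetric] integral_Re[OF iN, symmetric] Re_exp)
  next
    case (trig_sin L)
    have iM: "integrable M (\<lambda>\<omega>. iexp (L (V n \<omega>)))" for n
      using trig_sin by (intro M.integrable_iexp) auto
    have iN: "integrable N (\<lambda>\<omega>. iexp (L (Z \<omega>)))"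
      using trig_sin by (intro N.integrable_iexp) auto
    have "(\<lambda>n. Im (CLINT \<omega>|M. iexp (L (V n \<omega>)))) \<longlonglongrightarrow> Im (CLINT \<omega>|N. iexp (L (Z \<omega>)))"
      by (intro tendsto_Im char trig_sin)
    then show ?case
      by (simp add: integral_Im[OF iM, symmetric] integral_Im[OF iN, symmetric] Im_exp)
  next
    case (trig_add g h)
    have [measurable]: "g \<in> borel_measurable borel" "h \<in> borel_measurable borel"
      using trig_add.hyps trig_measurable by auto
    obtain Bg where "\<And>x. \<bar>g x\<bar> \<le> Bg" using trig_bounded[OF trig_add.hyps(1)] by auto
    moreover obtain Bh where "\<And>x. \<bar>h x\<bar> \<le> Bh" using trig_bounded[OF trig_add.hyps(2)] by auto
    ultimately have "integrable M (\<lambda>\<omega>. g (V n \<omega>))" "integrable M (\<lambda>\<omega>. h (V n \<omega>))"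
        "integrable N (\<lambda>\<omega>. g (Z \<omega>))" "integrable N (\<lambda>\<omega>. h (Z \<omega>))" for n
      by (auto intro: M.integrable_const_bound[of _ Bg] M.integrable_const_bound[of _ Bh]
          N.integrable_const_bound[of _ Bg] N.integrable_const_bound[of _ Bh])
    then show ?case using trig_add.IH by (auto intro!: tendsto_intros)
  next
    case (trig_scale g c)
    then show ?case by (auto intro!: tendsto_intros)
  qed
  have B0: "0 \<le> B" using B[of undefined] by linarith
  have fm: "f \<in> borel_measurable borel" by (rule borel_measurable_continuous_onI[OF f])
  show ?thesis
  proof (rule LIMSEQ_I)
    fix r :: real assume r: "r > 0"
    \<comment> \<open>With \<open>e * q \<le> r\<close>, each of the two approximation errors below stays under \<open>r / 3\<close>.\<close>
    define q where "q = 4 * (3 + 2 * B)"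
    define e where "e = min 1 (r / q)"
    have q: "q > 0" using B0 by (simp add: q_def)
    have e: "0 < e" "e \<le> 1" "e \<le> r / q" using r q by (auto simp: e_def)
    from e(3) have "e * q \<le> r" using q by (simp only: pos_le_divide_eq)
    moreover have "(2 * B + e) * e \<le> (2 * B + 1) * e" using e by (intro mult_right_mono) simp_all
    moreover have "e * q = 4 * (2 * e + (2 * B + 1) * e)" by (simp add: q_def field_simps)
    ultimately have "4 * (2 * e + (2 * B + e) * e) \<le> r" by simp
    moreover define \<eta> where "\<eta> = 2 * e + (2 * B + e) * e"
    ultimately have small: "\<eta> < r / 3" using r by simp
    obtain S where S: "compact S" "\<And>n. measure M {\<omega> \<in> space M. V n \<omega> \<notin> S} \<le> e"
        "measure N {\<omega> \<in> space N. Z \<omega> \<notin> S} \<le> e"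
      using tight[OF e(1)] by blast
    obtain g where g: "trig_poly A g" "\<And>x. x \<in> S \<Longrightarrow> \<bar>f x - g x\<bar> \<le> 2 * e"
        "\<And>x. \<bar>f x - g x\<bar> \<le> 2 * B + e"
      using trig_approximation[OF f B S(1) e(1)] by blast
    obtain Cg where Cg: "\<And>x. \<bar>g x\<bar> \<le> Cg" using trig_bounded[OF g(1)] by auto
    have 1: "\<bar>(\<integral>\<omega>. f (V n \<omega>) \<partial>M) - (\<integral>\<omega>. g (V n \<omega>) \<partial>M)\<bar> \<le> \<eta>" for n
      unfolding \<eta>_def by (rule integral_approx_off_small_set[OF M V S(1) fm trig_measurable[OF g(1)] B Cg g(2,3) _ S(2)])
         (use e in auto)
    have 2: "\<bar>(\<integral>\<omega>. f (Z \<omega>) \<partial>N) - (\<integral>\<omega>. g (Z \<omega>) \<partial>N)\<bar> \<le> \<eta>"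
      unfolding \<eta>_def by (rule integral_approx_off_small_set[OF N Z S(1) fm trig_measurable[OF g(1)] B Cg g(2,3) _ S(3)])
         (use e in auto)
    have "\<exists>n0. \<forall>n\<ge>n0. norm ((\<integral>\<omega>. g (V n \<omega>) \<partial>M) - (\<integral>\<omega>. g (Z \<omega>) \<partial>N)) < r / 3"
      by (rule LIMSEQ_D[OF trig[OF g(1)]]) (use r in simp)
    then obtain n0 where n0: "\<And>n. n \<ge> n0 \<Longrightarrow> \<bar>(\<integral>\<omega>. g (V n \<omega>) \<partial>M) - (\<integral>\<omega>. g (Z \<omega>) \<partial>N)\<bar> < r / 3"
      unfolding real_norm_def by blast
    have "norm ((\<integral>\<omega>. f (V n \<omega>) \<partial>M) - (\<integral>\<omega>. f (Z \<omega>) \<partial>N)) < r" if "n \<ge> n0" for n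
      unfolding real_norm_def by (rule abs_diff_three_steps[OF 1 n0[OF that] 2 small])
    then show "\<exists>n0. \<forall>n\<ge>n0. norm ((\<integral>\<omega>. f (V n \<omega>) \<partial>M) - (\<integral>\<omega>. f (Z \<omega>) \<partial>N)) < r" by blast
  qed
qed

end

section \<open>Polygonal paths and the topology of the path space\<close>

text \<open>The piecewise linear path with node \<open>x k\<close> at time \<open>k / c\<close>. Both the rescaled walks (\<open>c = n\<close>) and
  the dyadic interpolations (\<open>c = 2 ^ l\<close>) are of this form.\<close>

definition polygon :: "real \<Rightarrow> (nat \<Rightarrow> 'e::real_normed_vector) \<Rightarrow> real \<Rightarrow> 'e" where
  "polygon c x t = (let m = nat \<lfloor>c * t\<rfloor> in x m + (c * t - real m) *\<^sub>R (x (m + 1) - x m))"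

lemma polygon_segment:
  assumes "real k \<le> c * t" "c * t \<le> real (k + 1)"
  shows "polygon c x t = x k + (c * t - real k) *\<^sub>R (x (k + 1) - x k)"
proof (cases "c * t = real (k + 1)")
  case True
  then have "nat \<lfloor>c * t\<rfloor> = k + 1" by (metis floor_of_nat nat_int)
  then show ?thesis using True by (simp add: polygon_def)
next
  case False
  then have "\<lfloor>c * t\<rfloor> = int k" using assms by (intro floor_unique) auto
  then show ?thesis by (simp add: polygon_def)
qed

lemma segment_index:
  assumes "0 \<le> (s::real)"
  obtains k where "real k \<le> s" "s < real (k + 1)"
  by (rule that[of "nat \<lfloor>s\<rfloor>"]) (use assms in linarith)+

lemma polygon_node: "c > 0 \<Longrightarrow> polygon c x (real k / c) = x k"
  by (subst polygon_segment[of k]) auto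

lemma polygon_diff: "polygon c x t - polygon c y t = polygon c (\<lambda>k. x k - y k) t"
  by (simp add: polygon_def Let_def algebra_simps)

lemma norm_convex_le:
  fixes x y :: "'e::real_normed_vector"
  assumes "norm x \<le> b" "norm y \<le> b" "0 \<le> s" "s \<le> 1"
  shows "norm (x + s *\<^sub>R (y - x)) \<le> b"
proof -
  have "norm (x + s *\<^sub>R (y - x)) = norm ((1 - s) *\<^sub>R x + s *\<^sub>R y)"
    by (simp add: algebra_simps)
  also have "\<dots> \<le> (1 - s) * norm x + s * norm y"
    using assms by (intro order_trans[OF norm_triangle_ineq]) simp
  also have "\<dots> \<le> (1 - s) * b + s * b"
    using assms by (intro add_mono mult_left_mono) auto
  finally show ?thesis by (simp add: algebra_simps)
qed

lemma norm_polygon_le: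
  assumes t: "0 \<le> c * t" and b: "\<And>k. real k \<le> c * t + 1 \<Longrightarrow> norm (x k) \<le> b"
  shows "norm (polygon c x t) \<le> b"
proof -
  obtain k where k: "real k \<le> c * t" "c * t < real (k + 1)" using segment_index[OF t] .
  then have "polygon c x t = x k + (c * t - real k) *\<^sub>R (x (k + 1) - x k)"
    by (intro polygon_segment) auto
  moreover have "norm \<dots> \<le> b" using k by (intro norm_convex_le b) auto
  ultimately show ?thesis by simp
qed

lemma polygon_const: "polygon c (\<lambda>_. z) t = z"
  by (simp add: polygon_def)

text \<open>In this form a polygonal path is a sum of its steps with deterministic weights in \<open>[0, 1]\<close>, so that
  estimates for sums of independent vectors apply at all times and not only at the nodes.\<close>

lemma polygon_eq_ramps:
  assumes "0 \<le> c * t" "c * t \<le> real m"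
  shows "polygon c x t =
    x 0 + (\<Sum>i<m. max 0 (min 1 (c * t - real i)) *\<^sub>R (x (Suc i) - x i))"
proof -
  have *: "x 0 + (\<Sum>i<m. max 0 (min 1 (s - real i)) *\<^sub>R (x (Suc i) - x i))
      = x k + (s - real k) *\<^sub>R (x (Suc k) - x k)"
    if "k < m" "real k \<le> s" "s \<le> real (Suc k)" for s k
    using that(1)
  proof (induction m)
    case (Suc m)
    show ?case
    proof (cases "k = m")
      case True
      have "(\<Sum>i<m. max 0 (min 1 (s - real i)) *\<^sub>R (x (Suc i) - x i)) = (\<Sum>i<m. x (Suc i) - x i)"
      proof (intro sum.cong refl)
        fix i assume "i \<in> {..<m}"
        then have "max 0 (min 1 (s - real i)) = 1" using True that(2) by auto
        then show "max 0 (min 1 (s - real i)) *\<^sub>R (x (Suc i) - x i) = x (Suc i) - x i" by simp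
      qed
      also have "\<dots> = x m - x 0" by (rule sum_lessThan_telescope)
      finally have 1: "(\<Sum>i<m. max 0 (min 1 (s - real i)) *\<^sub>R (x (Suc i) - x i)) = x m - x 0" .
      have 2: "max 0 (min 1 (s - real m)) = s - real m" using True that by auto
      show ?thesis using True by (simp only: sum.lessThan_Suc 1 2) simp
    next
      case False
      then have "max 0 (min 1 (s - real m)) = 0" using Suc.prems that(3) by auto
      then show ?thesis using Suc False by simp
    qed
  qed simp
  show ?thesis
  proof (cases "m = 0")
    case True
    then have "c * t = 0" using assms by simp
    then show ?thesis using True by (auto simp: polygon_def)
  next
    case False
    have "\<exists>k<m. real k \<le> c * t \<and> c * t \<le> real (Suc k)"
    proof (cases "c * t = real m")
      case True then show ?thesis using False by (intro exI[of _ "m - 1"]) auto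
    next
      case neq: False
      obtain k where k: "real k \<le> c * t" "c * t < real (k + 1)" using segment_index[OF assms(1)] .
      then have "real k < real m" using neq assms by linarith
      then show ?thesis using k by (intro exI[of _ k]) auto
    qed
    then obtain k where k: "k < m" "real k \<le> c * t" "c * t \<le> real (Suc k)" by auto
    then show ?thesis using *[OF k] polygon_segment[of k c t x] by simp
  qed
qed

lemma continuous_on_atLeast_0I:
  fixes f :: "real \<Rightarrow> 'e::topological_space"
  assumes "\<And>T::nat. continuous_on {0..real T} f"
  shows "continuous_on {0..} f"
  unfolding continuous_on_sequentially
proof (intro allI ballI impI)
  fix x a assume a: "a \<in> {0::real..}" and x: "(\<forall>n. x n \<in> {0..}) \<and> x \<longlonglongrightarrow> a"
  then have "Bseq x" by (meson convergent_def convergent_imp_Bseq)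
  then obtain K where K: "\<And>n. norm (x n) \<le> K" by (auto simp: Bseq_def)
  obtain T :: nat where T: "max a K \<le> real T" using real_arch_simple by blast
  have "x n \<in> {0..real T}" for n using K[of n] T x by (auto simp: abs_le_iff)
  moreover have "a \<in> {0..real T}" using a T by auto
  ultimately show "(f \<circ> x) \<longlonglongrightarrow> f a"
    using assms[of T] x unfolding continuous_on_sequentially by blast
qed

lemma continuous_on_polygon:
  assumes "c > 0"
  shows "continuous_on {0..} (polygon c x)"
proof (rule continuous_on_atLeast_0I)
  fix T :: nat
  obtain m :: nat where m: "c * real T \<le> real m" using real_arch_simple by blast
  have "continuous_on {0..real T}
      (\<lambda>t. x 0 + (\<Sum>i<m. max 0 (min 1 (c * t - real i)) *\<^sub>R (x (Suc i) - x i)))"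
    by (intro continuous_intros)
  also have "?this \<longleftrightarrow> continuous_on {0..real T} (polygon c x)"
  proof (intro continuous_on_cong refl polygon_eq_ramps[symmetric])
    fix t assume "t \<in> {0..real T}"
    then have "c * t \<le> c * real T" using assms by (intro mult_left_mono) auto
    then show "c * t \<le> real m" using m by simp
  qed (use assms in auto)
  finally show "continuous_on {0..real T} (polygon c x)" .
qed

definition path_of :: "(real \<Rightarrow> real ^ 'd) \<Rightarrow> real \<Rightarrow> real ^ 'd" where
  "path_of f = (\<lambda>t\<in>{0..}. f t)"

lemma path_of_apply [simp]: "0 \<le> t \<Longrightarrow> path_of f t = f t"
  by (simp add: path_of_def)

lemma path_of_in_cont_paths: "continuous_on {0..} f \<Longrightarrow> path_of f \<in> cont_paths"
  using continuous_on_cong[of "{0..}" "{0..}" "path_of f" f] by (simp add: cont_paths_def path_of_def)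

lemma path_of_cont_path: "f \<in> cont_paths \<Longrightarrow> path_of f = f"
  by (auto simp: cont_paths_def path_of_def extensional_restrict)

interpretation path: Metric_space "cont_paths :: (real \<Rightarrow> real ^ 'd) set" path_dist
  by (rule Metric_space_cont_paths)

lemma path_dist_sup_bounds:
  fixes f g :: "real \<Rightarrow> real ^ 'd"
  defines "S \<equiv> \<lambda>k. SUP t\<in>{0..real (Suc k)}. min (norm (f t - g t)) 1"
  shows path_dist_sup_upper: "t \<in> {0..real (Suc k)} \<Longrightarrow> min (norm (f t - g t)) 1 \<le> S k"
    and path_dist_sup_nonneg: "0 \<le> S k"
    and path_dist_sup_le_1: "S k \<le> 1"
    and path_dist_summable: "summable (\<lambda>k. (1 / 2) ^ Suc k * S k)"
proof -
  have bdd: "bdd_above ((\<lambda>t. min (norm (f t - g t)) 1) ` {0..real (Suc k)})" for k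
    by (rule bdd_aboveI[of _ 1]) auto
  have upper: "min (norm (f t - g t)) 1 \<le> S k" if "t \<in> {0..real (Suc k)}" for t k
    unfolding S_def using that by (rule cSUP_upper[OF _ bdd])
  have nonneg: "0 \<le> S k" for k
    by (rule order_trans[OF _ upper[of 0 k]]) auto
  have le: "S k \<le> 1" for k
    unfolding S_def by (rule cSUP_least) auto
  have geo: "summable (\<lambda>k. (1 / 2 :: real) ^ Suc k)"
    by (simp add: summable_geometric)
  show "summable (\<lambda>k. (1 / 2) ^ Suc k * S k)"
    by (rule summable_comparison_test'[OF geo, of 0])
       (use nonneg le in \<open>auto simp: abs_mult mult_left_le\<close>)
  show "t \<in> {0..real (Suc k)} \<Longrightarrow> min (norm (f t - g t)) 1 \<le> S k" "0 \<le> S k" "S k \<le> 1"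
    using upper nonneg le by auto
qed

lemma geometric_half_sums: "(\<lambda>k. (1 / 2 :: real) ^ Suc k) sums 1"
  using power_half_series by simp

text \<open>The times after \<open>T\<close> enter \<open>path_dist\<close> only through terms with total weight \<open>(1 / 2) ^ T\<close>.\<close>

lemma path_dist_le:
  assumes e: "0 \<le> e" and le: "\<And>t. 0 \<le> t \<Longrightarrow> t \<le> real T \<Longrightarrow> norm (f t - g t) \<le> e"
  shows "path_dist f g \<le> e + (1 / 2) ^ T"
proof -
  let ?h = "\<lambda>k. (1 / 2 :: real) ^ Suc k"
  let ?r = "\<lambda>k. if k < T then 0 else ?h k"
  let ?S = "\<lambda>k. SUP t\<in>{0..real (Suc k)}. min (norm (f t - g t)) 1"
  have "(\<lambda>k. ?r (k + T)) sums ((1 / 2) ^ T)"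
    using sums_mult[OF geometric_half_sums, of "(1 / 2) ^ T"]
    by (simp add: power_add mult.commute mult.left_commute)
  then have r: "?r sums ((1 / 2) ^ T)"
    by (subst (asm) sums_iff_shift) simp
  have sum: "(\<lambda>k. e * ?h k + ?r k) sums (e * 1 + (1 / 2) ^ T)"
    by (intro sums_add sums_mult geometric_half_sums r)
  have "path_dist f g \<le> (\<Sum>k. e * ?h k + ?r k)"
    unfolding path_dist_def
  proof (rule suminf_le)
    fix k
    show "(1 / 2) ^ Suc k * ?S k \<le> e * ?h k + ?r k"
    proof (cases "k < T")
      case True
      have "min (norm (f t - g t)) 1 \<le> e" if "t \<in> {0..real (Suc k)}" for t
      proof -
        have "real (Suc k) \<le> real T" using True by simp
        then have "t \<le> real T" "0 \<le> t" using that by auto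
        from le[OF this(2,1)] show ?thesis by simp
      qed
      then have "?S k \<le> e" by (intro cSUP_least) auto
      then have "?S k * ?h k \<le> e * ?h k" by (intro mult_right_mono) auto
      then show ?thesis using True by (simp add: mult.commute)
    next
      case False
      have "?h k * ?S k \<le> ?h k * 1" by (intro mult_left_mono path_dist_sup_le_1) auto
      moreover have "0 \<le> e * ?h k" using e by simp
      ultimately show ?thesis by (simp only: False if_False mult_1_right)
    qed
  qed (use path_dist_summable sum sums_summable in auto)
  also have "\<dots> = e + (1 / 2) ^ T" using sums_unique[OF sum] by simp
  finally show ?thesis .
qed

lemma min_norm_le_path_dist:
  assumes "t \<in> {0..real (Suc k)}"
  shows "min (norm (f t - g t)) 1 \<le> 2 ^ Suc k * path_dist f g"
proof -
  let ?S = "\<lambda>k. SUP t\<in>{0..real (Suc k)}. min (norm (f t - g t)) 1"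
  have "(\<Sum>k\<in>{k}. (1 / 2) ^ Suc k * ?S k) \<le> path_dist f g"
    unfolding path_dist_def
    by (rule sum_le_suminf[OF path_dist_summable], simp,
        intro mult_nonneg_nonneg path_dist_sup_nonneg) simp
  then have "(1 / 2) ^ Suc k * ?S k \<le> path_dist f g" by simp
  then have "2 ^ Suc k * ((1 / 2) ^ Suc k * ?S k) \<le> 2 ^ Suc k * path_dist f g"
    by (intro mult_left_mono) auto
  moreover have "2 ^ Suc k * ((1 / 2) ^ Suc k * ?S k) = ?S k"
    by (simp add: power_one_over)
  ultimately show ?thesis using path_dist_sup_upper[OF assms, of f g] by linarith
qed

lemma path_dist_tendsto_0:
  assumes "\<And>(T::nat) e. e > 0 \<Longrightarrow>
    \<forall>\<^sub>F n in F. \<forall>t. 0 \<le> t \<and> t \<le> real T \<longrightarrow> norm (f n t - g t) \<le> e"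
  shows "((\<lambda>n. path_dist (f n) g) \<longlongrightarrow> 0) F"
proof (rule tendstoI)
  fix e :: real assume e: "e > 0"
  obtain T where T: "(1 / 2 :: real) ^ T < e / 2"
    using real_arch_pow_inv[of "e / 2" "1 / 2"] e by auto
  from assms[of "e / 2" T] have
    "\<forall>\<^sub>F n in F. \<forall>t. 0 \<le> t \<and> t \<le> real T \<longrightarrow> norm (f n t - g t) \<le> e / 2" using e by simp
  then show "\<forall>\<^sub>F n in F. dist (path_dist (f n) g) 0 < e"
  proof eventually_elim
    case (elim n)
    then have "path_dist (f n) g \<le> e / 2 + (1 / 2) ^ T" using e by (intro path_dist_le) auto
    then show ?case using T path.nonneg[of "f n" g] by (simp add: dist_real_def)
  qed
qed

lemma dyadic_polygon_tendsto:
  assumes f: "f \<in> cont_paths"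
  shows "(\<lambda>l. path_dist (path_of (polygon (2 ^ l) (\<lambda>k. f (real k / 2 ^ l)))) f) \<longlonglongrightarrow> 0"
proof (rule path_dist_tendsto_0)
  fix T :: nat and e :: real assume e: "e > 0"
  have "uniformly_continuous_on {0..real T + 1} f"
    using f by (intro compact_uniformly_continuous) (auto simp: cont_paths_def elim: continuous_on_subset)
  then obtain \<delta> where \<delta>: "\<delta> > 0"
    "\<And>s t. s \<in> {0..real T + 1} \<Longrightarrow> t \<in> {0..real T + 1} \<Longrightarrow> dist s t < \<delta> \<Longrightarrow> dist (f s) (f t) < e"
    unfolding uniformly_continuous_on_def using e by metis
  obtain l0 where l0: "(1 / 2 :: real) ^ l0 < \<delta>" using real_arch_pow_inv[of \<delta> "1 / 2"] \<delta>(1) by auto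
  show "\<forall>\<^sub>F l in sequentially. \<forall>t. 0 \<le> t \<and> t \<le> real T \<longrightarrow>
      norm (path_of (polygon (2 ^ l) (\<lambda>k. f (real k / 2 ^ l))) t - f t) \<le> e"
  proof (intro eventually_sequentiallyI[of l0] allI impI)
    fix l t assume l: "l0 \<le> l" and t: "0 \<le> t \<and> t \<le> real T"
    have c: "(1 / 2 :: real) ^ l < \<delta>"
      by (rule le_less_trans[OF power_decreasing[OF l] l0]) auto
    have t0: "0 \<le> 2 ^ l * t" using t by simp
    obtain k where k: "real k \<le> 2 ^ l * t" "2 ^ l * t < real (k + 1)" using segment_index[OF t0] .
    have node: "norm (f (real j / 2 ^ l) - f t) \<le> e" if "j = k \<or> j = k + 1" for j
    proof -
      have "\<bar>real j - 2 ^ l * t\<bar> \<le> 1" using that k by auto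
      then have "\<bar>real j - 2 ^ l * t\<bar> / 2 ^ l \<le> 1 / 2 ^ l" by (intro divide_right_mono) auto
      moreover have "real j / 2 ^ l - t = (real j - 2 ^ l * t) / 2 ^ l" by (simp add: diff_divide_distrib)
      ultimately have d: "\<bar>real j / 2 ^ l - t\<bar> \<le> (1 / 2) ^ l" by (simp add: power_one_over)
      have "(1 / 2 :: real) ^ l \<le> 1" by (intro power_le_one) auto
      then have "real j / 2 ^ l \<in> {0..real T + 1}" "t \<in> {0..real T + 1}" using d t by (auto simp: abs_le_iff)
      from \<delta>(2)[OF this] d c show ?thesis by (simp add: dist_norm)
    qed
    have "polygon (2 ^ l) (\<lambda>k. f (real k / 2 ^ l)) t - f t
        = polygon (2 ^ l) (\<lambda>k. f (real k / 2 ^ l) - f t) t"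
      using polygon_diff[of "2 ^ l" "\<lambda>k. f (real k / 2 ^ l)" t "\<lambda>_. f t"] by (simp add: polygon_const)
    also have "\<dots> = (f (real k / 2 ^ l) - f t) + (2 ^ l * t - real k) *\<^sub>R
        ((f (real (k + 1) / 2 ^ l) - f t) - (f (real k / 2 ^ l) - f t))"
      by (rule polygon_segment) (use k in auto)
    also have "norm \<dots> \<le> e"
      by (intro norm_convex_le node) (use k in auto)
    finally show "norm (path_of (polygon (2 ^ l) (\<lambda>k. f (real k / 2 ^ l))) t - f t) \<le> e"
      using t by simp
  qed
qed

text \<open>On \<open>[0, T]\<close> the path depends on finitely many nodes only. Hence the uniform topology on compact
  time intervals is compatible with the product topology on node sequences, and a functional of an
  interpolated path becomes a continuous function of a random sequence.\<close>

lemma continuous_map_polygon: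
  assumes "c > 0"
  shows "continuous_map euclidean path_topology
    (\<lambda>x :: nat \<Rightarrow> real ^ 'd. path_of (polygon c x))"
  unfolding continuous_map_def
proof (intro conjI allI impI funcsetI)
  fix x :: "nat \<Rightarrow> real ^ 'd"
  show "path_of (polygon c x) \<in> topspace path_topology"
    using path_of_in_cont_paths[OF continuous_on_polygon[OF assms]] by simp
next
  fix U :: "(real \<Rightarrow> real ^ 'd) set" assume U: "openin path_topology U"
  let ?P = "\<lambda>x :: nat \<Rightarrow> real ^ 'd. path_of (polygon c x)"
  have P: "?P x \<in> cont_paths" for x by (intro path_of_in_cont_paths continuous_on_polygon assms)
  have "\<exists>V. open V \<and> x \<in> V \<and> V \<subseteq> {x. ?P x \<in> U}" if x: "?P x \<in> U" for x
  proof -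
    obtain r where r: "r > 0" "path.mball (?P x) r \<subseteq> U"
      using U x unfolding path.openin_mtopology by blast
    obtain T where T: "(1 / 2 :: real) ^ T < r / 2"
      using real_arch_pow_inv[of "r / 2" "1 / 2"] r by auto
    obtain m :: nat where m: "c * real T + 1 \<le> real m" using real_arch_simple by blast
    define V where "V = (\<Inter>k\<in>{..m}. {y :: nat \<Rightarrow> real ^ 'd. norm (x k - y k) < r / 2})"
    have "open V"
      unfolding V_def by (intro open_INT ballI open_Collect_less continuous_intros) auto
    moreover have "x \<in> V" using r by (simp add: V_def)
    moreover have "V \<subseteq> {x. ?P x \<in> U}"
    proof safe
      fix y assume y: "y \<in> V"
      have "path_dist (?P x) (?P y) \<le> r / 2 + (1 / 2) ^ T"
      proof (rule path_dist_le)
        fix t assume t: "0 \<le> t" "t \<le> real T"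
        have "c * t \<le> c * real T" using assms t by (intro mult_left_mono) auto
        then have k: "k \<le> m" if "real k \<le> c * t + 1" for k
          using that m by (metis (mono_tags) add_le_cancel_right of_nat_le_iff order_trans)
        have "norm (polygon c (\<lambda>k. x k - y k) t) \<le> r / 2"
          by (rule norm_polygon_le) (use t assms k y in \<open>auto simp: V_def intro!: less_imp_le\<close>)
        then show "norm (?P x t - ?P y t) \<le> r / 2"
          using t by (simp add: polygon_diff)
      qed (use r in auto)
      then have "?P y \<in> path.mball (?P x) r" using T P by simp
      then show "?P y \<in> U" using r by auto
    qed
    ultimately show ?thesis by blast
  qed
  then have "open {x. ?P x \<in> U}" by (subst open_subopen) blast
  then show "openin euclidean {x \<in> topspace euclidean. ?P x \<in> U}" by simp
qed

lemma space_borel_of [simp]: "space (borel_of T) = topspace T"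
  unfolding borel_of_def by (rule space_measure_of) (auto dest: openin_subset)

lemma open_in_borel_of: "openin T U \<Longrightarrow> U \<in> sets (borel_of T)"
  unfolding borel_of_def by (rule in_measure_of) (auto dest: openin_subset)

lemma measurable_borel_ofI:
  assumes "\<And>\<omega>. \<omega> \<in> space M \<Longrightarrow> f \<omega> \<in> topspace T"
    and "\<And>U. openin T U \<Longrightarrow> {\<omega> \<in> space M. f \<omega> \<in> U} \<in> sets M"
  shows "f \<in> measurable M (borel_of T)"
  unfolding borel_of_def
  by (rule measurable_measure_of)
     (use assms in \<open>auto dest: openin_subset simp: vimage_def Int_def conj_commute\<close>)

lemma measurable_borel_ofD:
  assumes "f \<in> measurable M (borel_of T)" "openin T U"
  shows "{\<omega> \<in> space M. f \<omega> \<in> U} \<in> sets M"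
  using measurable_sets[OF assms(1) open_in_borel_of[OF assms(2)]]
  by (simp add: vimage_def Int_def conj_commute)

lemma continuous_map_measurable_real:
  assumes "continuous_map T euclideanreal h"
  shows "h \<in> borel_measurable (borel_of T)"
proof (rule borel_measurableI)
  fix S :: "real set" assume "open S"
  then have "openin T {x \<in> topspace T. h x \<in> S}" using assms by (auto simp: continuous_map_def)
  then show "h -` S \<inter> space (borel_of T) \<in> sets (borel_of T)"
    by (auto simp: vimage_def Int_def conj_commute dest!: open_in_borel_of)
qed

lemma measurable_path_of_polygon:
  fixes V :: "nat \<Rightarrow> 'a \<Rightarrow> real ^ 'd"
  assumes c: "c > 0" and V: "\<And>k. V k \<in> borel_measurable M"
  shows "(\<lambda>\<omega>. path_of (polygon c (\<lambda>k. V k \<omega>))) \<in> measurable M (borel_of path_topology)"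
proof (rule measurable_borel_ofI)
  have V': "(\<lambda>\<omega> k. V k \<omega>) \<in> borel_measurable M"
    by (rule measurable_coordinatewise_then_product) (rule V)
  show "path_of (polygon c (\<lambda>k. V k \<omega>)) \<in> topspace path_topology" for \<omega>
    using path_of_in_cont_paths[OF continuous_on_polygon[OF c]] by simp
  fix U :: "(real \<Rightarrow> real ^ 'd) set" assume "openin path_topology U"
  then have "open {x. path_of (polygon c x) \<in> U}"
    using continuous_map_polygon[OF c, where 'd = 'd] by (auto simp: continuous_map_def)
  then have "{x. path_of (polygon c x) \<in> U} \<in> sets borel" by simp
  from measurable_sets[OF V' this]
  show "{\<omega> \<in> space M. path_of (polygon c (\<lambda>k. V k \<omega>)) \<in> U} \<in> sets M"
    by (simp add: vimage_def Int_def conj_commute)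
qed

text \<open>The path is the limit of its dyadic interpolations, which are measurable by the preceding lemma.
  With \<open>r = 1 / (m + 1)\<close>, the open set \<open>G m\<close> consists of the points within \<open>r\<close> of a centre whose ball
  of radius \<open>2 * r\<close> lies in \<open>U\<close>. A limit of points lies in \<open>U\<close> iff for some \<open>m\<close> these points are
  eventually in \<open>G m\<close>.\<close>

lemma measurable_pathI:
  fixes Z :: "'a \<Rightarrow> real \<Rightarrow> real ^ 'd"
  assumes Z: "\<And>\<omega>. \<omega> \<in> space M \<Longrightarrow> Z \<omega> \<in> cont_paths"
    and eval: "\<And>t. 0 \<le> t \<Longrightarrow> (\<lambda>\<omega>. Z \<omega> t) \<in> borel_measurable M"
  shows "Z \<in> measurable M (borel_of path_topology)"
proof (rule measurable_borel_ofI)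
  show "Z \<omega> \<in> topspace path_topology" if "\<omega> \<in> space M" for \<omega> using Z[OF that] by simp
  fix U :: "(real \<Rightarrow> real ^ 'd) set" assume U: "openin path_topology U"
  define Y where "Y l \<omega> = path_of (polygon (2 ^ l) (\<lambda>k. Z \<omega> (real k / 2 ^ l)))" for l \<omega>
  have Y: "Y l \<in> measurable M (borel_of path_topology)" for l
    unfolding Y_def by (intro measurable_path_of_polygon eval) auto
  have Yc: "Y l \<omega> \<in> cont_paths" for l \<omega>
    unfolding Y_def by (intro path_of_in_cont_paths continuous_on_polygon) auto
  define G where "G m = \<Union>{path.mball f (1 / real (Suc m)) |f. path.mball f (2 / real (Suc m)) \<subseteq> U}"
    for m :: nat
  have G: "openin path_topology (G m)" for m
    unfolding G_def by (intro openin_Union) auto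
  have "Z \<omega> \<in> U \<longleftrightarrow> (\<exists>m k. \<forall>l\<ge>k. Y l \<omega> \<in> G m)" if \<omega>: "\<omega> \<in> space M" for \<omega>
  proof
    have lim: "(\<lambda>l. path_dist (Y l \<omega>) (Z \<omega>)) \<longlonglongrightarrow> 0"
      unfolding Y_def by (rule dyadic_polygon_tendsto[OF Z[OF \<omega>]])
    assume "Z \<omega> \<in> U"
    then obtain r where r: "r > 0" "path.mball (Z \<omega>) r \<subseteq> U"
      using U unfolding path.openin_mtopology by blast
    obtain m where m: "2 / real (Suc m) < r"
      using reals_Archimedean[of "r / 2"] r by (auto simp: field_simps)
    have sub: "path.mball (Z \<omega>) (2 / real (Suc m)) \<subseteq> U"
      using r m path.mball_subset_concentric[of "2 / real (Suc m)" r "Z \<omega>"] by auto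
    have "\<forall>\<^sub>F l in sequentially. path_dist (Y l \<omega>) (Z \<omega>) < 1 / real (Suc m)"
      by (rule order_tendstoD(2)[OF lim]) simp
    then obtain k where k: "\<And>l. l \<ge> k \<Longrightarrow> path_dist (Y l \<omega>) (Z \<omega>) < 1 / real (Suc m)"
      by (auto simp: eventually_sequentially)
    have "Y l \<omega> \<in> path.mball (Z \<omega>) (1 / real (Suc m))" if "l \<ge> k" for l
      using k[OF that] Yc Z[OF \<omega>] by (simp add: path.commute)
    then show "\<exists>m k. \<forall>l\<ge>k. Y l \<omega> \<in> G m"
      unfolding G_def using sub by blast
  next
    have lim: "(\<lambda>l. path_dist (Y l \<omega>) (Z \<omega>)) \<longlonglongrightarrow> 0"
      unfolding Y_def by (rule dyadic_polygon_tendsto[OF Z[OF \<omega>]])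
    assume "\<exists>m k. \<forall>l\<ge>k. Y l \<omega> \<in> G m"
    then obtain m k where mk: "\<And>l. l \<ge> k \<Longrightarrow> Y l \<omega> \<in> G m" by blast
    have "\<forall>\<^sub>F l in sequentially. path_dist (Y l \<omega>) (Z \<omega>) < 1 / real (Suc m)"
      by (rule order_tendstoD(2)[OF lim]) simp
    then obtain l where l: "l \<ge> k" "path_dist (Y l \<omega>) (Z \<omega>) < 1 / real (Suc m)"
      unfolding eventually_sequentially by (meson nle_le)
    from mk[OF l(1)] obtain f where f: "Y l \<omega> \<in> path.mball f (1 / real (Suc m))"
        "path.mball f (2 / real (Suc m)) \<subseteq> U"
      unfolding G_def by blast
    have "path_dist f (Z \<omega>) \<le> path_dist f (Y l \<omega>) + path_dist (Y l \<omega>) (Z \<omega>)"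
      using f(1) Z[OF \<omega>] Yc by (intro path.triangle) auto
    also have "\<dots> < 2 / real (Suc m)" using f(1) l(2) by simp
    finally show "Z \<omega> \<in> U" using f Z[OF \<omega>] by auto
  qed
  then have "{\<omega> \<in> space M. Z \<omega> \<in> U} = (\<Union>m. \<Union>k. \<Inter>l\<in>{k..}. {\<omega> \<in> space M. Y l \<omega> \<in> G m})"
    by (auto simp: Bex_def) blast+
  also have "\<dots> \<in> sets M"
    by (intro sets.countable_UN' sets.countable_INT' image_subsetI measurable_borel_ofD[OF Y G]) auto
  finally show "{\<omega> \<in> space M. Z \<omega> \<in> U} \<in> sets M" .
qed

lemma measurable_eval:
  assumes "0 \<le> t"
  shows "(\<lambda>f. f t :: real ^ 'd) \<in> borel_measurable (borel_of path_topology)"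
proof (rule borel_measurableI)
  fix S :: "(real ^ 'd) set" assume S: "open S"
  obtain k :: nat where "t \<le> real k" using real_arch_simple by blast
  then have t: "t \<in> {0..real (Suc k)}" using assms by auto
  have "openin path_topology {f \<in> cont_paths. f t \<in> S}"
    unfolding path.openin_mtopology
  proof (intro conjI allI impI)
    fix f :: "real \<Rightarrow> real ^ 'd" assume f: "f \<in> {f \<in> cont_paths. f t \<in> S}"
    then obtain e where e: "e > 0" "\<And>y. dist y (f t) < e \<Longrightarrow> y \<in> S"
      using S unfolding open_dist by blast
    define r where "r = min e 1 / 2 ^ Suc k"
    have "path.mball f r \<subseteq> {f \<in> cont_paths. f t \<in> S}"
    proof safe
      fix g assume g: "g \<in> path.mball f r"
      then have "2 ^ Suc k * path_dist f g < 2 ^ Suc k * r" by simp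
      also have "\<dots> = min e 1" by (simp add: r_def)
      finally have "min (norm (f t - g t)) 1 < min e 1"
        using min_norm_le_path_dist[OF t, of f g] by linarith
      then have "norm (f t - g t) < e" by (auto simp: min_def split: if_splits)
      then show "g t \<in> S" using e(2) by (simp add: dist_norm norm_minus_commute)
    qed auto
    moreover have "r > 0" using e by (simp add: r_def)
    ultimately show "\<exists>r>0. path.mball f r \<subseteq> {f \<in> cont_paths. f t \<in> S}" by blast
  qed auto
  from open_in_borel_of[OF this]
  show "(\<lambda>f. f t) -` S \<inter> space (borel_of path_topology) \<in> sets (borel_of path_topology)"
    by (simp add: vimage_def Int_def conj_commute)
qed

section \<open>Random sequences of vectors\<close>

definition linear_forms :: "((nat \<Rightarrow> 'e::euclidean_space) \<Rightarrow> real) set" where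
  "linear_forms = {\<lambda>x. \<Sum>i<k. u i \<bullet> x i |k u. True}"

lemma linear_formsI: "(\<lambda>x. \<Sum>i<k. u i \<bullet> x i) \<in> linear_forms"
  unfolding linear_forms_def by auto

lemma linear_form_pad:
  fixes u :: "nat \<Rightarrow> 'e::real_inner"
  shows "k \<le> m \<Longrightarrow> (\<Sum>i<k. u i \<bullet> x i) = (\<Sum>i<m. (if i < k then u i else 0) \<bullet> x i)"
  by (rule sum.mono_neutral_cong_left) auto

interpretation linear_forms: frequency_space "linear_forms :: ((nat \<Rightarrow> 'e::euclidean_space) \<Rightarrow> real) set"
proof
  show "(\<lambda>_ :: nat \<Rightarrow> 'e. 0) \<in> linear_forms"
    using linear_formsI[where k=0] by simp
next
  fix L K :: "(nat \<Rightarrow> 'e) \<Rightarrow> real"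
  assume "L \<in> linear_forms" "K \<in> linear_forms"
  then obtain k u m v where L: "L = (\<lambda>x. \<Sum>i<k. u i \<bullet> x i)" and K: "K = (\<lambda>x. \<Sum>i<m. v i \<bullet> x i)"
    unfolding linear_forms_def by auto
  have "(\<lambda>x. L x + K x) = (\<lambda>x. \<Sum>i<max k m. ((if i < k then u i else 0) + (if i < m then v i else 0)) \<bullet> x i)"
    unfolding L K linear_form_pad[OF max.cobounded1[of k m]] linear_form_pad[OF max.cobounded2[of m k]]
    by (simp only: inner_add_left sum.distrib)
  also have "\<dots> \<in> linear_forms" by (rule linear_formsI)
  finally show "(\<lambda>x. L x + K x) \<in> linear_forms" .
next
  fix L :: "(nat \<Rightarrow> 'e) \<Rightarrow> real" and c
  assume "L \<in> linear_forms"
  then obtain k u where L: "L = (\<lambda>x. \<Sum>i<k. u i \<bullet> x i)" unfolding linear_forms_def by auto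
  have "(\<lambda>x. c * L x) = (\<lambda>x. \<Sum>i<k. (c *\<^sub>R u i) \<bullet> x i)" by (simp add: L sum_distrib_left)
  also have "\<dots> \<in> linear_forms" by (rule linear_formsI)
  finally show "(\<lambda>x. c * L x) \<in> linear_forms" .
next
  fix L :: "(nat \<Rightarrow> 'e) \<Rightarrow> real"
  assume "L \<in> linear_forms"
  then show "continuous_on UNIV L"
    unfolding linear_forms_def by (auto intro!: continuous_intros)
next
  fix x y :: "nat \<Rightarrow> 'e" assume "x \<noteq> y"
  then obtain j where j: "x j \<noteq> y j" by auto
  define u where "u i = (if i = j then x j - y j else 0)" for i
  have *: "(\<Sum>i<Suc j. u i \<bullet> z i) = (x j - y j) \<bullet> z j" for z
    by (simp add: u_def)
  have "(x j - y j) \<bullet> x j - (x j - y j) \<bullet> y j = (x j - y j) \<bullet> (x j - y j)"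
    by (simp add: inner_diff_right)
  then have "(x j - y j) \<bullet> x j \<noteq> (x j - y j) \<bullet> y j" using j by auto
  then show "\<exists>L\<in>linear_forms. L x \<noteq> L y"
    by (intro bexI[OF _ linear_formsI[where k="Suc j" and u=u]]) (simp only: * not_False_eq_True)
qed

lemma compact_box_sequences: "compact {x :: nat \<Rightarrow> 'e::euclidean_space. \<forall>i. norm (x i) \<le> R i}"
proof -
  have "compactin (product_topology (\<lambda>_. euclidean) UNIV) (PiE UNIV (\<lambda>i. cball (0::'e) (R i)))"
    by (subst compactin_PiE) simp
  also have "PiE UNIV (\<lambda>i. cball (0::'e) (R i)) = {x. \<forall>i. norm (x i) \<le> R i}"
    by (auto simp: PiE_UNIV_domain Pi_def)
  finally show ?thesis by (simp add: euclidean_product_topology)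
qed

lemma (in prob_space) norm_tight:
  fixes X :: "'a \<Rightarrow> 'e::euclidean_space"
  assumes X [measurable]: "X \<in> borel_measurable M" and e: "e > 0"
  obtains R where "prob {\<omega> \<in> space M. norm (X \<omega>) > R} \<le> e"
proof -
  let ?A = "\<lambda>m::nat. {\<omega> \<in> space M. norm (X \<omega>) > real m}"
  have "(\<lambda>m. prob (?A m)) \<longlonglongrightarrow> prob (\<Inter>m. ?A m)"
  proof (rule finite_Lim_measure_decseq)
    have "?A m \<in> events" for m by measurable
    then show "range ?A \<subseteq> events" by (rule image_subsetI)
    show "decseq ?A" unfolding decseq_def by auto
  qed
  also have "(\<Inter>m. ?A m) = {}"
  proof -
    have False if "\<omega> \<in> (\<Inter>m. ?A m)" for \<omega>
    proof -
      obtain m where "norm (X \<omega>) \<le> real m" using real_arch_simple by blast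
      moreover have "\<omega> \<in> ?A m" using that by (rule INT_D) simp
      ultimately show False by simp
    qed
    then show ?thesis by blast
  qed
  finally have "(\<lambda>m. prob (?A m)) \<longlonglongrightarrow> 0" by simp
  from eventually_happens'[OF sequentially_bot order_tendstoD(2)[OF this e]]
  obtain m where "prob (?A m) < e" ..
  then show ?thesis by (intro that[of "real m"] less_imp_le)
qed

text \<open>The \<open>i\<close>-th coordinate may leave its ball with probability \<open>e * (1 / 2) ^ Suc i\<close>; these sum to \<open>e\<close>.\<close>

lemma (in prob_space) outside_box_le:
  fixes V :: "'a \<Rightarrow> nat \<Rightarrow> 'e::euclidean_space"
  assumes V: "\<And>i. (\<lambda>\<omega>. V \<omega> i) \<in> borel_measurable M"
    and R: "\<And>i. prob {\<omega> \<in> space M. norm (V \<omega> i) > R i} \<le> e * (1 / 2) ^ Suc i"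
  shows "prob {\<omega> \<in> space M. V \<omega> \<notin> {x. \<forall>i. norm (x i) \<le> R i}} \<le> e"
proof -
  note [measurable] = V
  let ?A = "\<lambda>i. {\<omega> \<in> space M. norm (V \<omega> i) > R i}"
  have sums: "(\<lambda>i. e * (1 / 2) ^ Suc i) sums (e * 1)"
    by (intro sums_mult geometric_half_sums)
  have summable: "summable (\<lambda>i. prob (?A i))"
    by (rule summable_comparison_test'[OF sums_summable[OF sums]]) (use R in auto)
  have "prob {\<omega> \<in> space M. V \<omega> \<notin> {x. \<forall>i. norm (x i) \<le> R i}} \<le> prob (\<Union>i. ?A i)"
    by (rule finite_measure_mono) (auto simp: not_le)
  also have "\<dots> \<le> (\<Sum>i. prob (?A i))"
    by (rule finite_measure_subadditive_countably[OF _ summable]) auto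
  also have "\<dots> \<le> (\<Sum>i. e * (1 / 2) ^ Suc i)"
    by (rule suminf_le[OF R summable sums_summable[OF sums]])
  also have "\<dots> = e" using sums_unique[OF sums] by simp
  finally show ?thesis .
qed

text \<open>Finite linear combinations of coordinates separate sequences, and by Tychonoff's theorem tightness
  of each coordinate gives tightness of the sequences: the compact sets are products of balls.\<close>

theorem sequence_weak_convergence:
  fixes V :: "nat \<Rightarrow> 'a \<Rightarrow> nat \<Rightarrow> 'e::euclidean_space" and Z :: "'b \<Rightarrow> nat \<Rightarrow> 'e"
    and f :: "(nat \<Rightarrow> 'e) \<Rightarrow> real"
  assumes M: "prob_space M" and N: "prob_space N"
    and V: "\<And>n i. (\<lambda>\<omega>. V n \<omega> i) \<in> borel_measurable M"
    and Z: "\<And>i. (\<lambda>\<omega>. Z \<omega> i) \<in> borel_measurable N"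
    and tight: "\<And>i e. e > 0 \<Longrightarrow> \<exists>R. \<forall>n. measure M {\<omega> \<in> space M. norm (V n \<omega> i) > R} \<le> e"
    and char: "\<And>k u. (\<lambda>n. CLINT \<omega>|M. iexp (\<Sum>i<k. u i \<bullet> V n \<omega> i))
      \<longlonglongrightarrow> (CLINT \<omega>|N. iexp (\<Sum>i<k. u i \<bullet> Z \<omega> i))"
    and f: "continuous_on UNIV f" and B: "\<And>x. \<bar>f x\<bar> \<le> B"
  shows "(\<lambda>n. \<integral>\<omega>. f (V n \<omega>) \<partial>M) \<longlonglongrightarrow> (\<integral>\<omega>. f (Z \<omega>) \<partial>N)"
proof (rule linear_forms.weak_convergence_of_char[OF M N _ _ _ _ f B])
  interpret M: prob_space M by fact
  interpret N: prob_space N by fact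
  show "V n \<in> borel_measurable M" for n
    by (rule measurable_coordinatewise_then_product) (rule V)
  show "Z \<in> borel_measurable N"
    by (rule measurable_coordinatewise_then_product) (rule Z)
  show "(\<lambda>n. CLINT \<omega>|M. iexp (L (V n \<omega>))) \<longlonglongrightarrow> (CLINT \<omega>|N. iexp (L (Z \<omega>)))"
    if L: "L \<in> linear_forms" for L
  proof -
    obtain k u where "L = (\<lambda>x. \<Sum>i<k. u i \<bullet> x i)" using L unfolding linear_forms_def by auto
    then show ?thesis using char[of u k] by simp
  qed
  fix e :: real assume e: "e > 0"
  define \<epsilon> where "\<epsilon> i = e * (1 / 2) ^ Suc i" for i
  have \<epsilon>: "\<epsilon> i > 0" for i using e by (simp add: \<epsilon>_def)
  have "\<forall>i. \<exists>R. \<forall>n. measure M {\<omega> \<in> space M. norm (V n \<omega> i) > R} \<le> \<epsilon> i"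
    by (intro allI tight \<epsilon>)
  from choice[OF this] obtain R where R: "\<And>i n. measure M {\<omega> \<in> space M. norm (V n \<omega> i) > R i} \<le> \<epsilon> i"
    by auto
  have "\<forall>i. \<exists>R. measure N {\<omega> \<in> space N. norm (Z \<omega> i) > R} \<le> \<epsilon> i"
  proof
    fix i
    obtain R where "measure N {\<omega> \<in> space N. norm (Z \<omega> i) > R} \<le> \<epsilon> i"
      by (rule N.norm_tight[OF Z \<epsilon>])
    then show "\<exists>R. measure N {\<omega> \<in> space N. norm (Z \<omega> i) > R} \<le> \<epsilon> i" ..
  qed
  from choice[OF this] obtain R' where R': "\<And>i. measure N {\<omega> \<in> space N. norm (Z \<omega> i) > R' i} \<le> \<epsilon> i"
    by auto
  define D where "D i = max (R i) (R' i)" for i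
  note [measurable] = V Z
  have MD: "measure M {\<omega> \<in> space M. norm (V n \<omega> i) > D i} \<le> \<epsilon> i" for n i
    by (rule order_trans[OF M.finite_measure_mono R]) (auto simp: D_def)
  have ND: "measure N {\<omega> \<in> space N. norm (Z \<omega> i) > D i} \<le> \<epsilon> i" for i
    by (rule order_trans[OF N.finite_measure_mono R']) (auto simp: D_def)
  show "\<exists>S. compact S \<and> (\<forall>n. measure M {\<omega> \<in> space M. V n \<omega> \<notin> S} \<le> e) \<and>
      measure N {\<omega> \<in> space N. Z \<omega> \<notin> S} \<le> e"
    by (intro exI[of _ "{x. \<forall>i. norm (x i) \<le> D i}"] conjI allI compact_box_sequences
        M.outside_box_le[OF V MD[unfolded \<epsilon>_def]] N.outside_box_le[OF Z ND[unfolded \<epsilon>_def]])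
qed

text \<open>The indicator of a closed set \<open>C\<close> is the pointwise limit of the bounded continuous functions
  \<open>max 0 (1 - m * infdist x C)\<close>, and the closed sets form a generator stable under
  intersections.\<close>

lemma borel_measure_eqI_continuous:
  fixes P Q :: "'x::metric_space measure"
  assumes P: "prob_space P" and Q: "prob_space Q" and sets: "sets P = sets borel" "sets Q = sets borel"
    and eq: "\<And>f. continuous_on UNIV f \<Longrightarrow> (\<And>x. \<bar>f x\<bar> \<le> 1) \<Longrightarrow> (\<integral>x. f x \<partial>P) = (\<integral>x. (f x :: real) \<partial>Q)"
  shows "P = Q"
proof -
  interpret P: prob_space P by fact
  interpret Q: prob_space Q by fact
  have closed_eq: "measure P C = measure Q C" if C: "closed C" for C
  proof (cases "C = {}")
    case False
    define f where "f m x = max 0 (1 - real m * infdist x C)" for m x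
    have cont: "continuous_on UNIV (f m)" for m
      unfolding f_def by (intro continuous_intros)
    have f1: "\<bar>f m x\<bar> \<le> 1" for m x
      using infdist_nonneg[of x C] by (simp add: f_def)
    have lim: "(\<lambda>m. f m x) \<longlonglongrightarrow> indicator C x" for x
    proof (cases "x \<in> C")
      case True
      then show ?thesis by (simp add: f_def)
    next
      case nin: False
      then have pos: "infdist x C > 0"
        using in_closed_iff_infdist_zero[OF C False, of x] infdist_nonneg[of x C] by simp
      obtain m0 :: nat where m0: "1 < real m0 * infdist x C" using ex_less_of_nat_mult[OF pos] by blast
      have "f m x = 0" if "m \<ge> m0" for m
      proof -
        have "real m0 * infdist x C \<le> real m * infdist x C"
          using that by (intro mult_right_mono infdist_nonneg) auto
        then show ?thesis using m0 by (simp add: f_def)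
      qed
      then show ?thesis using nin
        by (auto intro!: tendsto_eventually eventually_sequentiallyI[of m0])
    qed
    have int: "(\<lambda>m. \<integral>x. f m x \<partial>R) \<longlonglongrightarrow> measure R C" if R: "prob_space R" "sets R = sets borel" for R
    proof -
      interpret R: prob_space R by fact
      have [measurable]: "f m \<in> borel_measurable R" for m
        using borel_measurable_continuous_onI[OF cont, of m] by (simp add: measurable_cong_sets[OF R(2) refl])
      have CR: "C \<in> R.events" using C R(2) by simp
      have "(\<lambda>m. \<integral>x. f m x \<partial>R) \<longlonglongrightarrow> (\<integral>x. indicator C x \<partial>R)"
        by (rule integral_dominated_convergence[where w="\<lambda>_. 1"])
           (use CR lim f1 in auto)
      then show ?thesis using CR sets.sets_into_space[OF CR] by (simp add: Int_absorb2)
    qed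
    have "(\<integral>x. f m x \<partial>P) = (\<integral>x. f m x \<partial>Q)" for m by (rule eq[OF cont f1])
    then show ?thesis using int[OF P sets(1)] int[OF Q sets(2)] LIMSEQ_unique by simp
  qed simp
  show ?thesis
  proof (rule measure_eqI_generator_eq[where E="{C. closed C}" and \<Omega>=UNIV and A="\<lambda>_. UNIV"])
    show "Int_stable {C. closed (C :: 'x set)}" by (auto simp: Int_stable_def)
    show "sets P = sigma_sets UNIV {C. closed C}" "sets Q = sigma_sets UNIV {C. closed C}"
      by (simp_all add: sets borel_eq_closed)
  qed (use closed_eq in \<open>auto simp: P.emeasure_eq_measure Q.emeasure_eq_measure\<close>)
qed

text \<open>Uniqueness is the convergence theorem for a constant sequence of laws.\<close>

theorem sequence_law_eq:
  fixes V :: "'a \<Rightarrow> nat \<Rightarrow> 'e::euclidean_space" and Z :: "'b \<Rightarrow> nat \<Rightarrow> 'e"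
  assumes M: "prob_space M" and N: "prob_space N"
    and V: "\<And>i. (\<lambda>\<omega>. V \<omega> i) \<in> borel_measurable M"
    and Z: "\<And>i. (\<lambda>\<omega>. Z \<omega> i) \<in> borel_measurable N"
    and char: "\<And>k u. (CLINT \<omega>|M. iexp (\<Sum>i<k. u i \<bullet> V \<omega> i)) = (CLINT \<omega>|N. iexp (\<Sum>i<k. u i \<bullet> Z \<omega> i))"
  shows "distr M borel V = distr N borel Z"
proof (rule borel_measure_eqI_continuous)
  interpret M: prob_space M by fact
  interpret N: prob_space N by fact
  have [measurable]: "V \<in> borel_measurable M" "Z \<in> borel_measurable N"
    using V Z by (auto intro: measurable_coordinatewise_then_product)
  show "prob_space (distr M borel V)" "prob_space (distr N borel Z)"
    by (auto intro: M.prob_space_distr N.prob_space_distr)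
  fix f :: "(nat \<Rightarrow> 'e) \<Rightarrow> real" assume f: "continuous_on UNIV f" "\<And>x. \<bar>f x\<bar> \<le> 1"
  have [measurable]: "f \<in> borel_measurable borel" by (rule borel_measurable_continuous_onI[OF f(1)])
  have "(\<lambda>n::nat. \<integral>\<omega>. f (V \<omega>) \<partial>M) \<longlonglongrightarrow> (\<integral>\<omega>. f (Z \<omega>) \<partial>N)"
  proof (rule sequence_weak_convergence[OF M N V Z _ _ f])
    show "\<exists>R. \<forall>n::nat. M.prob {\<omega> \<in> space M. norm (V \<omega> i) > R} \<le> e" if "e > 0" for i e
    proof -
      obtain R where "M.prob {\<omega> \<in> space M. norm (V \<omega> i) > R} \<le> e"
        by (rule M.norm_tight[OF V \<open>e > 0\<close>])
      then show ?thesis by blast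
    qed
  qed (simp only: char tendsto_const)
  then have "(\<integral>\<omega>. f (V \<omega>) \<partial>M) = (\<integral>\<omega>. f (Z \<omega>) \<partial>N)"
    using LIMSEQ_unique[OF tendsto_const] by blast
  then show "(\<integral>x. f x \<partial>distr M borel V) = (\<integral>x. f x \<partial>distr N borel Z)"
    by (simp add: integral_distr)
qed auto

lemma indep_vars_of_law_eq:
  fixes V :: "'a \<Rightarrow> nat \<Rightarrow> 'e::euclidean_space" and Z :: "'b \<Rightarrow> nat \<Rightarrow> 'e"
  assumes M: "prob_space M" and N: "prob_space N"
    and V: "\<And>i. (\<lambda>\<omega>. V \<omega> i) \<in> borel_measurable M"
    and indep: "prob_space.indep_vars N (\<lambda>_. borel) (\<lambda>i \<omega>. Z \<omega> i) UNIV"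
    and law: "distr M borel V = distr N borel Z"
  shows "prob_space.indep_vars M (\<lambda>_. borel) (\<lambda>i \<omega>. V \<omega> i) UNIV"
proof -
  interpret M: prob_space M by fact
  interpret N: prob_space N by fact
  let ?P = "PiM UNIV (\<lambda>_::nat. borel :: 'e measure)"
  have Z: "(\<lambda>\<omega>. Z \<omega> i) \<in> borel_measurable N" for i using indep by (auto simp: N.indep_vars_def)
  have VZ: "V \<in> borel_measurable M" "Z \<in> borel_measurable N"
    using V Z by (auto intro: measurable_coordinatewise_then_product)
  have coord: "distr M borel (\<lambda>\<omega>. V \<omega> i) = distr N borel (\<lambda>\<omega>. Z \<omega> i)" for i
  proof -
    have m: "(\<lambda>x :: nat \<Rightarrow> 'e. x i) \<in> borel_measurable borel"
      by (intro borel_measurable_continuous_onI) simp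
    have "distr M borel (\<lambda>\<omega>. V \<omega> i) = distr (distr M borel V) borel (\<lambda>x. x i)"
      by (subst distr_distr[OF m VZ(1)]) (simp add: comp_def)
    also have "\<dots> = distr N borel (\<lambda>\<omega>. Z \<omega> i)"
      unfolding law by (subst distr_distr[OF m VZ(2)]) (simp add: comp_def)
    finally show ?thesis .
  qed
  have P: "distr M ?P V = distr M borel V" "distr N ?P Z = distr N borel Z"
    by (auto intro!: distr_cong simp: sets_PiM_equal_borel)
  have "distr N ?P (\<lambda>\<omega>. \<lambda>i\<in>UNIV. Z \<omega> i) = (\<Pi>\<^sub>M i\<in>UNIV. distr N borel (\<lambda>\<omega>. Z \<omega> i))"
    using indep N.indep_vars_iff_distr_eq_PiM[where I=UNIV and M'="\<lambda>_. borel" and X="\<lambda>i \<omega>. Z \<omega> i"] Z by simp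
  then have "distr M ?P (\<lambda>\<omega>. \<lambda>i\<in>UNIV. V \<omega> i) = (\<Pi>\<^sub>M i\<in>UNIV. distr M borel (\<lambda>\<omega>. V \<omega> i))"
    using law P coord by (simp add: restrict_UNIV)
  then show ?thesis
    using M.indep_vars_iff_distr_eq_PiM[where I=UNIV and M'="\<lambda>_. borel" and X="\<lambda>i \<omega>. V \<omega> i"] V by simp
qed

section \<open>Lipschitz test functions\<close>

lemma (in Metric_space) continuous_map_lipschitz:
  assumes "\<And>x y. x \<in> M \<Longrightarrow> y \<in> M \<Longrightarrow> \<bar>g x - g y\<bar> \<le> L * d x y"
  shows "continuous_map mtopology euclideanreal g"
  unfolding continuous_map_def
proof (intro conjI allI impI funcsetI)
  fix U :: "real set" assume "openin euclideanreal U"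
  then have U: "open U" by simp
  show "openin mtopology {x \<in> topspace mtopology. g x \<in> U}"
    unfolding openin_mtopology
  proof (intro conjI allI impI)
    fix x assume x: "x \<in> {x \<in> topspace mtopology. g x \<in> U}"
    then obtain e where e: "e > 0" "\<And>y. dist y (g x) < e \<Longrightarrow> y \<in> U"
      using U unfolding open_dist by auto
    define r where "r = e / (\<bar>L\<bar> + 1)"
    have "mball x r \<subseteq> {x \<in> topspace mtopology. g x \<in> U}"
    proof
      fix y assume y: "y \<in> mball x r"
      have "\<bar>g y - g x\<bar> \<le> L * d y x" using assms[of y x] x y by simp
      also have "\<dots> \<le> (\<bar>L\<bar> + 1) * d y x" by (intro mult_right_mono) auto
      also have "\<dots> < (\<bar>L\<bar> + 1) * r" using y by (intro mult_strict_left_mono) (auto simp: commute)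
      also have "\<dots> = e" by (simp add: r_def)
      finally show "y \<in> {x \<in> topspace mtopology. g x \<in> U}"
        using y e(2)[of "g y"] by (simp add: dist_real_def)
    qed
    moreover have "r > 0" using e by (simp add: r_def)
    ultimately show "\<exists>r>0. mball x r \<subseteq> {x \<in> topspace mtopology. g x \<in> U}" by blast
  qed auto
qed auto

context Metric_space
begin

text \<open>The infimal convolution of \<open>h\<close> with \<open>k\<close> times the distance: the largest function below \<open>h\<close> that
  is Lipschitz with constant \<open>k\<close>.\<close>

definition lipschitz_minorant :: "('a \<Rightarrow> real) \<Rightarrow> nat \<Rightarrow> 'a \<Rightarrow> real" where
  "lipschitz_minorant h k x = (INF y\<in>M. h y + real k * d x y)"

context
  fixes h :: "'a \<Rightarrow> real" and B :: real
  assumes B: "\<And>x. x \<in> M \<Longrightarrow> \<bar>h x\<bar> \<le> B"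
begin

lemma lipschitz_minorant_bdd: "bdd_below ((\<lambda>y. h y + real k * d x y) ` M)"
proof (rule bdd_belowI2[of _ "- B"])
  fix y assume "y \<in> M"
  moreover have "0 \<le> real k * d x y" by simp
  ultimately show "- B \<le> h y + real k * d x y" using B[of y] by linarith
qed

lemma lipschitz_minorant_le: "y \<in> M \<Longrightarrow> lipschitz_minorant h k x \<le> h y + real k * d x y"
  unfolding lipschitz_minorant_def by (rule cINF_lower[OF lipschitz_minorant_bdd])

lemma lipschitz_minorant_le_self: "x \<in> M \<Longrightarrow> lipschitz_minorant h k x \<le> h x"
  using lipschitz_minorant_le[of x k x] by simp

lemma lipschitz_minorant_abs_le:
  assumes "x \<in> M" shows "\<bar>lipschitz_minorant h k x\<bar> \<le> B"
proof -
  have "- B \<le> lipschitz_minorant h k x"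
    unfolding lipschitz_minorant_def
  proof (rule cINF_greatest)
    fix y assume "y \<in> M"
    moreover have "0 \<le> real k * d x y" by simp
    ultimately show "- B \<le> h y + real k * d x y" using B[of y] by linarith
  qed (use assms in auto)
  then show ?thesis using lipschitz_minorant_le_self[OF assms, of k] B[OF assms] by linarith
qed

lemma lipschitz_minorant_lipschitz:
  assumes "x \<in> M" "y \<in> M"
  shows "\<bar>lipschitz_minorant h k x - lipschitz_minorant h k y\<bar> \<le> real k * d x y"
proof -
  have *: "lipschitz_minorant h k x - real k * d x y \<le> lipschitz_minorant h k y"
    if "x \<in> M" "y \<in> M" for x y
    unfolding lipschitz_minorant_def[of h k y]
  proof (rule cINF_greatest)
    fix z assume z: "z \<in> M"
    have "real k * d x z \<le> real k * (d x y + d y z)"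
      using that z by (intro mult_left_mono triangle) auto
    then show "lipschitz_minorant h k x - real k * d x y \<le> h z + real k * d y z"
      using lipschitz_minorant_le[OF z, of k x] by (simp add: distrib_left)
  qed (use that in auto)
  show ?thesis using *[OF assms] *[OF assms(2,1)] by (simp add: commute abs_le_iff)
qed

lemma lipschitz_minorant_tendsto:
  assumes h: "continuous_map mtopology euclideanreal h" and x: "x \<in> M"
  shows "(\<lambda>k. lipschitz_minorant h k x) \<longlonglongrightarrow> h x"
proof (rule order_tendstoI)
  show "\<forall>\<^sub>F k in sequentially. lipschitz_minorant h k x < a" if "h x < a" for a
    using lipschitz_minorant_le_self[OF x] that by (intro always_eventually) (meson le_less_trans)
next
  fix a assume a: "a < h x"
  define b where "b = (a + h x) / 2"
  have b: "a < b" "b < h x" using a by (auto simp: b_def)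
  have "openin mtopology {y \<in> topspace mtopology. h y \<in> {b<..}}"
    by (rule openin_continuous_map_preimage[OF h]) simp
  then obtain r where r: "r > 0" "mball x r \<subseteq> {y \<in> topspace mtopology. h y \<in> {b<..}}"
    using x b unfolding openin_mtopology by auto
  obtain k0 :: nat where k0: "2 * B < real k0 * r" using ex_less_of_nat_mult[OF r(1)] by blast
  have "b \<le> lipschitz_minorant h k x" if "k \<ge> k0" for k
    unfolding lipschitz_minorant_def
  proof (rule cINF_greatest)
    fix y assume y: "y \<in> M"
    show "b \<le> h y + real k * d x y"
    proof (cases "d x y < r")
      case True
      then have "b < h y" using r(2) x y by auto
      moreover have "0 \<le> real k * d x y" by simp
      ultimately show ?thesis by linarith
    next
      case False
      have "real k0 * r \<le> real k * d x y" using that False r by (intro mult_mono) auto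
      then show ?thesis using k0 B[OF x] B[OF y] b by linarith
    qed
  qed (use x in auto)
  then show "\<forall>\<^sub>F k in sequentially. a < lipschitz_minorant h k x"
    using b by (intro eventually_sequentiallyI[of k0]) (meson less_le_trans)
qed

end

text \<open>Along \<open>Y\<close> the function \<open>h\<close> dominates each of its minorants, whose integrals converge by hypothesis,
  and the integrals of the minorants against the limit law approach the integral of \<open>h\<close>.\<close>

lemma liminf_from_lipschitz:
  fixes Y :: "nat \<Rightarrow> 'p \<Rightarrow> 'a" and Z :: "'q \<Rightarrow> 'a"
  assumes P: "prob_space P" and Q: "prob_space Q"
    and Y: "\<And>n. n \<ge> 1 \<Longrightarrow> Y n \<in> measurable P (borel_of mtopology)"
    and Z: "Z \<in> measurable Q (borel_of mtopology)"
    and lip: "\<And>g L. (\<And>x y. x \<in> M \<Longrightarrow> y \<in> M \<Longrightarrow> \<bar>g x - g y\<bar> \<le> L * d x y) \<Longrightarrow>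
      (\<And>x. x \<in> M \<Longrightarrow> \<bar>g x\<bar> \<le> B) \<Longrightarrow> 0 \<le> L \<Longrightarrow>
      (\<lambda>n. \<integral>\<omega>. g (Y n \<omega>) \<partial>P) \<longlonglongrightarrow> (\<integral>\<omega>. g (Z \<omega>) \<partial>Q)"
    and h: "continuous_map mtopology euclideanreal h" and B: "\<And>x. x \<in> M \<Longrightarrow> \<bar>h x\<bar> \<le> B"
    and a: "a < (\<integral>\<omega>. h (Z \<omega>) \<partial>Q)"
  shows "\<forall>\<^sub>F n in sequentially. a < (\<integral>\<omega>. h (Y n \<omega>) \<partial>P)"
proof -
  interpret P: prob_space P by fact
  interpret Q: prob_space Q by fact
  let ?g = "lipschitz_minorant h"
  have g_meas: "?g k \<in> borel_measurable (borel_of mtopology)" for k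
    by (intro continuous_map_measurable_real continuous_map_lipschitz[of _ "real k"]
        lipschitz_minorant_lipschitz[OF B])
  have h_meas: "h \<in> borel_measurable (borel_of mtopology)" by (rule continuous_map_measurable_real[OF h])
  have YM: "Y n \<omega> \<in> M" if "\<omega> \<in> space P" "n \<ge> 1" for n \<omega>
    using measurable_space[OF Y[OF that(2)] that(1)] by simp
  have ZM: "Z \<omega> \<in> M" if "\<omega> \<in> space Q" for \<omega>
    using measurable_space[OF Z that] by simp
  have "(\<lambda>k. \<integral>\<omega>. ?g k (Z \<omega>) \<partial>Q) \<longlonglongrightarrow> (\<integral>\<omega>. h (Z \<omega>) \<partial>Q)"
  proof (rule integral_dominated_convergence[where w="\<lambda>_. B"])
    show "(\<lambda>\<omega>. ?g k (Z \<omega>)) \<in> borel_measurable Q" for k by (rule measurable_compose[OF Z g_meas])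
    show "(\<lambda>\<omega>. h (Z \<omega>)) \<in> borel_measurable Q" by (rule measurable_compose[OF Z h_meas])
    show "AE \<omega> in Q. (\<lambda>k. ?g k (Z \<omega>)) \<longlonglongrightarrow> h (Z \<omega>)"
      using lipschitz_minorant_tendsto[OF B h ZM] by (intro AE_I2)
    show "AE \<omega> in Q. norm (?g k (Z \<omega>)) \<le> B" for k
      using lipschitz_minorant_abs_le[OF B ZM] by (intro AE_I2) simp
  qed simp
  from order_tendstoD(1)[OF this a] obtain k where k: "a < (\<integral>\<omega>. ?g k (Z \<omega>) \<partial>Q)"
    by (auto dest: eventually_happens)
  have "(\<lambda>n. \<integral>\<omega>. ?g k (Y n \<omega>) \<partial>P) \<longlonglongrightarrow> (\<integral>\<omega>. ?g k (Z \<omega>) \<partial>Q)"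
    by (rule lip[of _ "real k"]) (auto intro: lipschitz_minorant_lipschitz[OF B] lipschitz_minorant_abs_le[OF B])
  from order_tendstoD(1)[OF this k] eventually_ge_at_top[of 1]
  show ?thesis
  proof eventually_elim
    case (elim n)
    have "(\<integral>\<omega>. ?g k (Y n \<omega>) \<partial>P) \<le> (\<integral>\<omega>. h (Y n \<omega>) \<partial>P)"
    proof (rule integral_mono)
      show "integrable P (\<lambda>\<omega>. ?g k (Y n \<omega>))"
        by (rule P.integrable_const_bound[of _ B])
           (use measurable_compose[OF Y g_meas] elim lipschitz_minorant_abs_le[OF B YM] in \<open>auto intro!: AE_I2\<close>)
      show "integrable P (\<lambda>\<omega>. h (Y n \<omega>))"
        by (rule P.integrable_const_bound[of _ B])
           (use measurable_compose[OF Y h_meas] elim B[OF YM] in \<open>auto intro!: AE_I2\<close>)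
      show "?g k (Y n \<omega>) \<le> h (Y n \<omega>)" if "\<omega> \<in> space P" for \<omega>
        using lipschitz_minorant_le_self[OF B YM] that elim by simp
    qed
    then show ?case using elim by simp
  qed
qed

theorem converges_in_distribution_lipschitzI:
  fixes Y :: "nat \<Rightarrow> 'p \<Rightarrow> 'a" and Z :: "'q \<Rightarrow> 'a"
  assumes P: "prob_space P" and Q: "prob_space Q"
    and Y: "\<And>n. n \<ge> 1 \<Longrightarrow> Y n \<in> measurable P (borel_of mtopology)"
    and Z: "Z \<in> measurable Q (borel_of mtopology)"
    and lip: "\<And>g L B. (\<And>x y. x \<in> M \<Longrightarrow> y \<in> M \<Longrightarrow> \<bar>g x - g y\<bar> \<le> L * d x y) \<Longrightarrow>
      (\<And>x. x \<in> M \<Longrightarrow> \<bar>g x\<bar> \<le> B) \<Longrightarrow> 0 \<le> L \<Longrightarrow>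
      (\<lambda>n. \<integral>\<omega>. g (Y n \<omega>) \<partial>P) \<longlonglongrightarrow> (\<integral>\<omega>. g (Z \<omega>) \<partial>Q)"
  shows "converges_in_distribution mtopology P Y Q Z"
  unfolding converges_in_distribution_def
proof (intro conjI allI impI Y Z)
  fix h assume h: "continuous_map mtopology euclideanreal h \<and> bounded (h ` topspace mtopology)"
  then obtain B where B: "\<And>x. x \<in> M \<Longrightarrow> \<bar>h x\<bar> \<le> B" by (auto simp: bounded_iff)
  have h': "continuous_map mtopology euclideanreal (\<lambda>x. - h x)"
    using h by (intro continuous_map_minus) auto
  show "(\<lambda>n. \<integral>\<omega>. h (Y n \<omega>) \<partial>P) \<longlonglongrightarrow> (\<integral>\<omega>. h (Z \<omega>) \<partial>Q)"
  proof (rule order_tendstoI)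
    fix a assume "a < (\<integral>\<omega>. h (Z \<omega>) \<partial>Q)"
    with h B show "\<forall>\<^sub>F n in sequentially. a < (\<integral>\<omega>. h (Y n \<omega>) \<partial>P)"
      by (intro liminf_from_lipschitz[OF P Q Y Z lip, where B=B]) auto
  next
    fix a assume "(\<integral>\<omega>. h (Z \<omega>) \<partial>Q) < a"
    then have "- a < (\<integral>\<omega>. - h (Z \<omega>) \<partial>Q)" by simp
    with h' B have "\<forall>\<^sub>F n in sequentially. - a < (\<integral>\<omega>. - h (Y n \<omega>) \<partial>P)"
      by (intro liminf_from_lipschitz[OF P Q Y Z lip, where B=B]) auto
    then show "\<forall>\<^sub>F n in sequentially. (\<integral>\<omega>. h (Y n \<omega>) \<partial>P) < a" by simp
  qed
qed

end

section \<open>Dyadic refinement of random paths\<close>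

text \<open>The midpoints of the chords can be added as nodes without changing the path. Two successive dyadic
  interpolations can therefore be compared node by node.\<close>

lemma polygon_refine:
  assumes "0 \<le> c * t"
  shows "polygon c x t =
    polygon (2 * c) (\<lambda>j. if even j then x (j div 2) else (1/2) *\<^sub>R (x (j div 2) + x (j div 2 + 1))) t"
    (is "_ = polygon _ ?z _")
proof -
  obtain k where k: "real k \<le> c * t" "c * t < real (k + 1)" using segment_index[OF assms] .
  have l: "polygon c x t = x k + (c * t - real k) *\<^sub>R (x (k + 1) - x k)"
    using k by (intro polygon_segment) auto
  have half: "(1/2) *\<^sub>R (x k + x (k + 1)) - x k = (1/2) *\<^sub>R (x (k + 1) - x k)"
    "x (k + 1) - (1/2) *\<^sub>R (x k + x (k + 1)) = (1/2) *\<^sub>R (x (k + 1) - x k)"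
    by (simp_all add: algebra_simps flip: scaleR_add_left)
  have mid: "(1/2) *\<^sub>R (x k + x (k + 1)) = x k + (1/2) *\<^sub>R (x (k + 1) - x k)"
    using half(1) by (simp add: algebra_simps)
  show ?thesis
  proof (cases "2 * (c * t) \<le> real (2 * k + 1)")
    case True
    then have "polygon (2 * c) ?z t = ?z (2 * k) + (2 * c * t - real (2 * k)) *\<^sub>R (?z (2 * k + 1) - ?z (2 * k))"
      using k by (intro polygon_segment) auto
    also have "\<dots> = x k + (2 * c * t - real (2 * k)) *\<^sub>R ((1/2) *\<^sub>R (x (k + 1) - x k))"
      using half(1) by simp
    also have "\<dots> = x k + (c * t - real k) *\<^sub>R (x (k + 1) - x k)"
      by (simp add: algebra_simps)
    finally show ?thesis using l by simp
  next
    case False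
    then have "polygon (2 * c) ?z t = ?z (2 * k + 1)
        + (2 * c * t - real (2 * k + 1)) *\<^sub>R (?z (2 * k + 1 + 1) - ?z (2 * k + 1))"
      using k by (intro polygon_segment) auto
    also have "\<dots> = (1/2) *\<^sub>R (x k + x (k + 1))
        + (2 * c * t - real (2 * k + 1)) *\<^sub>R ((1/2) *\<^sub>R (x (k + 1) - x k))"
      using half(2) by simp
    also have "\<dots> = x k + ((1/2) + (2 * c * t - real (2 * k + 1)) * (1/2)) *\<^sub>R (x (k + 1) - x k)"
      unfolding mid by (simp only: scaleR_add_left scaleR_scaleR add.assoc)
    also have "(1/2) + (2 * c * t - real (2 * k + 1)) * (1/2) = c * t - real k"
      by (simp add: field_simps)
    finally show ?thesis using l by simp
  qed
qed

text \<open>The exponent \<open>1/4\<close> balances the two terms of \<open>dyadic_bound\<close> below: with \<open>2 ^ l\<close> deviations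
  per unit of time, each with fourth moment of order \<open>4 ^ - l\<close>, the threshold \<open>chain_rate ^ l\<close> for
  their maximum leaves an error of the same order.\<close>

definition chain_rate :: real where "chain_rate = (1 / 2) powr (1 / 4)"

lemma chain_rate: "0 < chain_rate" "chain_rate < 1" "chain_rate ^ 4 = 1 / 2"
proof -
  show "0 < chain_rate" by (simp add: chain_rate_def)
  show "chain_rate ^ 4 = 1 / 2"
    unfolding chain_rate_def by (subst powr_power) auto
  then show "chain_rate < 1"
    by (smt (verit) one_le_power half_gt_zero_iff field_sum_of_halves)
qed

definition chain_error :: "real \<Rightarrow> nat \<Rightarrow> real" where
  "chain_error C l = (1 + C * real (Suc l)) * chain_rate ^ l + (1 / 2) ^ l"

lemma summable_chain_error: "summable (chain_error C)"
proof -
  have "summable (\<lambda>l. real (Suc l) * chain_rate ^ l)"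
    using geometric_deriv_sums[of chain_rate] chain_rate(1,2) by (auto simp: sums_iff)
  then have "summable (\<lambda>l. chain_rate ^ l + C * (real (Suc l) * chain_rate ^ l) + (1 / 2) ^ l)"
    using chain_rate by (intro summable_add summable_mult summable_geometric) auto
  then show ?thesis by (simp add: chain_error_def[abs_def] algebra_simps)
qed

text \<open>The vector \<open>y l k\<close> is the value of a process at time \<open>k / 2 ^ l\<close>. The moment condition says that a new
  node is at a distance of order \<open>2 powr (- l / 2)\<close> from the chord between its neighbours, as it is for
  Brownian motion.\<close>

locale dyadic_process = prob_space M
  for M :: "'a measure" and y :: "nat \<Rightarrow> nat \<Rightarrow> 'a \<Rightarrow> real ^ 'd" and C :: real +
  assumes y_measurable [measurable]: "y l k \<in> borel_measurable M"
    and y_consistent: "y (Suc l) (2 * k) \<omega> = y l k \<omega>"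
    and dev_integrable: "integrable M (\<lambda>\<omega>. norm (y (Suc l) (2 * k + 1) \<omega>
      - (1/2) *\<^sub>R (y l k \<omega> + y l (k + 1) \<omega>)) ^ 4)"
    and dev_moment: "expectation (\<lambda>\<omega>. norm (y (Suc l) (2 * k + 1) \<omega>
      - (1/2) *\<^sub>R (y l k \<omega> + y l (k + 1) \<omega>)) ^ 4) \<le> C / 4 ^ l"
begin

definition dev :: "nat \<Rightarrow> nat \<Rightarrow> 'a \<Rightarrow> real ^ 'd" where
  "dev l k \<omega> = y (Suc l) (2 * k + 1) \<omega> - (1/2) *\<^sub>R (y l k \<omega> + y l (k + 1) \<omega>)"

definition dyadic_path :: "nat \<Rightarrow> 'a \<Rightarrow> real \<Rightarrow> real ^ 'd" where
  "dyadic_path l \<omega> = polygon (2 ^ l) (\<lambda>k. y l k \<omega>)"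

definition dyadic_bound :: "nat \<Rightarrow> 'a \<Rightarrow> real" where
  "dyadic_bound l \<omega> = chain_rate ^ l + (\<Sum>k\<le>l * 2 ^ l. norm (dev l k \<omega>) ^ 4) / (chain_rate ^ l) ^ 3"

lemma dev_measurable [measurable]: "dev l k \<in> borel_measurable M"
  unfolding dev_def[abs_def] by measurable

lemma integrable_dev: "integrable M (\<lambda>\<omega>. norm (dev l k \<omega>) ^ 4)"
  unfolding dev_def by (rule dev_integrable)

lemma dyadic_bound_nonneg: "0 \<le> dyadic_bound l \<omega>"
  unfolding dyadic_bound_def using chain_rate(1) by (intro add_nonneg_nonneg divide_nonneg_nonneg sum_nonneg) auto

lemma integrable_dyadic_bound: "integrable M (dyadic_bound l)"
  unfolding dyadic_bound_def[abs_def]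
  by (intro Bochner_Integration.integrable_add integrable_divide Bochner_Integration.integrable_sum
      integrable_dev) simp

lemma expectation_dyadic_bound:
  "expectation (dyadic_bound l) + (1 / 2) ^ l \<le> chain_error C l"
proof -
  define r where "r = chain_rate ^ l"
  have r: "r > 0" using chain_rate by (simp add: r_def)
  have "r ^ 4 = (chain_rate ^ 4) ^ l"
    unfolding r_def by (simp only: power_mult[symmetric] mult.commute)
  then have r4: "r ^ 4 = (1 / 2) ^ l" by (simp only: chain_rate(3))
  have C: "0 \<le> C"
    using order_trans[OF integral_nonneg_AE dev_moment[of 0 0]] by simp
  have "expectation (dyadic_bound l)
      = r + (\<Sum>k\<le>l * 2 ^ l. expectation (\<lambda>\<omega>. norm (dev l k \<omega>) ^ 4)) / r ^ 3"
    unfolding dyadic_bound_def[abs_def] r_def[symmetric]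
    by (simp add: integrable_dev Bochner_Integration.integrable_sum prob_space)
  also have "\<dots> \<le> r + (\<Sum>k\<le>l * 2 ^ l. C / 4 ^ l) / r ^ 3"
    using r by (intro add_left_mono divide_right_mono sum_mono dev_moment[folded dev_def]) auto
  also have "\<dots> = r + (real l * 2 ^ l + 1) * (C / 4 ^ l) / r ^ 3" by simp
  also have "\<dots> \<le> r + (real (Suc l) * 2 ^ l) * (C / 4 ^ l) / r ^ 3"
    using r C by (intro add_left_mono divide_right_mono mult_right_mono) (auto simp: algebra_simps)
  also have "\<dots> = r + C * real (Suc l) * (2 ^ l / 4 ^ l) / r ^ 3" by simp
  also have "(2 ^ l / 4 ^ l :: real) = (1 / 2) ^ l" by (simp flip: power_divide)
  also have "\<dots> = r ^ 3 * r" unfolding r4[symmetric] by (simp add: power_eq_if)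
  also have "r + C * real (Suc l) * (r ^ 3 * r) / r ^ 3 = (1 + C * real (Suc l)) * r"
    using r by (simp add: field_simps)
  finally show ?thesis by (simp add: chain_error_def r_def)
qed

lemma norm_dev_le_dyadic_bound:
  assumes "k \<le> l * 2 ^ l"
  shows "norm (dev l k \<omega>) \<le> dyadic_bound l \<omega>"
proof -
  define r where "r = chain_rate ^ l"
  have r: "r > 0" using chain_rate by (simp add: r_def)
  let ?x = "norm (dev l k \<omega>)"
  \<comment> \<open>Above the threshold \<open>r\<close> the fourth power dominates: \<open>?x * r ^ 3 \<le> ?x ^ 4\<close>.\<close>
  have "?x \<le> r + ?x ^ 4 / r ^ 3"
  proof (cases "?x \<le> r")
    case True
    then show ?thesis using r by (simp add: add_increasing2)
  next
    case False
    then have "?x * r ^ 3 \<le> ?x * ?x ^ 3" using r by (intro mult_left_mono power_mono) auto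
    then have "?x \<le> ?x ^ 4 / r ^ 3" using r by (simp add: pos_le_divide_eq power_eq_if)
    then show ?thesis using r by simp
  qed
  also have "?x ^ 4 \<le> (\<Sum>k\<le>l * 2 ^ l. norm (dev l k \<omega>) ^ 4)"
    using assms by (intro member_le_sum) auto
  then have "r + ?x ^ 4 / r ^ 3 \<le> dyadic_bound l \<omega>"
    unfolding dyadic_bound_def r_def[symmetric] using r by (intro add_left_mono divide_right_mono) auto
  finally show ?thesis .
qed

text \<open>Only the new nodes contribute to the difference, each with its deviation from the chord. The time
  horizon \<open>l\<close> grows with the level: then the times beyond it cost only \<open>(1 / 2) ^ l\<close> in \<open>path_dist\<close>,
  which is summable over the levels.\<close>

lemma dyadic_path_step:
  assumes t: "0 \<le> t" "t \<le> real l"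
  shows "norm (dyadic_path (Suc l) \<omega> t - dyadic_path l \<omega> t) \<le> dyadic_bound l \<omega>"
proof -
  let ?z = "\<lambda>j. if even j then y l (j div 2) \<omega> else (1/2) *\<^sub>R (y l (j div 2) \<omega> + y l (j div 2 + 1) \<omega>)"
  have refine: "dyadic_path l \<omega> t = polygon (2 ^ Suc l) ?z t"
    unfolding dyadic_path_def using polygon_refine[of "2 ^ l" t "\<lambda>k. y l k \<omega>"] t by simp
  have "norm (polygon (2 ^ Suc l) (\<lambda>j. y (Suc l) j \<omega> - ?z j) t) \<le> dyadic_bound l \<omega>"
  proof (rule norm_polygon_le)
    fix j assume j: "real j \<le> 2 ^ Suc l * t + 1"
    show "norm (y (Suc l) j \<omega> - ?z j) \<le> dyadic_bound l \<omega>"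
    proof (cases "even j")
      case True
      then obtain k where "j = 2 * k" by (elim evenE)
      then show ?thesis by (simp add: y_consistent dyadic_bound_nonneg)
    next
      case False
      then obtain k where k: "j = 2 * k + 1" by (elim oddE)
      have "real k \<le> 2 ^ l * t" using j k by simp
      also have "\<dots> \<le> 2 ^ l * real l" using t by (intro mult_left_mono) auto
      finally have "real k \<le> real (l * 2 ^ l)" by (simp add: mult.commute)
      then have "k \<le> l * 2 ^ l" by (simp only: of_nat_le_iff)
      from norm_dev_le_dyadic_bound[OF this, of \<omega>] show ?thesis
        using k by (simp add: dev_def)
    qed
  qed (use t in auto)
  then show ?thesis
    unfolding refine unfolding dyadic_path_def by (simp only: polygon_diff)
qed

lemma path_dist_dyadic_step:
  "path_dist (path_of (dyadic_path (Suc l) \<omega>)) (path_of (dyadic_path l \<omega>)) \<le> dyadic_bound l \<omega> + (1 / 2) ^ l"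
  by (rule path_dist_le) (auto simp: dyadic_bound_nonneg dyadic_path_step)

lemma measurable_dyadic_path: "(\<lambda>\<omega>. path_of (dyadic_path l \<omega>)) \<in> measurable M (borel_of path_topology)"
  unfolding dyadic_path_def by (intro measurable_path_of_polygon) auto

end

lemma (in prob_space) lipschitz_integral_diff:
  fixes Y Z :: "'a \<Rightarrow> real \<Rightarrow> real ^ 'd"
  assumes Y: "Y \<in> measurable M (borel_of path_topology)" and Z: "Z \<in> measurable M (borel_of path_topology)"
    and lip: "\<And>f h. f \<in> cont_paths \<Longrightarrow> h \<in> cont_paths \<Longrightarrow> \<bar>g f - g h\<bar> \<le> L * path_dist f h"
    and B: "\<And>f. f \<in> cont_paths \<Longrightarrow> \<bar>g f\<bar> \<le> B" and L: "0 \<le> L"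
    and H: "integrable M H" and dist: "\<And>\<omega>. \<omega> \<in> space M \<Longrightarrow> path_dist (Y \<omega>) (Z \<omega>) \<le> H \<omega>"
  shows "\<bar>(\<integral>\<omega>. g (Y \<omega>) \<partial>M) - (\<integral>\<omega>. g (Z \<omega>) \<partial>M)\<bar> \<le> L * expectation H"
proof -
  have g: "g \<in> borel_measurable (borel_of path_topology)"
    by (rule continuous_map_measurable_real, rule path.continuous_map_lipschitz[where L=L], rule lip)
  have YZ: "Y \<omega> \<in> cont_paths" "Z \<omega> \<in> cont_paths" if "\<omega> \<in> space M" for \<omega>
    using measurable_space[OF Y that] measurable_space[OF Z that] by auto
  have iY: "integrable M (\<lambda>\<omega>. g (Y \<omega>))"
    by (rule integrable_const_bound[of _ B]) (use YZ B measurable_compose[OF Y g] in \<open>auto intro!: AE_I2\<close>)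
  have iZ: "integrable M (\<lambda>\<omega>. g (Z \<omega>))"
    by (rule integrable_const_bound[of _ B]) (use YZ B measurable_compose[OF Z g] in \<open>auto intro!: AE_I2\<close>)
  have "\<bar>(\<integral>\<omega>. g (Y \<omega>) \<partial>M) - (\<integral>\<omega>. g (Z \<omega>) \<partial>M)\<bar> = \<bar>\<integral>\<omega>. g (Y \<omega>) - g (Z \<omega>) \<partial>M\<bar>"
    using iY iZ by simp
  also have "\<dots> \<le> (\<integral>\<omega>. \<bar>g (Y \<omega>) - g (Z \<omega>)\<bar> \<partial>M)"
    using integral_norm_bound[of M "\<lambda>\<omega>. g (Y \<omega>) - g (Z \<omega>)"] by simp
  also have "\<dots> \<le> (\<integral>\<omega>. L * H \<omega> \<partial>M)"
  proof (rule integral_mono)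
    fix \<omega> assume \<omega>: "\<omega> \<in> space M"
    have "\<bar>g (Y \<omega>) - g (Z \<omega>)\<bar> \<le> L * path_dist (Y \<omega>) (Z \<omega>)" using YZ[OF \<omega>] by (intro lip)
    also have "\<dots> \<le> L * H \<omega>" by (intro mult_left_mono dist \<omega> L)
    finally show "\<bar>g (Y \<omega>) - g (Z \<omega>)\<bar> \<le> L * H \<omega>" .
  qed (use iY iZ H in auto)
  finally show ?thesis by simp
qed

context dyadic_process
begin

text \<open>The differences of successive interpolations telescope. The bound depends on the process only
  through the moment constant \<open>C\<close>, so it is uniform over families of processes with a common one.\<close>

theorem dyadic_approximation_error:
  fixes Y :: "'a \<Rightarrow> real \<Rightarrow> real ^ 'd"
  assumes Y: "Y \<in> measurable M (borel_of path_topology)"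
    and lim: "\<And>\<omega>. \<omega> \<in> space M \<Longrightarrow> (\<lambda>l. path_dist (path_of (dyadic_path l \<omega>)) (Y \<omega>)) \<longlonglongrightarrow> 0"
    and lip: "\<And>f h. f \<in> cont_paths \<Longrightarrow> h \<in> cont_paths \<Longrightarrow> \<bar>g f - g h\<bar> \<le> L * path_dist f h"
    and B: "\<And>f. f \<in> cont_paths \<Longrightarrow> \<bar>g f\<bar> \<le> B" and L: "0 \<le> L"
  shows "\<bar>(\<integral>\<omega>. g (Y \<omega>) \<partial>M) - (\<integral>\<omega>. g (path_of (dyadic_path j \<omega>)) \<partial>M)\<bar>
    \<le> L * (\<Sum>l. chain_error C (l + j))"
proof -
  let ?I = "\<lambda>l. \<integral>\<omega>. g (path_of (dyadic_path l \<omega>)) \<partial>M"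
  have step: "\<bar>?I (Suc l) - ?I l\<bar> \<le> L * chain_error C l" for l
  proof -
    have "\<bar>?I (Suc l) - ?I l\<bar> \<le> L * expectation (\<lambda>\<omega>. dyadic_bound l \<omega> + (1 / 2) ^ l)"
      by (rule lipschitz_integral_diff[OF measurable_dyadic_path measurable_dyadic_path lip B L])
         (use integrable_dyadic_bound path_dist_dyadic_step in auto)
    also have "\<dots> = L * (expectation (dyadic_bound l) + (1 / 2) ^ l)"
      using integrable_dyadic_bound by (simp add: prob_space)
    also have "\<dots> \<le> L * chain_error C l" by (intro mult_left_mono expectation_dyadic_bound L)
    finally show ?thesis .
  qed
  have pos: "0 \<le> L * chain_error C l" for l using step[of l] by linarith
  have sj: "summable (\<lambda>l. L * chain_error C (l + j))"
    using summable_chain_error by (intro summable_mult) simp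
  have partial: "\<bar>?I (m + j) - ?I j\<bar> \<le> (\<Sum>l<m. L * chain_error C (l + j))" for m
  proof (induction m)
    case (Suc m)
    then show ?case using step[of "m + j"] by simp
  qed simp
  have bound: "\<bar>?I (m + j) - ?I j\<bar> \<le> L * (\<Sum>l. chain_error C (l + j))" for m
  proof -
    have "(\<Sum>l<m. L * chain_error C (l + j)) \<le> (\<Sum>l. L * chain_error C (l + j))"
      by (rule sum_le_suminf[OF sj]) (auto simp: pos)
    also have "\<dots> = L * (\<Sum>l. chain_error C (l + j))"
      using summable_chain_error by (intro suminf_mult) simp
    finally show ?thesis using partial[of m] by linarith
  qed
  have g: "continuous_map path_topology euclideanreal g"
    by (rule path.continuous_map_lipschitz[where L=L]) (rule lip)
  have gm: "g \<in> borel_measurable (borel_of path_topology)" by (rule continuous_map_measurable_real[OF g])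
  have c: "path_of (dyadic_path l \<omega>) \<in> cont_paths" for l \<omega>
    unfolding dyadic_path_def by (intro path_of_in_cont_paths continuous_on_polygon) simp
  have Yc: "Y \<omega> \<in> cont_paths" if "\<omega> \<in> space M" for \<omega> using measurable_space[OF Y that] by simp
  have "?I \<longlonglongrightarrow> (\<integral>\<omega>. g (Y \<omega>) \<partial>M)"
  proof (rule integral_dominated_convergence[where w="\<lambda>_. B"])
    show "AE \<omega> in M. (\<lambda>l. g (path_of (dyadic_path l \<omega>))) \<longlonglongrightarrow> g (Y \<omega>)"
    proof (rule AE_I2)
      fix \<omega> assume \<omega>: "\<omega> \<in> space M"
      have "(\<lambda>l. g (path_of (dyadic_path l \<omega>)) - g (Y \<omega>)) \<longlonglongrightarrow> 0"
      proof (rule Lim_null_comparison)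
        show "\<forall>\<^sub>F l in sequentially. norm (g (path_of (dyadic_path l \<omega>)) - g (Y \<omega>))
            \<le> L * path_dist (path_of (dyadic_path l \<omega>)) (Y \<omega>)"
          using lip[OF c Yc[OF \<omega>]] by simp
        show "(\<lambda>l. L * path_dist (path_of (dyadic_path l \<omega>)) (Y \<omega>)) \<longlonglongrightarrow> 0"
          using tendsto_mult_left[OF lim[OF \<omega>], of L] by simp
      qed
      then show "(\<lambda>l. g (path_of (dyadic_path l \<omega>))) \<longlonglongrightarrow> g (Y \<omega>)"
        by (simp add: LIM_zero_iff)
    qed
    show "AE \<omega> in M. norm (g (path_of (dyadic_path l \<omega>))) \<le> B" for l using B[OF c] by simp
    show "(\<lambda>\<omega>. g (Y \<omega>)) \<in> borel_measurable M" by (rule measurable_compose[OF Y gm])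
    show "(\<lambda>\<omega>. g (path_of (dyadic_path l \<omega>))) \<in> borel_measurable M" for l
      by (rule measurable_compose[OF measurable_dyadic_path gm])
  qed simp
  then have "(\<lambda>m. \<bar>?I (m + j) - ?I j\<bar>) \<longlonglongrightarrow> \<bar>(\<integral>\<omega>. g (Y \<omega>) \<partial>M) - ?I j\<bar>"
    by (intro tendsto_intros LIMSEQ_ignore_initial_segment)
  then show ?thesis
    by (rule LIMSEQ_le_const2) (use bound in auto)
qed

lemma AE_summable_dyadic_bound: "AE \<omega> in M. summable (\<lambda>l. dyadic_bound l \<omega>)"
proof -
  have nn: "(\<integral>\<^sup>+\<omega>. ennreal (dyadic_bound l \<omega>) \<partial>M) = ennreal (expectation (dyadic_bound l))" for l
    by (rule nn_integral_eq_integral[OF integrable_dyadic_bound]) (simp add: dyadic_bound_nonneg)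
  have e0: "0 \<le> expectation (dyadic_bound l)" for l by (simp add: dyadic_bound_nonneg)
  have "expectation (dyadic_bound l) \<le> chain_error C l" for l
    using expectation_dyadic_bound[of l] by (smt (verit) zero_le_power zero_le_divide_1_iff)
  then have s: "summable (\<lambda>l. expectation (dyadic_bound l))"
    by (intro summable_comparison_test'[OF summable_chain_error[of C], of 0]) (use e0 in auto)
  have [measurable]: "dyadic_bound l \<in> borel_measurable M" for l
    using integrable_dyadic_bound by auto
  have "(\<integral>\<^sup>+\<omega>. (\<Sum>l. ennreal (dyadic_bound l \<omega>)) \<partial>M) = (\<Sum>l. ennreal (expectation (dyadic_bound l)))"
    by (subst nn_integral_suminf) (auto simp: nn)
  also have "\<dots> \<noteq> \<infinity>" using suminf_ennreal2[OF e0 s] by simp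
  finally have "AE \<omega> in M. (\<Sum>l. ennreal (dyadic_bound l \<omega>)) \<noteq> \<infinity>"
    by (intro nn_integral_PInf_AE) auto
  then show ?thesis
    by eventually_elim (auto intro!: summable_suminf_not_top dyadic_bound_nonneg)
qed

lemma y_consistent_iter: "y (l + m) (k * 2 ^ m) \<omega> = y l k \<omega>"
proof (induction m)
  case (Suc m)
  have "y (l + Suc m) (k * 2 ^ Suc m) \<omega> = y (Suc (l + m)) (2 * (k * 2 ^ m)) \<omega>"
    by (simp add: mult.left_commute)
  then show ?case using Suc by (simp only: y_consistent)
qed simp

lemma dyadic_path_node:
  assumes "l \<le> m" shows "dyadic_path m \<omega> (real k / 2 ^ l) = y l k \<omega>"
proof -
  have m: "m = l + (m - l)" using assms by simp
  have e: "real k / 2 ^ l = real (k * 2 ^ (m - l)) / 2 ^ m"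
    by (subst (2) m) (simp add: power_add)
  show ?thesis
    unfolding dyadic_path_def e using y_consistent_iter[of l "m - l" k \<omega>] assms
    by (subst polygon_node) auto
qed

lemma dyadic_path_limit:
  assumes s: "summable (\<lambda>l. dyadic_bound l \<omega>)"
  shows "continuous_on {0..} (\<lambda>t. lim (\<lambda>l. dyadic_path l \<omega> t))"
    and "0 \<le> t \<Longrightarrow> convergent (\<lambda>l. dyadic_path l \<omega> t)"
proof -
  have *: "continuous_on {0..real T} (\<lambda>t. lim (\<lambda>l. dyadic_path l \<omega> t)) \<and>
      (\<forall>t\<in>{0..real T}. convergent (\<lambda>l. dyadic_path l \<omega> t))" for T
  proof -
    define f where "f i t = dyadic_path (Suc (i + T)) \<omega> t - dyadic_path (i + T) \<omega> t" for i t
    have "uniform_limit {0..real T} (\<lambda>n t. \<Sum>i<n. f i t) (\<lambda>t. \<Sum>i. f i t) sequentially"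
      by (rule Weierstrass_m_test[where M="\<lambda>i. dyadic_bound (i + T) \<omega>"])
         (auto simp: f_def intro!: dyadic_path_step summable_ignore_initial_segment[OF s])
    then have "uniform_limit {0..real T} (\<lambda>n t. dyadic_path T \<omega> t + (\<Sum>i<n. f i t))
        (\<lambda>t. dyadic_path T \<omega> t + (\<Sum>i. f i t)) sequentially"
      by (intro uniform_limit_intros)
    moreover have "dyadic_path T \<omega> t + (\<Sum>i<n. f i t) = dyadic_path (n + T) \<omega> t" for n t
    proof (induction n)
      case (Suc n)
      then show ?case by (simp only: sum.lessThan_Suc add.assoc[symmetric]) (simp add: f_def)
    qed simp
    ultimately have u: "uniform_limit {0..real T} (\<lambda>n. dyadic_path (n + T) \<omega>)
        (\<lambda>t. dyadic_path T \<omega> t + (\<Sum>i. f i t)) sequentially" by simp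
    have lim: "(\<lambda>n. dyadic_path n \<omega> t) \<longlonglongrightarrow> dyadic_path T \<omega> t + (\<Sum>i. f i t)"
      if "t \<in> {0..real T}" for t
      using tendsto_uniform_limitI[OF u that] by (simp only: LIMSEQ_offset)
    have c: "continuous_on {0..real T} (dyadic_path (n + T) \<omega>)" for n
      unfolding dyadic_path_def
      by (rule continuous_on_subset[OF continuous_on_polygon]) auto
    have "continuous_on {0..real T} (\<lambda>t. dyadic_path T \<omega> t + (\<Sum>i. f i t))"
      by (rule uniform_limit_theorem[OF _ u]) (simp_all add: c)
    also have "?this \<longleftrightarrow> continuous_on {0..real T} (\<lambda>t. lim (\<lambda>l. dyadic_path l \<omega> t))"
      by (intro continuous_on_cong refl) (use limI[OF lim] in simp)
    finally show ?thesis using convergentI[OF lim] by blast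
  qed
  show "continuous_on {0..} (\<lambda>t. lim (\<lambda>l. dyadic_path l \<omega> t))"
    using * by (intro continuous_on_atLeast_0I) blast
  show "convergent (\<lambda>l. dyadic_path l \<omega> t)" if t: "0 \<le> t"
  proof -
    obtain T :: nat where "t \<le> real T" using real_arch_simple by blast
    then show ?thesis using * t by auto
  qed
qed

text \<open>Almost surely the bounds of successive differences are summable, and the interpolations converge
  uniformly on compact time intervals. On the exceptional null set the path is set to \<open>0\<close>.\<close>

theorem continuous_extension:
  obtains W :: "real \<Rightarrow> 'a \<Rightarrow> real ^ 'd"
  where "\<And>\<omega>. continuous_on {0..} (\<lambda>t. W t \<omega>)" "\<And>t. 0 \<le> t \<Longrightarrow> W t \<in> borel_measurable M"
    "AE \<omega> in M. \<forall>l k. W (real k / 2 ^ l) \<omega> = y l k \<omega>"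
proof -
  obtain N where N: "{\<omega> \<in> space M. \<not> summable (\<lambda>l. dyadic_bound l \<omega>)} \<subseteq> N"
      "emeasure M N = 0" "N \<in> sets M"
    by (rule AE_E[OF AE_summable_dyadic_bound])
  define G where "G = space M - N"
  have G [measurable]: "G \<in> sets M" using N(3) by (simp add: G_def)
  have sG: "summable (\<lambda>l. dyadic_bound l \<omega>)" if "\<omega> \<in> G" for \<omega> using that N(1) by (auto simp: G_def)
  define W where "W t \<omega> = (if \<omega> \<in> G then lim (\<lambda>l. dyadic_path l \<omega> t) else 0)" for t \<omega>
  show thesis
  proof
    show "continuous_on {0..} (\<lambda>t. W t \<omega>)" for \<omega>
      unfolding W_def using dyadic_path_limit(1)[OF sG] by (cases "\<omega> \<in> G") auto
    show "W t \<in> borel_measurable M" if t: "0 \<le> t" for t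
    proof (rule borel_measurable_LIMSEQ_metric)
      show "(\<lambda>\<omega>. if \<omega> \<in> G then dyadic_path l \<omega> t else 0) \<in> borel_measurable M" for l
        unfolding dyadic_path_def polygon_def Let_def by measurable
      show "(\<lambda>l. if \<omega> \<in> G then dyadic_path l \<omega> t else 0) \<longlonglongrightarrow> W t \<omega>" for \<omega>
        using dyadic_path_limit(2)[OF sG t, of \<omega>] by (auto simp: W_def convergent_LIMSEQ_iff)
    qed
    have "AE \<omega> in M. \<omega> \<in> G"
      using N by (intro AE_I[where N=N]) (auto simp: G_def)
    then show "AE \<omega> in M. \<forall>l k. W (real k / 2 ^ l) \<omega> = y l k \<omega>"
    proof eventually_elim
      case (elim \<omega>)
      have "(\<lambda>m. dyadic_path m \<omega> (real k / 2 ^ l)) \<longlonglongrightarrow> y l k \<omega>" for l k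
        by (rule tendsto_eventually) (use dyadic_path_node in \<open>auto intro!: eventually_sequentiallyI[of l]\<close>)
      then show ?case using elim by (auto simp: W_def intro: limI)
    qed
  qed
qed

end

section \<open>Sums of independent random variables\<close>

context prob_space
begin

lemma integrable_power_le_4:
  fixes X :: "'a \<Rightarrow> real"
  assumes [measurable]: "X \<in> borel_measurable M" and X: "integrable M (\<lambda>\<omega>. X \<omega> ^ 4)" and k: "k \<le> 4"
  shows "integrable M (\<lambda>\<omega>. X \<omega> ^ k)"
proof (rule Bochner_Integration.integrable_bound)
  show "integrable M (\<lambda>\<omega>. 1 + X \<omega> ^ 4)" using X by simp
  show "AE \<omega> in M. norm (X \<omega> ^ k) \<le> norm (1 + X \<omega> ^ 4)"
  proof (rule AE_I2)
    fix \<omega>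
    have p: "0 \<le> X \<omega> ^ 4" by (rule zero_le_even_power) simp
    have "\<bar>X \<omega>\<bar> ^ k \<le> 1 + \<bar>X \<omega>\<bar> ^ 4"
    proof (cases "\<bar>X \<omega>\<bar> \<le> 1")
      case True
      then have "\<bar>X \<omega>\<bar> ^ k \<le> 1" by (intro power_le_one) auto
      then show ?thesis by (simp add: add_increasing2)
    next
      case False
      then have "\<bar>X \<omega>\<bar> ^ k \<le> \<bar>X \<omega>\<bar> ^ 4" using k by (intro power_increasing) auto
      then show ?thesis by simp
    qed
    then show "norm (X \<omega> ^ k) \<le> norm (1 + X \<omega> ^ 4)" using p by (simp add: power_abs)
  qed
qed simp

lemma fourth_moment_add:
  fixes X Y :: "'a \<Rightarrow> real"
  assumes indep: "indep_var borel X borel Y"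
    and X4: "integrable M (\<lambda>\<omega>. X \<omega> ^ 4)" and Y4: "integrable M (\<lambda>\<omega>. Y \<omega> ^ 4)"
    and X1: "expectation X = 0" and Y1: "expectation Y = 0"
  shows "integrable M (\<lambda>\<omega>. (X \<omega> + Y \<omega>) ^ 4)"
    and "expectation (\<lambda>\<omega>. (X \<omega> + Y \<omega>)\<^sup>2) = expectation (\<lambda>\<omega>. (X \<omega>)\<^sup>2) + expectation (\<lambda>\<omega>. (Y \<omega>)\<^sup>2)"
    and "expectation (\<lambda>\<omega>. (X \<omega> + Y \<omega>) ^ 4) = expectation (\<lambda>\<omega>. X \<omega> ^ 4)
      + 6 * (expectation (\<lambda>\<omega>. (X \<omega>)\<^sup>2) * expectation (\<lambda>\<omega>. (Y \<omega>)\<^sup>2)) + expectation (\<lambda>\<omega>. Y \<omega> ^ 4)"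
    and "expectation (\<lambda>\<omega>. X \<omega> + Y \<omega>) = 0"
proof -
  have [measurable]: "X \<in> borel_measurable M" "Y \<in> borel_measurable M"
    using indep by (auto dest: indep_var_rv1 indep_var_rv2)
  have iX: "k \<le> 4 \<Longrightarrow> integrable M (\<lambda>\<omega>. X \<omega> ^ k)" for k by (rule integrable_power_le_4[OF _ X4]) auto
  have iY: "k \<le> 4 \<Longrightarrow> integrable M (\<lambda>\<omega>. Y \<omega> ^ k)" for k by (rule integrable_power_le_4[OF _ Y4]) auto
  have ind: "indep_var borel (\<lambda>\<omega>. X \<omega> ^ j) borel (\<lambda>\<omega>. Y \<omega> ^ k)" for j k
    using indep_var_compose[OF indep, of "\<lambda>x. x ^ j" borel "\<lambda>x. x ^ k" borel] by (simp add: comp_def)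
  have int: "integrable M (\<lambda>\<omega>. X \<omega> ^ j * Y \<omega> ^ k)" if "j \<le> 4" "k \<le> 4" for j k
    by (rule indep_var_integrable[OF ind iX iY]) (use that in auto)
  have E: "expectation (\<lambda>\<omega>. X \<omega> ^ j * Y \<omega> ^ k) = expectation (\<lambda>\<omega>. X \<omega> ^ j) * expectation (\<lambda>\<omega>. Y \<omega> ^ k)"
    if "j \<le> 4" "k \<le> 4" for j k
    by (rule indep_var_lebesgue_integral[OF ind iX iY]) (use that in auto)
  have e4: "(X \<omega> + Y \<omega>) ^ 4 = X \<omega> ^ 4 + 4 * (X \<omega> ^ 3 * Y \<omega> ^ 1) + 6 * (X \<omega> ^ 2 * Y \<omega> ^ 2)
      + 4 * (X \<omega> ^ 1 * Y \<omega> ^ 3) + Y \<omega> ^ 4" for \<omega>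
    by (simp add: power4_eq_xxxx power3_eq_cube power2_eq_square algebra_simps)
  have e2: "(X \<omega> + Y \<omega>)\<^sup>2 = (X \<omega>)\<^sup>2 + 2 * (X \<omega> ^ 1 * Y \<omega> ^ 1) + (Y \<omega>)\<^sup>2" for \<omega>
    by (simp add: power2_eq_square algebra_simps)
  show "integrable M (\<lambda>\<omega>. (X \<omega> + Y \<omega>) ^ 4)"
    unfolding e4 by (intro Bochner_Integration.integrable_add integrable_mult_right int iX iY) auto
  show "expectation (\<lambda>\<omega>. (X \<omega> + Y \<omega>)\<^sup>2) = expectation (\<lambda>\<omega>. (X \<omega>)\<^sup>2) + expectation (\<lambda>\<omega>. (Y \<omega>)\<^sup>2)"
    unfolding e2 using int[of 1 1] iX[of 2] iY[of 2] E[of 1 1] X1 by simp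
  show "expectation (\<lambda>\<omega>. (X \<omega> + Y \<omega>) ^ 4) = expectation (\<lambda>\<omega>. X \<omega> ^ 4)
      + 6 * (expectation (\<lambda>\<omega>. (X \<omega>)\<^sup>2) * expectation (\<lambda>\<omega>. (Y \<omega>)\<^sup>2)) + expectation (\<lambda>\<omega>. Y \<omega> ^ 4)"
    unfolding e4 using int[of 3 1] int[of 2 2] int[of 1 3] X4 Y4 E[of 3 1] E[of 1 3] E[of 2 2] X1 Y1 by simp
  show "expectation (\<lambda>\<omega>. X \<omega> + Y \<omega>) = 0"
    using iX[of 1] iY[of 1] X1 Y1 by simp
qed

text \<open>The bound \<open>3 * s\<^sup>2\<close> is stable under adding an independent centred variable, because
  \<open>3 * s\<^sup>2 + 6 * (s * t) + 3 * t\<^sup>2 = 3 * (s + t)\<^sup>2\<close>. It holds with equality for a centred Gaussian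
  variable of variance \<open>s\<close>, so that the lemma covers bounded and Gaussian summands alike.\<close>

theorem fourth_moment_sum:
  fixes X :: "'i \<Rightarrow> 'a \<Rightarrow> real"
  assumes "finite I" "indep_vars (\<lambda>_. borel) X I"
    and "\<And>i. i \<in> I \<Longrightarrow> integrable M (\<lambda>\<omega>. X i \<omega> ^ 4)" "\<And>i. i \<in> I \<Longrightarrow> expectation (X i) = 0"
    and "\<And>i. i \<in> I \<Longrightarrow> expectation (\<lambda>\<omega>. (X i \<omega>)\<^sup>2) \<le> s i"
    and "\<And>i. i \<in> I \<Longrightarrow> expectation (\<lambda>\<omega>. X i \<omega> ^ 4) \<le> 3 * (s i)\<^sup>2"
  shows "integrable M (\<lambda>\<omega>. (\<Sum>i\<in>I. X i \<omega>) ^ 4) \<and> expectation (\<lambda>\<omega>. \<Sum>i\<in>I. X i \<omega>) = 0 \<and>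
    expectation (\<lambda>\<omega>. (\<Sum>i\<in>I. X i \<omega>)\<^sup>2) \<le> (\<Sum>i\<in>I. s i) \<and>
    expectation (\<lambda>\<omega>. (\<Sum>i\<in>I. X i \<omega>) ^ 4) \<le> 3 * (\<Sum>i\<in>I. s i)\<^sup>2"
  using assms
proof (induction I rule: finite_induct)
  case (insert i F)
  let ?T = "\<lambda>\<omega>. \<Sum>i\<in>F. X i \<omega>" and ?S = "\<Sum>i\<in>F. s i"
  have "indep_vars (\<lambda>_. borel) X F" by (rule indep_vars_subset[OF insert.prems(1)]) auto
  then have IH: "integrable M (\<lambda>\<omega>. ?T \<omega> ^ 4)" "expectation ?T = 0" "expectation (\<lambda>\<omega>. (?T \<omega>)\<^sup>2) \<le> ?S"
      "expectation (\<lambda>\<omega>. ?T \<omega> ^ 4) \<le> 3 * ?S\<^sup>2"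
    using insert.IH insert.prems by auto
  have ind: "indep_var borel (X i) borel ?T"
    by (rule indep_vars_sum[OF insert.hyps insert.prems(1)])
  note add = fourth_moment_add[OF ind insert.prems(2)[OF insertI1] IH(1) insert.prems(3)[OF insertI1] IH(2)]
  have si: "0 \<le> s i"
    by (rule order_trans[OF _ insert.prems(4)[OF insertI1]]) simp
  have "expectation (\<lambda>\<omega>. (X i \<omega>)\<^sup>2) * expectation (\<lambda>\<omega>. (?T \<omega>)\<^sup>2) \<le> s i * ?S"
    using insert.prems(4) IH(3) si by (intro mult_mono) auto
  then have "expectation (\<lambda>\<omega>. (X i \<omega> + ?T \<omega>) ^ 4) \<le> 3 * (s i)\<^sup>2 + 6 * (s i * ?S) + 3 * ?S\<^sup>2"
    unfolding add(3) using insert.prems(5)[OF insertI1] IH(4) by linarith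
  also have "\<dots> = 3 * (s i + ?S)\<^sup>2" by (simp add: power2_eq_square algebra_simps)
  finally show ?case
    using insert.hyps add(1,2,4) IH(3) insert.prems(4)[OF insertI1] by (simp add: add_mono)
qed simp

lemma norm_power4_le:
  fixes v :: "real ^ 'd"
  shows "norm v ^ 4 \<le> real CARD('d) * (\<Sum>j\<in>UNIV. (v $ j) ^ 4)"
proof -
  have "norm v ^ 4 = ((norm v)\<^sup>2)\<^sup>2" by simp
  also have "(norm v)\<^sup>2 = (\<Sum>j\<in>UNIV. (v $ j)\<^sup>2)"
    unfolding power2_norm_eq_inner inner_vec_def by (simp add: power2_eq_square)
  also have "(\<Sum>j\<in>UNIV. (v $ j)\<^sup>2)\<^sup>2 \<le> (\<Sum>j\<in>UNIV. ((v $ j)\<^sup>2)\<^sup>2) * real CARD('d)"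
    by (rule sum_squared_le_sum_of_squares)
  finally show ?thesis by (simp add: mult.commute)
qed

lemma vector_fourth_moment:
  fixes T :: "'a \<Rightarrow> real ^ 'd"
  assumes [measurable]: "T \<in> borel_measurable M"
    and int: "\<And>j. integrable M (\<lambda>\<omega>. (T \<omega> $ j) ^ 4)"
    and le: "\<And>j. expectation (\<lambda>\<omega>. (T \<omega> $ j) ^ 4) \<le> b"
  shows "integrable M (\<lambda>\<omega>. norm (T \<omega>) ^ 4)"
    and "expectation (\<lambda>\<omega>. norm (T \<omega>) ^ 4) \<le> (real CARD('d))\<^sup>2 * b"
proof -
  have i: "integrable M (\<lambda>\<omega>. real CARD('d) * (\<Sum>j\<in>UNIV. (T \<omega> $ j) ^ 4))"
    using int by auto
  show *: "integrable M (\<lambda>\<omega>. norm (T \<omega>) ^ 4)"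
    by (rule Bochner_Integration.integrable_bound[OF i])
       (auto intro!: AE_I2 order_trans[OF norm_power4_le])
  have "expectation (\<lambda>\<omega>. norm (T \<omega>) ^ 4) \<le> expectation (\<lambda>\<omega>. real CARD('d) * (\<Sum>j\<in>UNIV. (T \<omega> $ j) ^ 4))"
    by (intro integral_mono * i norm_power4_le)
  also have "\<dots> = real CARD('d) * (\<Sum>j\<in>UNIV. expectation (\<lambda>\<omega>. (T \<omega> $ j) ^ 4))"
    using int by simp
  also have "\<dots> \<le> real CARD('d) * (\<Sum>j\<in>(UNIV :: 'd set). b)"
    by (intro mult_left_mono sum_mono le) auto
  finally show "expectation (\<lambda>\<omega>. norm (T \<omega>) ^ 4) \<le> (real CARD('d))\<^sup>2 * b"
    by (simp add: power2_eq_square)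
qed

lemma iexp_sum_indep:
  fixes X :: "'i \<Rightarrow> 'a \<Rightarrow> real"
  assumes "indep_vars (\<lambda>_. borel) X I"
  shows "(CLINT \<omega>|M. iexp (\<Sum>i\<in>I. X i \<omega>)) = (\<Prod>i\<in>I. CLINT \<omega>|M. iexp (X i \<omega>))"
proof -
  have m: "X i \<in> borel_measurable M" if "i \<in> I" for i
    using assms that by (auto simp: indep_vars_def)
  have m': "(\<lambda>\<omega>. \<Sum>i\<in>I. X i \<omega>) \<in> borel_measurable M" using m by (intro borel_measurable_sum)
  have c: "char (distr M borel Y) 1 = (CLINT \<omega>|M. iexp (Y \<omega>))" if "Y \<in> borel_measurable M" for Y
    unfolding char_def by (subst integral_distr[OF that]) auto
  show ?thesis
    using char_distr_sum[OF assms, of 1] unfolding c[OF m'] by (simp add: c m cong: prod.cong)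
qed

lemma exp_minus_quadratic:
  fixes y :: real
  assumes "0 \<le> y"
  shows "\<bar>exp (- y) - (1 - y)\<bar> \<le> y\<^sup>2 / 2"
proof -
  have "1 - y \<le> exp (- y)" using exp_ge_add_one_self[of "- y"] by simp
  moreover have "exp (- y) \<le> 1 - y + y\<^sup>2 / 2"
  proof -
    have pos: "0 < 1 + y + y\<^sup>2 / 2" using assms by (simp add: add_pos_nonneg)
    have "1 \<le> (1 - y + y\<^sup>2 / 2) * (1 + y + y\<^sup>2 / 2)"
      using assms by (simp add: algebra_simps power2_eq_square)
    then have "1 / (1 + y + y\<^sup>2 / 2) \<le> 1 - y + y\<^sup>2 / 2"
      using pos by (simp add: pos_divide_le_eq)
    moreover have "exp (- y) \<le> 1 / (1 + y + y\<^sup>2 / 2)"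
      using exp_lower_Taylor_quadratic[OF assms] pos
      by (simp add: exp_minus inverse_eq_divide frac_le)
    ultimately show ?thesis by linarith
  qed
  ultimately show ?thesis by linarith
qed

text \<open>The characteristic function of a centred variable and that of the Gaussian variable with the same
  variance agree to second order.\<close>

lemma iexp_bounded_approx:
  fixes X :: "'a \<Rightarrow> real"
  assumes [measurable]: "X \<in> borel_measurable M" and b: "\<And>\<omega>. \<omega> \<in> space M \<Longrightarrow> \<bar>X \<omega>\<bar> \<le> b"
    and X1: "expectation X = 0"
  shows "cmod ((CLINT \<omega>|M. iexp (X \<omega>)) - exp (- expectation (\<lambda>\<omega>. (X \<omega>)\<^sup>2) / 2)) \<le> b ^ 3 + b ^ 4"
proof -
  let ?q = "expectation (\<lambda>\<omega>. (X \<omega>)\<^sup>2)"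
  obtain \<omega>0 where "\<omega>0 \<in> space M" using not_empty by blast
  then have b0: "0 \<le> b" using b[of \<omega>0] by linarith
  have iX: "integrable M X" by (rule integrable_const_bound[of _ b]) (use b in auto)
  have sq: "(X \<omega>)\<^sup>2 \<le> b\<^sup>2" if "\<omega> \<in> space M" for \<omega>
    using b[OF that] by (metis abs_ge_zero power2_abs power_mono)
  have iX2: "integrable M (\<lambda>\<omega>. (X \<omega>)\<^sup>2)"
    by (rule integrable_const_bound[of _ "b\<^sup>2"]) (use sq in auto)
  have q: "0 \<le> ?q" "?q \<le> b\<^sup>2"
    using integral_mono[OF iX2 integrable_const sq] by (auto simp: prob_space)
  have ie: "integrable M (\<lambda>\<omega>. iexp (X \<omega>))" by (rule integrable_iexp) auto
  have poly: "integrable M (\<lambda>\<omega>. 1 + \<i> * complex_of_real (X \<omega>) - complex_of_real ((X \<omega>)\<^sup>2) / 2)"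
    using iX iX2 by (intro Bochner_Integration.integrable_diff Bochner_Integration.integrable_add
        integrable_mult_right integrable_divide integrable_of_real) auto
  have "(CLINT \<omega>|M. 1 + \<i> * complex_of_real (X \<omega>) - complex_of_real ((X \<omega>)\<^sup>2) / 2)
      = (CLINT \<omega>|M. 1 + \<i> * complex_of_real (X \<omega>)) - (CLINT \<omega>|M. complex_of_real ((X \<omega>)\<^sup>2) / 2)"
    using iX iX2 by (intro Bochner_Integration.integral_diff Bochner_Integration.integrable_add
        integrable_mult_right integrable_divide integrable_of_real) auto
  also have "(CLINT \<omega>|M. 1 + \<i> * complex_of_real (X \<omega>)) = 1 + \<i> * complex_of_real (expectation X)"
    using iX by (subst Bochner_Integration.integral_add) (auto simp: prob_space)
  also have "(CLINT \<omega>|M. complex_of_real ((X \<omega>)\<^sup>2) / 2) = complex_of_real ?q / 2"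
    by (simp only: integral_divide_zero integral_complex_of_real)
  finally have poly_eq: "(CLINT \<omega>|M. 1 + \<i> * complex_of_real (X \<omega>) - complex_of_real ((X \<omega>)\<^sup>2) / 2)
      = 1 - complex_of_real (?q / 2)"
    using X1 by simp
  have pt: "cmod (iexp (X \<omega>) - (1 + \<i> * complex_of_real (X \<omega>) - complex_of_real ((X \<omega>)\<^sup>2) / 2)) \<le> b ^ 3 / 6"
    if "\<omega> \<in> space M" for \<omega>
  proof -
    have "(\<Sum>k\<le>2. (\<i> * complex_of_real (X \<omega>)) ^ k / fact k)
        = 1 + \<i> * complex_of_real (X \<omega>) - complex_of_real ((X \<omega>)\<^sup>2) / 2"
      by (simp add: numeral_2_eq_2 power2_eq_square algebra_simps)
    then have "cmod (iexp (X \<omega>) - (1 + \<i> * complex_of_real (X \<omega>) - complex_of_real ((X \<omega>)\<^sup>2) / 2))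
        \<le> \<bar>X \<omega>\<bar> ^ 3 / 6"
      using iexp_approx1[of "X \<omega>" 2] by (simp add: numeral_3_eq_3 fact_numeral)
    also have "\<dots> \<le> b ^ 3 / 6" using b[OF that] by (intro divide_right_mono power_mono) auto
    finally show ?thesis .
  qed
  have "cmod ((CLINT \<omega>|M. iexp (X \<omega>)) - (1 - complex_of_real (?q / 2)))
      = cmod (CLINT \<omega>|M. iexp (X \<omega>) - (1 + \<i> * complex_of_real (X \<omega>) - complex_of_real ((X \<omega>)\<^sup>2) / 2))"
    unfolding poly_eq[symmetric] using ie poly by (subst Bochner_Integration.integral_diff) auto
  also have "\<dots> \<le> (\<integral>\<omega>. cmod (iexp (X \<omega>) - (1 + \<i> * complex_of_real (X \<omega>) - complex_of_real ((X \<omega>)\<^sup>2) / 2)) \<partial>M)"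
    by (rule integral_norm_bound)
  also have "\<dots> \<le> (\<integral>\<omega>. b ^ 3 / 6 \<partial>M)"
    using ie poly pt by (intro integral_mono) auto
  finally have 1: "cmod ((CLINT \<omega>|M. iexp (X \<omega>)) - (1 - complex_of_real (?q / 2))) \<le> b ^ 3 / 6"
    by (simp add: prob_space)
  have "cmod (complex_of_real (1 - ?q / 2) - complex_of_real (exp (- ?q / 2))) \<le> (?q / 2)\<^sup>2 / 2"
    using exp_minus_quadratic[of "?q / 2"] q by (simp only: of_real_diff[symmetric] norm_of_real abs_minus_commute) simp
  also have "(?q / 2)\<^sup>2 / 2 = ?q\<^sup>2 / 8" by (simp add: power_divide)
  also have "\<dots> \<le> ?q\<^sup>2" by simp
  also have "\<dots> \<le> (b\<^sup>2)\<^sup>2" by (rule power_mono[OF q(2,1)])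
  finally have 2: "cmod ((1 - complex_of_real (?q / 2)) - complex_of_real (exp (- ?q / 2))) \<le> b ^ 4"
    by simp
  have "cmod ((CLINT \<omega>|M. iexp (X \<omega>)) - complex_of_real (exp (- ?q / 2))) \<le> b ^ 3 / 6 + b ^ 4"
    by (rule norm_diff_triangle_le[OF 1 2])
  also have "\<dots> \<le> b ^ 3 + b ^ 4" using b0 by simp
  finally show ?thesis by simp
qed

text \<open>Both sides are products of factors in the unit disc, so the errors of the factors add up.\<close>

theorem iexp_sum_bounded_approx:
  fixes X :: "'i \<Rightarrow> 'a \<Rightarrow> real"
  assumes indep: "indep_vars (\<lambda>_. borel) X I"
    and b: "\<And>i \<omega>. i \<in> I \<Longrightarrow> \<omega> \<in> space M \<Longrightarrow> \<bar>X i \<omega>\<bar> \<le> b"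
    and X1: "\<And>i. i \<in> I \<Longrightarrow> expectation (X i) = 0"
  shows "cmod ((CLINT \<omega>|M. iexp (\<Sum>i\<in>I. X i \<omega>)) - exp (- (\<Sum>i\<in>I. expectation (\<lambda>\<omega>. (X i \<omega>)\<^sup>2)) / 2))
    \<le> real (card I) * (b ^ 3 + b ^ 4)"
proof (cases "finite I")
  case True
  have m: "X i \<in> borel_measurable M" if "i \<in> I" for i
    using indep that by (auto simp: indep_vars_def)
  let ?w = "\<lambda>i. complex_of_real (exp (- expectation (\<lambda>\<omega>. (X i \<omega>)\<^sup>2) / 2))"
  have w: "complex_of_real (exp (- (\<Sum>i\<in>I. expectation (\<lambda>\<omega>. (X i \<omega>)\<^sup>2)) / 2)) = (\<Prod>i\<in>I. ?w i)"
    using True by (simp add: sum_negf[symmetric] sum_divide_distrib exp_sum del: of_real_exp)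
  have "cmod ((\<Prod>i\<in>I. CLINT \<omega>|M. iexp (X i \<omega>)) - (\<Prod>i\<in>I. ?w i))
      \<le> (\<Sum>i\<in>I. cmod ((CLINT \<omega>|M. iexp (X i \<omega>)) - ?w i))"
  proof (rule norm_prod_diff)
    fix i assume i: "i \<in> I"
    have "cmod (CLINT \<omega>|M. iexp (X i \<omega>)) \<le> (\<integral>\<omega>. cmod (iexp (X i \<omega>)) \<partial>M)" by (rule integral_norm_bound)
    then show "cmod (CLINT \<omega>|M. iexp (X i \<omega>)) \<le> 1" by (simp add: prob_space)
    show "cmod (?w i) \<le> 1" by (simp only: norm_of_real) simp
  qed
  also have "\<dots> \<le> (\<Sum>i\<in>I. b ^ 3 + b ^ 4)"
    using iexp_bounded_approx[OF m b X1] by (intro sum_mono) simp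
  finally show ?thesis unfolding iexp_sum_indep[OF indep] w[symmetric] by simp
qed (simp add: prob_space)

end

section \<open>Existence of Brownian motion\<close>

lemma sum_even_odd: "(\<Sum>k<2 * n. f k) = (\<Sum>k<n. f (2 * k) + f (2 * k + 1 :: nat) :: 'e::comm_monoid_add)"
  by (induction n) (auto simp: add.assoc)

text \<open>The length of the intersection of the intervals \<open>[a, b]\<close> and \<open>[c, d]\<close>, which is the covariance of
  the increments of a standard Brownian motion over them.\<close>

definition overlap :: "real \<Rightarrow> real \<Rightarrow> real \<Rightarrow> real \<Rightarrow> real" where
  "overlap a b c d = max 0 (min b d - max a c)"

text \<open>With independent standard normal \<open>Z x\<close>, the vector \<open>\<Sum>x\<in>A. Z x *\<^sub>R b x\<close> is Gaussian, and
  \<open>cov\<close> below is the bilinear form of its covariance matrix. The noise consists of independent copies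
  of this vector, indexed by dyadic level and position.\<close>

locale gaussian_factors =
  fixes A :: "'i set" and b :: "'i \<Rightarrow> real ^ 'd"
  assumes finite_A: "finite A"
begin

definition cov :: "real ^ 'd \<Rightarrow> real ^ 'd \<Rightarrow> real" where
  "cov u v = (\<Sum>x\<in>A. (u \<bullet> b x) * (v \<bullet> b x))"

lemma cov_add_left: "cov (u + v) w = cov u w + cov v w"
  by (simp add: cov_def inner_add_left distrib_right sum.distrib)

lemma cov_scaleR_left: "cov (c *\<^sub>R u) w = c * cov u w"
  by (simp add: cov_def sum_distrib_left mult.assoc)

lemma cov_commute: "cov u v = cov v u"
  by (simp add: cov_def mult.commute)

lemma cov_scaleR_right: "cov w (c *\<^sub>R u) = c * cov w u"
  using cov_scaleR_left[of c u w] by (simp add: cov_commute)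

lemma cov_zero_left [simp]: "cov 0 w = 0" by (simp add: cov_def)

lemma cov_zero_right [simp]: "cov w 0 = 0" by (simp add: cov_def)

lemma cov_sum_left: "cov (\<Sum>i\<in>I. f i) w = (\<Sum>i\<in>I. cov (f i) w)"
  by (induction I rule: infinite_finite_induct) (auto simp: cov_add_left)

lemma cov_sum_right: "cov w (\<Sum>i\<in>I. f i) = (\<Sum>i\<in>I. cov w (f i))"
  using cov_sum_left[of f I w] by (simp add: cov_commute)

lemma cov_nonneg: "0 \<le> cov u u"
  by (simp add: cov_def sum_nonneg)

lemma cov_parallelogram: "cov (u + v) (u + v) + cov (u - v) (u - v) = 2 * cov u u + 2 * cov v v"
  by (simp add: cov_def sum.distrib[symmetric] sum_distrib_left inner_add_left inner_diff_left)
     (simp add: algebra_simps)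

definition gauss_space :: "((nat \<times> nat) \<times> 'i \<Rightarrow> real) measure" where
  "gauss_space = PiM UNIV (\<lambda>_. std_normal_distribution)"

definition noise :: "nat \<times> nat \<Rightarrow> ((nat \<times> nat) \<times> 'i \<Rightarrow> real) \<Rightarrow> real ^ 'd" where
  "noise n \<omega> = (\<Sum>x\<in>A. \<omega> (n, x) *\<^sub>R b x)"

lemma prob_space_gauss_space: "prob_space gauss_space"
  unfolding gauss_space_def
  by (intro prob_space_PiM) (rule real_distribution.axioms(1)[OF real_dist_normal_dist])

sublocale gauss: prob_space gauss_space by (rule prob_space_gauss_space)

lemma coord_measurable [measurable]: "(\<lambda>\<omega>. \<omega> a) \<in> borel_measurable gauss_space"
proof -
  have "(\<lambda>\<omega>. \<omega> a) \<in> measurable gauss_space std_normal_distribution"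
    unfolding gauss_space_def by (rule measurable_component_singleton) simp
  then show ?thesis by (simp cong: measurable_cong_sets)
qed

lemma noise_measurable [measurable]: "noise n \<in> borel_measurable gauss_space"
  unfolding noise_def[abs_def] by measurable

lemma coord_distr: "distr gauss_space borel (\<lambda>\<omega>. \<omega> a) = std_normal_distribution"
proof -
  have "distr gauss_space std_normal_distribution (\<lambda>\<omega>. \<omega> a) = std_normal_distribution"
    unfolding gauss_space_def
    by (rule distr_PiM_component) (auto intro: real_distribution.axioms(1)[OF real_dist_normal_dist])
  moreover have "distr gauss_space borel (\<lambda>\<omega>. \<omega> a) = distr gauss_space std_normal_distribution (\<lambda>\<omega>. \<omega> a)"
    by (rule distr_cong) auto
  ultimately show ?thesis by simp
qed

lemma coord_indep: "gauss.indep_vars (\<lambda>_. borel) (\<lambda>a \<omega>. \<omega> a) UNIV"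
proof -
  let ?P = "PiM UNIV (\<lambda>_ :: (nat \<times> nat) \<times> 'i. borel :: real measure)"
  have s: "sets ?P = sets gauss_space" unfolding gauss_space_def by (rule sets_PiM_cong) auto
  have "distr gauss_space ?P (\<lambda>\<omega>. \<lambda>a\<in>UNIV. \<omega> a) = distr gauss_space gauss_space (\<lambda>\<omega>. \<omega>)"
    by (rule distr_cong) (auto simp: s restrict_UNIV)
  also have "\<dots> = (\<Pi>\<^sub>M a\<in>UNIV. distr gauss_space borel (\<lambda>\<omega>. \<omega> a))"
    unfolding coord_distr by (simp add: gauss_space_def)
  finally show ?thesis
    by (subst gauss.indep_vars_iff_distr_eq_PiM) auto
qed

lemma noise_linear_iexp:
  assumes "finite B"
  shows "(CLINT \<omega>|gauss_space. iexp (\<Sum>n\<in>B. w n \<bullet> noise n \<omega>)) = exp (- (\<Sum>n\<in>B. cov (w n) (w n)) / 2)"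
proof -
  let ?c = "\<lambda>(n, x). w n \<bullet> b x"
  have lin: "(\<Sum>n\<in>B. w n \<bullet> noise n \<omega>) = (\<Sum>a\<in>B \<times> A. ?c a * \<omega> a)" for \<omega>
    by (simp add: noise_def inner_sum_right sum.cartesian_product mult.commute split_def)
  have ind: "gauss.indep_vars (\<lambda>_. borel) (\<lambda>a \<omega>. ?c a * \<omega> a) (B \<times> A)"
    by (rule gauss.indep_vars_compose2[OF gauss.indep_vars_subset[OF coord_indep]]) auto
  have one: "(CLINT \<omega>|gauss_space. iexp (c * \<omega> a)) = exp (- (c\<^sup>2) / 2)" for c a
  proof -
    have "(CLINT \<omega>|gauss_space. iexp (c * \<omega> a)) = char (distr gauss_space borel (\<lambda>\<omega>. \<omega> a)) c"
      unfolding char_def by (subst integral_distr) auto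
    then show ?thesis by (simp add: coord_distr char_std_normal_distribution)
  qed
  have "(CLINT \<omega>|gauss_space. iexp (\<Sum>n\<in>B. w n \<bullet> noise n \<omega>)) = (\<Prod>a\<in>B \<times> A. complex_of_real (exp (- (?c a)\<^sup>2 / 2)))"
    unfolding lin gauss.iexp_sum_indep[OF ind] one by simp
  also have "\<dots> = complex_of_real (\<Prod>a\<in>B \<times> A. exp (- (?c a)\<^sup>2 / 2))" by simp
  also have "(\<Prod>a\<in>B \<times> A. exp (- (?c a)\<^sup>2 / 2)) = exp (\<Sum>a\<in>B \<times> A. - (?c a)\<^sup>2 / 2)"
    using assms finite_A by (simp only: exp_sum finite_cartesian_product)
  also have "(\<Sum>a\<in>B \<times> A. - (?c a)\<^sup>2 / 2) = - (\<Sum>a\<in>B \<times> A. (?c a)\<^sup>2) / 2"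
    by (simp add: sum_divide_distrib sum_negf)
  also have "(\<Sum>a\<in>B \<times> A. (?c a)\<^sup>2) = (\<Sum>n\<in>B. cov (w n) (w n))"
    by (simp add: cov_def sum.cartesian_product split_def power2_eq_square)
  finally show ?thesis by simp
qed

lemma noise_moments:
  obtains K where "0 \<le> K" "\<And>n. integrable gauss_space (\<lambda>\<omega>. norm (noise n \<omega>) ^ 4)"
    "\<And>n. (\<integral>\<omega>. norm (noise n \<omega>) ^ 4 \<partial>gauss_space) \<le> K"
proof -
  define m where "m = (\<Sum>x\<in>A. (norm (b x))\<^sup>2)"
  have comp: "integrable gauss_space (\<lambda>\<omega>. (noise n \<omega> $ j) ^ 4)"
    "(\<integral>\<omega>. (noise n \<omega> $ j) ^ 4 \<partial>gauss_space) \<le> 3 * m\<^sup>2" for n j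
  proof -
    have mom: "integrable gauss_space (\<lambda>\<omega>. \<omega> a ^ k)"
      "(\<integral>\<omega>. \<omega> a ^ k \<partial>gauss_space) = (\<integral>z. z ^ k \<partial>std_normal_distribution)" for a k
    proof -
      have "integrable (distr gauss_space borel (\<lambda>\<omega>. \<omega> a)) (\<lambda>z. z ^ k)"
        unfolding coord_distr by (rule integrable_std_normal_distribution_moment)
      then show "integrable gauss_space (\<lambda>\<omega>. \<omega> a ^ k)" by (subst (asm) integrable_distr_eq) auto
      show "(\<integral>\<omega>. \<omega> a ^ k \<partial>gauss_space) = (\<integral>z. z ^ k \<partial>std_normal_distribution)"
        unfolding coord_distr[of a, symmetric] by (subst integral_distr) auto
    qed
    have m1: "(\<integral>\<omega>. \<omega> a \<partial>gauss_space) = 0" for a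
      using mom(2)[of a 1] integral_std_normal_distribution_moment_odd[of 1] by simp
    have m2: "(\<integral>\<omega>. (\<omega> a)\<^sup>2 \<partial>gauss_space) = 1" for a
      using mom(2)[of a 2] std_normal_distribution_even_moments(1)[of 1] by (simp add: fact_numeral)
    have m4: "(\<integral>\<omega>. \<omega> a ^ 4 \<partial>gauss_space) = 3" for a
      using mom(2)[of a 4] std_normal_distribution_even_moments(1)[of 2] by (simp add: fact_numeral)
    let ?B = "Pair n ` A"
    let ?T = "\<lambda>\<omega>. \<Sum>a\<in>?B. b (snd a) $ j * \<omega> a"
    have inj: "inj_on (Pair n) A" by (simp add: inj_on_def)
    have ind: "gauss.indep_vars (\<lambda>_. borel) (\<lambda>a \<omega>. b (snd a) $ j * \<omega> a) ?B"
      by (rule gauss.indep_vars_compose2[OF gauss.indep_vars_subset[OF coord_indep]]) auto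
    have sum: "noise n \<omega> $ j = ?T \<omega>" for \<omega>
      by (simp add: noise_def mult.commute sum.reindex[OF inj])
    have s: "(\<Sum>a\<in>?B. (b (snd a) $ j)\<^sup>2) = (\<Sum>x\<in>A. (b x $ j)\<^sup>2)"
      by (simp add: sum.reindex[OF inj])
    have res: "integrable gauss_space (\<lambda>\<omega>. ?T \<omega> ^ 4) \<and> gauss.expectation ?T = 0 \<and>
      gauss.expectation (\<lambda>\<omega>. (?T \<omega>)\<^sup>2) \<le> (\<Sum>a\<in>?B. (b (snd a) $ j)\<^sup>2) \<and>
      gauss.expectation (\<lambda>\<omega>. ?T \<omega> ^ 4) \<le> 3 * (\<Sum>a\<in>?B. (b (snd a) $ j)\<^sup>2)\<^sup>2"
      by (rule gauss.fourth_moment_sum[OF finite_imageI[OF finite_A] ind])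
         (auto simp: power_mult_distrib mom(1) m1 m2 m4)
    have "(\<Sum>x\<in>A. (b x $ j)\<^sup>2) \<le> m"
      unfolding m_def using component_le_norm_cart[of _ j]
      by (intro sum_mono) (metis abs_ge_zero power2_abs power_mono)
    then have "(\<Sum>x\<in>A. (b x $ j)\<^sup>2)\<^sup>2 \<le> m\<^sup>2" by (intro power_mono sum_nonneg) auto
    then show "integrable gauss_space (\<lambda>\<omega>. (noise n \<omega> $ j) ^ 4)"
      "(\<integral>\<omega>. (noise n \<omega> $ j) ^ 4 \<partial>gauss_space) \<le> 3 * m\<^sup>2"
      using res unfolding sum s by auto
  qed
  show thesis
    by (rule that[of "(real CARD('d))\<^sup>2 * (3 * m\<^sup>2)"])
       (auto intro!: gauss.vector_fourth_moment comp)
qed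

text \<open>Levy's construction: \<open>increment l k\<close> is the increment over \<open>[k / 2 ^ l, (k + 1) / 2 ^ l]\<close>. It splits
  into halves, to which the same independent noise is added and subtracted. The noise is scaled to
  half the standard deviation \<open>2 powr (- l / 2)\<close> of the increment, which makes the two parts uncorrelated.\<close>

fun increment :: "nat \<Rightarrow> nat \<Rightarrow> ((nat \<times> nat) \<times> 'i \<Rightarrow> real) \<Rightarrow> real ^ 'd" where
  "increment 0 k \<omega> = noise (0, k) \<omega>"
| "increment (Suc l) k \<omega> = (1/2) *\<^sub>R increment l (k div 2) \<omega> +
    ((if even k then 1 else - 1) * ((1/2) * (1 / sqrt 2) ^ l)) *\<^sub>R noise (Suc l, k div 2) \<omega>"

lemma increment_measurable [measurable]: "increment l k \<in> borel_measurable gauss_space"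
  by (induction l arbitrary: k) (auto simp: increment.simps[abs_def])

lemma increment_even: "increment (Suc l) (2 * k) \<omega> =
    (1/2) *\<^sub>R increment l k \<omega> + ((1/2) * (1 / sqrt 2) ^ l) *\<^sub>R noise (Suc l, k) \<omega>"
  and increment_odd: "increment (Suc l) (2 * k + 1) \<omega> =
    (1/2) *\<^sub>R increment l k \<omega> - ((1/2) * (1 / sqrt 2) ^ l) *\<^sub>R noise (Suc l, k) \<omega>"
  by simp_all

lemma sqrt2_power: "((1 / sqrt 2) ^ l)\<^sup>2 = (1 / 2 :: real) ^ l"
  by (simp add: power_divide flip: power_mult power2_eq_square)
     (simp add: power_mult mult.commute[of l 2] power_one_over)

text \<open>The increments of level \<open>l\<close> have the characteristic function of independent Gaussian vectors. The
  statement includes noise of later levels since the induction step consumes the noise of the next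
  one; the variances match by the parallelogram law.\<close>

lemma increments_iexp:
  assumes "finite B" "\<And>n. n \<in> B \<Longrightarrow> l < fst n"
  shows "(CLINT \<omega>|gauss_space. iexp ((\<Sum>k<N. u k \<bullet> increment l k \<omega>) + (\<Sum>n\<in>B. w n \<bullet> noise n \<omega>)))
    = exp (- ((1/2) ^ l * (\<Sum>k<N. cov (u k) (u k)) + (\<Sum>n\<in>B. cov (w n) (w n))) / 2)"
  using assms
proof (induction l arbitrary: N u B w)
  case 0
  let ?B0 = "Pair (0::nat) ` {..<N}"
  define w' where "w' n = (if fst n = 0 then u (snd n) else w n)" for n
  have inj: "inj_on (Pair (0::nat)) {..<N}" by (simp add: inj_on_def)
  have B: "fst n \<noteq> 0" if "n \<in> B" for n using 0(2)[OF that] by simp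
  then have disj: "?B0 \<inter> B = {}" by (auto dest!: B)
  have split: "(\<Sum>n\<in>?B0 \<union> B. f (w' n) n) = (\<Sum>k<N. f (u k) (0, k)) + (\<Sum>n\<in>B. f (w n) n)"
    for f :: "real ^ 'd \<Rightarrow> nat \<times> nat \<Rightarrow> real"
  proof -
    have "(\<Sum>n\<in>B. f (w' n) n) = (\<Sum>n\<in>B. f (w n) n)"
      by (intro sum.cong refl) (auto simp: w'_def dest!: B)
    then show ?thesis
      using 0(1) disj by (subst sum.union_disjoint) (auto simp: sum.reindex[OF inj] w'_def)
  qed
  have "finite (?B0 \<union> B)" using 0 by simp
  from noise_linear_iexp[OF this, of w'] show ?case
    using split[of "\<lambda>v n. v \<bullet> noise n _"] split[of "\<lambda>v n. cov v v"] by simp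
next
  case (Suc l)
  \<comment> \<open>Padding with zeros makes the number of increments even, so that they can be paired.\<close>
  define u' where "u' k = (if k < N then u k else 0)" for k
  have pad: "(\<Sum>k<N. f (u k) k) = (\<Sum>k<2 * N. f (u' k) k)"
    if "\<And>k. f 0 k = 0" for f :: "real ^ 'd \<Rightarrow> nat \<Rightarrow> real"
    using that by (intro sum.mono_neutral_cong_left) (auto simp: u'_def)
  define c where "c = (1/2) * (1 / sqrt 2 :: real) ^ l"
  define p where "p k = (1/2) *\<^sub>R (u' (2 * k) + u' (2 * k + 1))" for k
  define q where "q k = c *\<^sub>R (u' (2 * k) - u' (2 * k + 1))" for k
  let ?B1 = "Pair (Suc l) ` {..<N}"
  define w' where "w' n = (if fst n = Suc l then q (snd n) else w n)" for n
  have inj: "inj_on (Pair (Suc l)) {..<N}" by (simp add: inj_on_def)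
  have B: "fst n > Suc l" if "n \<in> B" for n using Suc.prems(2)[OF that] by simp
  then have disj: "?B1 \<inter> B = {}" by (auto dest!: B)
  have split: "(\<Sum>n\<in>?B1 \<union> B. f (w' n) n) = (\<Sum>k<N. f (q k) (Suc l, k)) + (\<Sum>n\<in>B. f (w n) n)"
    for f :: "real ^ 'd \<Rightarrow> nat \<times> nat \<Rightarrow> real"
  proof -
    have "(\<Sum>n\<in>B. f (w' n) n) = (\<Sum>n\<in>B. f (w n) n)"
      by (intro sum.cong refl) (auto simp: w'_def dest!: B)
    then show ?thesis
      using Suc.prems(1) disj by (subst sum.union_disjoint) (auto simp: sum.reindex[OF inj] w'_def)
  qed
  have lin: "(\<Sum>k<N. u k \<bullet> increment (Suc l) k \<omega>)
      = (\<Sum>k<N. p k \<bullet> increment l k \<omega>) + (\<Sum>k<N. q k \<bullet> noise (Suc l, k) \<omega>)" for \<omega>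
  proof -
    have "(\<Sum>k<N. u k \<bullet> increment (Suc l) k \<omega>) = (\<Sum>k<2 * N. u' k \<bullet> increment (Suc l) k \<omega>)"
      by (rule pad) simp
    also have "\<dots> = (\<Sum>k<N. u' (2 * k) \<bullet> increment (Suc l) (2 * k) \<omega>
        + u' (2 * k + 1) \<bullet> increment (Suc l) (2 * k + 1) \<omega>)"
      by (rule sum_even_odd)
    also have "\<dots> = (\<Sum>k<N. p k \<bullet> increment l k \<omega> + q k \<bullet> noise (Suc l, k) \<omega>)"
      unfolding increment_even increment_odd p_def q_def c_def[symmetric]
      by (intro sum.cong refl) (simp add: inner_add_left inner_add_right inner_diff_left inner_diff_right algebra_simps)
    finally show ?thesis by (simp add: sum.distrib)
  qed
  have c2: "c * c = (1/4) * (1/2) ^ l"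
    unfolding c_def using sqrt2_power[of l] by (simp add: power2_eq_square)
  have cov: "(1/2) ^ l * (\<Sum>k<N. cov (p k) (p k)) + (\<Sum>k<N. cov (q k) (q k))
      = (1/2) ^ Suc l * (\<Sum>k<N. cov (u k) (u k))"
  proof -
    have "(1/2) ^ l * cov (p k) (p k) + cov (q k) (q k)
        = (1/2) ^ Suc l * (cov (u' (2 * k)) (u' (2 * k)) + cov (u' (2 * k + 1)) (u' (2 * k + 1)))" for k
    proof -
      have "(1/2) ^ l * cov (p k) (p k) + cov (q k) (q k)
          = (1/4) * (1/2) ^ l * (cov (u' (2 * k) + u' (2 * k + 1)) (u' (2 * k) + u' (2 * k + 1))
            + cov (u' (2 * k) - u' (2 * k + 1)) (u' (2 * k) - u' (2 * k + 1)))"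
        unfolding p_def q_def by (simp add: cov_scaleR_left cov_scaleR_right c2 mult.assoc[symmetric] distrib_left)
      also have "\<dots> = (1/2) ^ Suc l * (cov (u' (2 * k)) (u' (2 * k)) + cov (u' (2 * k + 1)) (u' (2 * k + 1)))"
        unfolding cov_parallelogram by (simp add: algebra_simps)
      finally show ?thesis .
    qed
    then have "(1/2) ^ l * (\<Sum>k<N. cov (p k) (p k)) + (\<Sum>k<N. cov (q k) (q k))
      = (1/2) ^ Suc l * (\<Sum>k<N. cov (u' (2 * k)) (u' (2 * k)) + cov (u' (2 * k + 1)) (u' (2 * k + 1)))"
      by (simp only: sum_distrib_left sum.distrib[symmetric])
    also have "(\<Sum>k<N. cov (u' (2 * k)) (u' (2 * k)) + cov (u' (2 * k + 1)) (u' (2 * k + 1)))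
        = (\<Sum>k<2 * N. cov (u' k) (u' k))"
      by (rule sum_even_odd[symmetric])
    also have "\<dots> = (\<Sum>k<N. cov (u k) (u k))" by (rule pad[symmetric]) simp
    finally show ?thesis .
  qed
  have lev: "l < fst n" if "n \<in> ?B1 \<union> B" for n
    using that by (auto dest!: B)
  have fin: "finite (?B1 \<union> B)" using Suc.prems by simp
  have noise: "(\<Sum>n\<in>?B1 \<union> B. w' n \<bullet> noise n \<omega>)
      = (\<Sum>k<N. q k \<bullet> noise (Suc l, k) \<omega>) + (\<Sum>n\<in>B. w n \<bullet> noise n \<omega>)" for \<omega>
    by (rule split)
  have "(CLINT \<omega>|gauss_space. iexp ((\<Sum>k<N. u k \<bullet> increment (Suc l) k \<omega>) + (\<Sum>n\<in>B. w n \<bullet> noise n \<omega>)))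
      = (CLINT \<omega>|gauss_space. iexp ((\<Sum>k<N. p k \<bullet> increment l k \<omega>) + (\<Sum>n\<in>?B1 \<union> B. w' n \<bullet> noise n \<omega>)))"
    unfolding lin noise by (simp only: add.assoc)
  also have "\<dots> = exp (- ((1/2) ^ l * (\<Sum>k<N. cov (p k) (p k)) + (\<Sum>n\<in>?B1 \<union> B. cov (w' n) (w' n))) / 2)"
    by (rule Suc.IH[OF fin lev])
  also have "(1/2) ^ l * (\<Sum>k<N. cov (p k) (p k)) + (\<Sum>n\<in>?B1 \<union> B. cov (w' n) (w' n))
      = (1/2) ^ Suc l * (\<Sum>k<N. cov (u k) (u k)) + (\<Sum>n\<in>B. cov (w n) (w n))"
    unfolding split[of "\<lambda>v _. cov v v"] cov[symmetric] by (simp only: add.assoc)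
  finally show ?case .
qed

definition dyadic_walk :: "nat \<Rightarrow> nat \<Rightarrow> ((nat \<times> nat) \<times> 'i \<Rightarrow> real) \<Rightarrow> real ^ 'd" where
  "dyadic_walk l k \<omega> = (\<Sum>i<k. increment l i \<omega>)"

lemma dyadic_walk_consistent: "dyadic_walk (Suc l) (2 * k) \<omega> = dyadic_walk l k \<omega>"
proof -
  have "increment (Suc l) (2 * i) \<omega> + increment (Suc l) (2 * i + 1) \<omega> = increment l i \<omega>" for i
    unfolding increment_even increment_odd by (simp flip: scaleR_add_left)
  then show ?thesis unfolding dyadic_walk_def sum_even_odd by simp
qed

lemma dyadic_walk_dev:
  "dyadic_walk (Suc l) (2 * k + 1) \<omega> - (1/2) *\<^sub>R (dyadic_walk l k \<omega> + dyadic_walk l (k + 1) \<omega>)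
    = ((1/2) * (1 / sqrt 2) ^ l) *\<^sub>R noise (Suc l, k) \<omega>"
proof -
  have 1: "dyadic_walk (Suc l) (2 * k + 1) \<omega> = dyadic_walk l k \<omega> + increment (Suc l) (2 * k) \<omega>"
  proof -
    have "dyadic_walk (Suc l) (2 * k + 1) \<omega> = dyadic_walk (Suc l) (2 * k) \<omega> + increment (Suc l) (2 * k) \<omega>"
      by (simp add: dyadic_walk_def)
    then show ?thesis by (simp only: dyadic_walk_consistent)
  qed
  have 2: "dyadic_walk l (k + 1) \<omega> = dyadic_walk l k \<omega> + increment l k \<omega>"
    by (simp add: dyadic_walk_def)
  have 3: "(1/2) *\<^sub>R (v + (v + w)) = v + (1/2) *\<^sub>R w" for v w :: "real ^ 'd"
  proof -
    have "(1/2) *\<^sub>R (v + (v + w)) = (1/2) *\<^sub>R (v + v) + (1/2) *\<^sub>R w"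
      by (simp only: add.assoc scaleR_add_right)
    then show ?thesis by (simp only: scaleR_half_double)
  qed
  show ?thesis unfolding 1 2 3 increment_even by simp
qed

lemma dyadic_walk_process: obtains K where "dyadic_process gauss_space dyadic_walk K"
proof -
  obtain K where K: "0 \<le> K" "\<And>n. integrable gauss_space (\<lambda>\<omega>. norm (noise n \<omega>) ^ 4)"
    "\<And>n. (\<integral>\<omega>. norm (noise n \<omega>) ^ 4 \<partial>gauss_space) \<le> K"
    by (rule noise_moments) (rule that)
  have norm4: "norm (((1/2) * (1 / sqrt 2) ^ l) *\<^sub>R noise (Suc l, k) \<omega>) ^ 4
      = (1/16) * (1/4) ^ l * norm (noise (Suc l, k) \<omega>) ^ 4" for l k \<omega>
  proof -
    have "((1 / sqrt 2) ^ l) ^ 4 = (((1 / sqrt 2) ^ l)\<^sup>2)\<^sup>2" by simp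
    also have "\<dots> = (1 / 4 :: real) ^ l"
      unfolding sqrt2_power by (simp add: power2_eq_square flip: power_mult_distrib)
    finally show ?thesis by (simp add: power_mult_distrib power_divide)
  qed
  have "dyadic_process gauss_space dyadic_walk K"
  proof
    show "dyadic_walk l k \<in> borel_measurable gauss_space" for l k
      unfolding dyadic_walk_def[abs_def] by measurable
    show "dyadic_walk (Suc l) (2 * k) \<omega> = dyadic_walk l k \<omega>" for l k \<omega>
      by (rule dyadic_walk_consistent)
    fix l k
    show "integrable gauss_space (\<lambda>\<omega>. norm (dyadic_walk (Suc l) (2 * k + 1) \<omega>
        - (1/2) *\<^sub>R (dyadic_walk l k \<omega> + dyadic_walk l (k + 1) \<omega>)) ^ 4)"
      unfolding dyadic_walk_dev norm4 using K(2) by simp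
    have "(1/16) * (1/4) ^ l * (\<integral>\<omega>. norm (noise (Suc l, k) \<omega>) ^ 4 \<partial>gauss_space) \<le> 1 * (1/4) ^ l * K"
      using K(1) by (intro mult_mono K(3)) auto
    then show "(\<integral>\<omega>. norm (dyadic_walk (Suc l) (2 * k + 1) \<omega>
        - (1/2) *\<^sub>R (dyadic_walk l k \<omega> + dyadic_walk l (k + 1) \<omega>)) ^ 4 \<partial>gauss_space) \<le> K / 4 ^ l"
      unfolding dyadic_walk_dev norm4 by (simp add: power_one_over)
  qed
  then show thesis by (rule that)
qed

text \<open>After exchanging sums, the coefficient of \<open>cov (u i) (u j)\<close> counts the dyadic cells common to the
  \<open>i\<close>-th and the \<open>j\<close>-th interval.\<close>

lemma dyadic_walk_iexp:
  fixes n m :: "nat \<Rightarrow> nat" and N :: nat and u :: "nat \<Rightarrow> real ^ 'd"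
  assumes nm: "\<And>i. i < N \<Longrightarrow> n i \<le> m i"
  shows "(CLINT \<omega>|gauss_space. iexp (\<Sum>i<N. u i \<bullet> (dyadic_walk l (m i) \<omega> - dyadic_walk l (n i) \<omega>)))
    = exp (- (\<Sum>i<N. \<Sum>j<N. cov (u i) (u j) *
        overlap (real (n i) / 2 ^ l) (real (m i) / 2 ^ l) (real (n j) / 2 ^ l) (real (m j) / 2 ^ l)) / 2)"
proof -
  define K where "K = Max (insert 0 (m ` {..<N}))"
  have K: "m i \<le> K" if "i < N" for i unfolding K_def using that by (intro Max_ge) auto
  define J where "J i = {n i..<m i}" for i
  have J: "J i \<subseteq> {..<K}" if "i < N" for i using K[OF that] by (auto simp: J_def)
  have diff: "dyadic_walk l (m i) \<omega> - dyadic_walk l (n i) \<omega> = (\<Sum>k<K. of_bool (k \<in> J i) *\<^sub>R increment l k \<omega>)"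
    if i: "i < N" for i \<omega>
  proof -
    have "{..<m i} = {..<n i} \<union> J i" "{..<n i} \<inter> J i = {}"
      using nm[OF i] by (auto simp: J_def)
    then have "dyadic_walk l (m i) \<omega> - dyadic_walk l (n i) \<omega> = (\<Sum>k\<in>J i. increment l k \<omega>)"
      unfolding dyadic_walk_def by (simp add: sum.union_disjoint J_def)
    also have "\<dots> = (\<Sum>k<K. of_bool (k \<in> J i) *\<^sub>R increment l k \<omega>)"
      using J[OF i] by (intro sum.mono_neutral_cong_left) auto
    finally show ?thesis .
  qed
  define c where "c k = (\<Sum>i<N. of_bool (k \<in> J i) *\<^sub>R u i)" for k
  have lin: "(\<Sum>i<N. u i \<bullet> (dyadic_walk l (m i) \<omega> - dyadic_walk l (n i) \<omega>)) = (\<Sum>k<K. c k \<bullet> increment l k \<omega>)" for \<omega>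
  proof -
    have "(\<Sum>i<N. u i \<bullet> (dyadic_walk l (m i) \<omega> - dyadic_walk l (n i) \<omega>))
        = (\<Sum>i<N. \<Sum>k<K. of_bool (k \<in> J i) * (u i \<bullet> increment l k \<omega>))"
      by (simp add: diff inner_sum_right)
    also have "\<dots> = (\<Sum>k<K. \<Sum>i<N. of_bool (k \<in> J i) * (u i \<bullet> increment l k \<omega>))" by (rule sum.swap)
    finally show ?thesis by (simp add: c_def inner_sum_left)
  qed
  have "(\<Sum>k<K. cov (c k) (c k)) = (\<Sum>k<K. \<Sum>i<N. \<Sum>j<N. of_bool (k \<in> J i) * of_bool (k \<in> J j) * cov (u i) (u j))"
    unfolding c_def by (simp only: cov_sum_left cov_sum_right cov_scaleR_left cov_scaleR_right sum_distrib_left mult.assoc)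
      (intro sum.cong refl, simp add: cov_commute)
  also have "\<dots> = (\<Sum>i<N. \<Sum>k<K. \<Sum>j<N. of_bool (k \<in> J i) * of_bool (k \<in> J j) * cov (u i) (u j))" by (rule sum.swap)
  also have "\<dots> = (\<Sum>i<N. \<Sum>j<N. \<Sum>k<K. of_bool (k \<in> J i) * of_bool (k \<in> J j) * cov (u i) (u j))"
    by (intro sum.cong refl sum.swap)
  finally have cov1: "(\<Sum>k<K. cov (c k) (c k))
      = (\<Sum>i<N. \<Sum>j<N. (\<Sum>k<K. of_bool (k \<in> J i) * of_bool (k \<in> J j)) * cov (u i) (u j))"
    by (simp only: sum_distrib_right)
  have ov: "(1/2) ^ l * (\<Sum>k<K. of_bool (k \<in> J i) * of_bool (k \<in> J j))
      = overlap (real (n i) / 2 ^ l) (real (m i) / 2 ^ l) (real (n j) / 2 ^ l) (real (m j) / 2 ^ l)"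
    if "i < N" "j < N" for i j
  proof -
    have "(\<Sum>k<K. of_bool (k \<in> J i) * of_bool (k \<in> J j)) = (\<Sum>k\<in>J i \<inter> J j. (1::real))"
      using J[OF that(1)] by (intro sum.mono_neutral_cong_right) auto
    also have "J i \<inter> J j = {max (n i) (n j)..<min (m i) (m j)}" by (auto simp: J_def)
    also have "(\<Sum>k\<in>{max (n i) (n j)..<min (m i) (m j)}. (1::real)) = max 0 (min (real (m i)) (real (m j)) - max (real (n i)) (real (n j)))"
      by (auto simp: max_def min_def of_nat_diff)
    also have "(1/2) ^ l * \<dots> = overlap (real (n i) / 2 ^ l) (real (m i) / 2 ^ l) (real (n j) / 2 ^ l) (real (m j) / 2 ^ l)"
      unfolding overlap_def
      by (simp add: power_one_over max_mult_distrib_left min_mult_distrib_left right_diff_distrib inverse_eq_divide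
          min_divide_distrib_right max_divide_distrib_right diff_divide_distrib)
    finally show ?thesis .
  qed
  have var: "(1/2) ^ l * (\<Sum>k<K. cov (c k) (c k)) = (\<Sum>i<N. \<Sum>j<N. cov (u i) (u j) *
        overlap (real (n i) / 2 ^ l) (real (m i) / 2 ^ l) (real (n j) / 2 ^ l) (real (m j) / 2 ^ l))"
    unfolding cov1 sum_distrib_left
    by (intro sum.cong refl) (simp add: ov[symmetric] sum_distrib_left mult.commute mult.left_commute)
  have "(CLINT \<omega>|gauss_space. iexp ((\<Sum>k<K. c k \<bullet> increment l k \<omega>) + (\<Sum>n\<in>{}. 0 \<bullet> noise n \<omega>)))
    = exp (- ((1/2) ^ l * (\<Sum>k<K. cov (c k) (c k)) + (\<Sum>n\<in>({}::(nat \<times> nat) set). cov 0 0)) / 2)"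
    by (rule increments_iexp) auto
  then show ?thesis unfolding lin using var by simp
qed

end

lemma normal_law_char:
  assumes v: "0 \<le> v"
  shows "real_distribution (normal_law 0 v)" and "char (normal_law 0 v) \<theta> = exp (- (\<theta>\<^sup>2 * v) / 2)"
proof -
  interpret S: real_distribution std_normal_distribution by (rule real_dist_normal_dist)
  have law: "normal_law 0 v = distr std_normal_distribution borel (\<lambda>x. sqrt v * x)"
  proof (cases "v = 0")
    case True
    then show ?thesis by (simp add: normal_law_def)
  next
    case False
    then have s: "sqrt v > 0" using v by simp
    have id: "distr std_normal_distribution lborel (\<lambda>x. x) = std_normal_distribution"
      by (rule distr_id2) simp
    have "distributed std_normal_distribution lborel (\<lambda>x. sqrt v * x) (normal_density 0 (sqrt v))"
      using s by (subst S.normal_standard_normal_convert[OF s]) (auto simp: distributed_def id)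
    then have "distr std_normal_distribution lborel (\<lambda>x. sqrt v * x) = density lborel (normal_density 0 (sqrt v))"
      by (simp add: distributed_def)
    moreover have "distr std_normal_distribution borel (\<lambda>x. sqrt v * x) = distr std_normal_distribution lborel (\<lambda>x. sqrt v * x)"
      by (rule distr_cong) auto
    ultimately show ?thesis using False by (simp add: normal_law_def)
  qed
  show "real_distribution (normal_law 0 v)"
    unfolding law by (rule S.real_distribution_distr) simp
  have "char (normal_law 0 v) \<theta> = char std_normal_distribution (\<theta> * sqrt v)"
    unfolding law char_def by (subst integral_distr) (auto simp: mult.assoc)
  then show "char (normal_law 0 v) \<theta> = exp (- (\<theta>\<^sup>2 * v) / 2)"
    using v by (simp add: char_std_normal_distribution power_mult_distrib)
qed

context gaussian_factors
begin

lemma dyadic_floor: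
  assumes "0 \<le> a"
  shows "(\<lambda>l. real (nat \<lfloor>2 ^ l * a\<rfloor>) / 2 ^ l) \<longlonglongrightarrow> a"
proof -
  have "(\<lambda>l. real (nat \<lfloor>2 ^ l * a\<rfloor>) / 2 ^ l - a) \<longlonglongrightarrow> 0"
  proof (rule Lim_null_comparison)
    show "\<forall>\<^sub>F l in sequentially. norm (real (nat \<lfloor>2 ^ l * a\<rfloor>) / 2 ^ l - a) \<le> (1/2) ^ l"
    proof (intro always_eventually allI)
      fix l
      have "0 \<le> 2 ^ l * a" using assms by simp
      then have "\<bar>real (nat \<lfloor>2 ^ l * a\<rfloor>) - 2 ^ l * a\<bar> \<le> 1" by linarith
      then have "\<bar>real (nat \<lfloor>2 ^ l * a\<rfloor>) - 2 ^ l * a\<bar> / 2 ^ l \<le> 1 / 2 ^ l" by (intro divide_right_mono) auto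
      moreover have "real (nat \<lfloor>2 ^ l * a\<rfloor>) / 2 ^ l - a = (real (nat \<lfloor>2 ^ l * a\<rfloor>) - 2 ^ l * a) / 2 ^ l"
        by (simp add: diff_divide_distrib)
      ultimately show "norm (real (nat \<lfloor>2 ^ l * a\<rfloor>) / 2 ^ l - a) \<le> (1/2) ^ l"
        by (simp add: power_one_over)
    qed
    show "(\<lambda>l. (1/2 :: real) ^ l) \<longlonglongrightarrow> 0" by (rule LIMSEQ_power_zero) simp
  qed
  then show ?thesis by (simp add: LIM_zero_iff)
qed

text \<open>The formula holds at dyadic times and passes to all times, because the paths are continuous and the
  overlap is a continuous function of the end points.\<close>

lemma gaussian_path_exists:
  obtains W :: "real \<Rightarrow> ((nat \<times> nat) \<times> 'i \<Rightarrow> real) \<Rightarrow> real ^ 'd"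
  where "\<And>\<omega>. continuous_on {0..} (\<lambda>t. W t \<omega>)" "\<And>t. 0 \<le> t \<Longrightarrow> W t \<in> borel_measurable gauss_space"
    "AE \<omega> in gauss_space. W 0 \<omega> = 0"
    "\<forall>(N::nat) u a b. (\<forall>i. 0 \<le> a i \<and> a i \<le> b i) \<longrightarrow>
      (CLINT \<omega>|gauss_space. iexp (\<Sum>i<N. u i \<bullet> (W (b i) \<omega> - W (a i) \<omega>)))
      = exp (- (\<Sum>i<N. \<Sum>j<N. cov (u i) (u j) * overlap (a i) (b i) (a j) (b j)) / 2)"
proof -
  obtain K where "dyadic_process gauss_space dyadic_walk K" by (rule dyadic_walk_process)
  then interpret D: dyadic_process gauss_space dyadic_walk K .
  obtain W where W: "\<And>\<omega>. continuous_on {0..} (\<lambda>t. W t \<omega>)" "\<And>t. 0 \<le> t \<Longrightarrow> W t \<in> borel_measurable gauss_space"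
    "AE \<omega> in gauss_space. \<forall>l k. W (real k / 2 ^ l) \<omega> = dyadic_walk l k \<omega>"
    by (rule D.continuous_extension) (rule that)
  show thesis
  proof (rule that[OF W(1,2)])
    show "AE \<omega> in gauss_space. W 0 \<omega> = 0"
      using W(3)
    proof eventually_elim
      case (elim \<omega>)
      then have "W (real 0 / 2 ^ 0) \<omega> = dyadic_walk 0 0 \<omega>" by blast
      then show ?case by (simp add: dyadic_walk_def)
    qed
  next
    show "\<forall>(N::nat) u a b. (\<forall>i. 0 \<le> a i \<and> a i \<le> b i) \<longrightarrow>
      (CLINT \<omega>|gauss_space. iexp (\<Sum>i<N. u i \<bullet> (W (b i) \<omega> - W (a i) \<omega>)))
      = exp (- (\<Sum>i<N. \<Sum>j<N. cov (u i) (u j) * overlap (a i) (b i) (a j) (b j)) / 2)"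
    proof (intro allI impI)
      fix N :: nat and u :: "nat \<Rightarrow> real ^ 'd" and a b :: "nat \<Rightarrow> real"
      assume "\<forall>i. 0 \<le> a i \<and> a i \<le> b i"
      then have ab: "0 \<le> a i \<and> a i \<le> b i" for i by blast
      define n where "n l i = nat \<lfloor>2 ^ l * a i\<rfloor>" for l :: nat and i
      define m where "m l i = nat \<lfloor>2 ^ l * b i\<rfloor>" for l :: nat and i
      have lim: "(\<lambda>l. real (n l i) / 2 ^ l) \<longlonglongrightarrow> a i" "(\<lambda>l. real (m l i) / 2 ^ l) \<longlonglongrightarrow> b i" for i
        unfolding n_def m_def by (rule dyadic_floor, use ab[of i] in linarith)+
      have nm: "n l i \<le> m l i" for l i
        unfolding n_def m_def using ab[of i] by (intro nat_mono floor_mono mult_left_mono) auto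
      let ?R = "\<lambda>l \<omega>. \<Sum>i<N. u i \<bullet> (W (real (m l i) / 2 ^ l) \<omega> - W (real (n l i) / 2 ^ l) \<omega>)"
      let ?ov = "\<lambda>l i j. overlap (real (n l i) / 2 ^ l) (real (m l i) / 2 ^ l) (real (n l j) / 2 ^ l) (real (m l j) / 2 ^ l)"
      have Wm: "W (real k / 2 ^ l) \<in> borel_measurable gauss_space" for k l by (rule W(2)) simp
      have [measurable]: "?R l \<in> borel_measurable gauss_space" for l
        by (intro borel_measurable_sum borel_measurable_inner borel_measurable_diff Wm) auto
      have Wab: "W (a i) \<in> borel_measurable gauss_space" "W (b i) \<in> borel_measurable gauss_space" for i
        using ab[of i] by (auto intro!: W(2))
      have [measurable]: "(\<lambda>\<omega>. \<Sum>i<N. u i \<bullet> (W (b i) \<omega> - W (a i) \<omega>)) \<in> borel_measurable gauss_space"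
        by (intro borel_measurable_sum borel_measurable_inner borel_measurable_diff Wab) auto
      have wlim: "(\<lambda>l. W (s l) \<omega>) \<longlonglongrightarrow> W t \<omega>" if "s \<longlonglongrightarrow> t" "\<And>l. 0 \<le> s l" "0 \<le> t" for s t \<omega>
        using continuous_on_tendsto_compose[OF W(1) that(1)] that(2,3) by auto
      have step: "(CLINT \<omega>|gauss_space. iexp (?R l \<omega>)) = exp (- (\<Sum>i<N. \<Sum>j<N. cov (u i) (u j) * ?ov l i j) / 2)" for l
      proof -
        have "(CLINT \<omega>|gauss_space. iexp (?R l \<omega>))
            = (CLINT \<omega>|gauss_space. iexp (\<Sum>i<N. u i \<bullet> (dyadic_walk l (m l i) \<omega> - dyadic_walk l (n l i) \<omega>)))"
        proof (rule integral_cong_AE)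
          show "AE \<omega> in gauss_space. iexp (?R l \<omega>)
              = iexp (\<Sum>i<N. u i \<bullet> (dyadic_walk l (m l i) \<omega> - dyadic_walk l (n l i) \<omega>))"
            using W(3) by eventually_elim simp
          show "(\<lambda>\<omega>. iexp (\<Sum>i<N. u i \<bullet> (dyadic_walk l (m l i) \<omega> - dyadic_walk l (n l i) \<omega>))) \<in> borel_measurable gauss_space"
            by measurable
        qed measurable
        also have "\<dots> = exp (- (\<Sum>i<N. \<Sum>j<N. cov (u i) (u j) * ?ov l i j) / 2)"
          by (rule dyadic_walk_iexp) (rule nm)
        finally show ?thesis .
      qed
      have "(\<lambda>l. CLINT \<omega>|gauss_space. iexp (?R l \<omega>))
          \<longlonglongrightarrow> (CLINT \<omega>|gauss_space. iexp (\<Sum>i<N. u i \<bullet> (W (b i) \<omega> - W (a i) \<omega>)))"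
      proof (rule integral_dominated_convergence[where w="\<lambda>_. 1"])
        show "AE \<omega> in gauss_space. (\<lambda>l. iexp (?R l \<omega>)) \<longlonglongrightarrow> iexp (\<Sum>i<N. u i \<bullet> (W (b i) \<omega> - W (a i) \<omega>))"
          using ab by (intro AE_I2 tendsto_intros wlim lim) (auto intro: order_trans)
        show "(\<lambda>\<omega>. iexp (?R l \<omega>)) \<in> borel_measurable gauss_space" for l by measurable
        show "(\<lambda>\<omega>. iexp (\<Sum>i<N. u i \<bullet> (W (b i) \<omega> - W (a i) \<omega>))) \<in> borel_measurable gauss_space" by measurable
      qed auto
      moreover have "(\<lambda>l. CLINT \<omega>|gauss_space. iexp (?R l \<omega>))
          \<longlonglongrightarrow> complex_of_real (exp (- (\<Sum>i<N. \<Sum>j<N. cov (u i) (u j) * overlap (a i) (b i) (a j) (b j)) / 2))"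
        unfolding step overlap_def by (intro tendsto_intros lim) auto
      ultimately show "(CLINT \<omega>|gauss_space. iexp (\<Sum>i<N. u i \<bullet> (W (b i) \<omega> - W (a i) \<omega>)))
        = exp (- (\<Sum>i<N. \<Sum>j<N. cov (u i) (u j) * overlap (a i) (b i) (a j) (b j)) / 2)"
        by (rule LIMSEQ_unique)
    qed
  qed
qed

lemma scaled_noise_indep:
  "gauss.indep_vars (\<lambda>_. borel) (\<lambda>i \<omega>. c i *\<^sub>R noise (0, i) \<omega>) (UNIV :: nat set)"
proof -
  let ?K = "\<lambda>i. Pair (0::nat, i) ` A"
  have "gauss.indep_vars (\<lambda>i. PiM (?K i) (\<lambda>_. borel)) (\<lambda>i \<omega>. restrict (\<lambda>a. \<omega> a) (?K i)) UNIV"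
    by (rule gauss.indep_vars_restrict[OF coord_indep]) (auto simp: disjoint_family_on_def)
  then have "gauss.indep_vars (\<lambda>_. borel)
      (\<lambda>i \<omega>. c i *\<^sub>R (\<Sum>x\<in>A. restrict (\<lambda>a. \<omega> a) (?K i) ((0, i), x) *\<^sub>R b x)) UNIV"
    by (rule gauss.indep_vars_compose2) (auto intro!: borel_measurable_scaleR borel_measurable_sum measurable_component_singleton)
  then show ?thesis by (simp add: noise_def cong: sum.cong)
qed

text \<open>The law of the continuous path is put on the path space itself. The increments over consecutive
  intervals have the same joint characteristic function, hence the same joint law, as independent
  scaled noise vectors, so they are independent.\<close>

theorem brownian_motion_exists:
  assumes S: "\<And>u. u \<bullet> (S *v u) = cov u u"
  obtains P :: "(real \<Rightarrow> real ^ 'd) measure"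
  where "brownian_motion P S (\<lambda>t f. f t)" "sets P = sets (borel_of path_topology)" "space P = cont_paths"
    "\<forall>(k::nat) u t. (\<forall>i. 0 \<le> t i) \<longrightarrow>
      (CLINT f|P. iexp (\<Sum>i<k. u i \<bullet> f (t i))) = exp (- (\<Sum>i<k. \<Sum>j<k. cov (u i) (u j) * min (t i) (t j)) / 2)"
proof -
  obtain W where W: "\<And>\<omega>. continuous_on {0..} (\<lambda>t. W t \<omega>)" "\<And>t. 0 \<le> t \<Longrightarrow> W t \<in> borel_measurable gauss_space"
    "AE \<omega> in gauss_space. W 0 \<omega> = 0"
    "\<forall>(N::nat) u a b. (\<forall>i. 0 \<le> a i \<and> a i \<le> b i) \<longrightarrow>
      (CLINT \<omega>|gauss_space. iexp (\<Sum>i<N. u i \<bullet> (W (b i) \<omega> - W (a i) \<omega>)))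
      = exp (- (\<Sum>i<N. \<Sum>j<N. cov (u i) (u j) * overlap (a i) (b i) (a j) (b j)) / 2)"
    by (rule gaussian_path_exists) (rule that)
  let ?B = "borel_of (path_topology :: (real \<Rightarrow> real ^ 'd) topology)"
  let ?Y = "\<lambda>\<omega>. path_of (\<lambda>t. W t \<omega>)"
  have Y [measurable]: "?Y \<in> measurable gauss_space ?B"
    by (rule measurable_pathI) (use W(1,2) in \<open>auto intro: path_of_in_cont_paths\<close>)
  define P where "P = distr gauss_space ?B ?Y"
  interpret P: prob_space P unfolding P_def by (rule gauss.prob_space_distr[OF Y])
  have sets_P: "sets P = sets ?B" and space_P: "space P = cont_paths"
    by (simp_all add: P_def)
  have eval: "(\<lambda>f. f t) \<in> borel_measurable P" if "0 \<le> t" for t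
    using measurable_eval[OF that] by (simp add: measurable_cong_sets[OF sets_P refl])
  have evalB: "(\<lambda>f. f t :: real ^ 'd) \<in> borel_measurable ?B" if "0 \<le> t" for t
    by (rule measurable_eval[OF that])
  have iexp: "(CLINT f|P. iexp (\<Sum>i<N. u i \<bullet> (f (r i) - f (a i))))
      = exp (- (\<Sum>i<N. \<Sum>j<N. cov (u i) (u j) * overlap (a i) (r i) (a j) (r j)) / 2)"
    if ab: "\<And>i. 0 \<le> a i \<and> a i \<le> r i" for N :: nat and u :: "nat \<Rightarrow> real ^ 'd" and a r :: "nat \<Rightarrow> real"
  proof -
    have b0: "0 \<le> r i" and a0: "0 \<le> a i" for i using ab[of i] by auto
    have m [measurable]: "(\<lambda>f :: real \<Rightarrow> real ^ 'd. \<Sum>i<N. u i \<bullet> (f (r i) - f (a i))) \<in> borel_measurable ?B"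
      by (intro borel_measurable_sum borel_measurable_inner borel_measurable_diff evalB a0 b0) auto
    have mi: "(\<lambda>f. iexp (\<Sum>i<N. u i \<bullet> (f (r i) - f (a i)))) \<in> borel_measurable ?B" by measurable
    have "(CLINT f|P. iexp (\<Sum>i<N. u i \<bullet> (f (r i) - f (a i))))
        = (CLINT \<omega>|gauss_space. iexp (\<Sum>i<N. u i \<bullet> (?Y \<omega> (r i) - ?Y \<omega> (a i))))"
      unfolding P_def by (rule integral_distr[OF Y mi])
    then show ?thesis using W(4) ab a0 b0 by simp
  qed
  have start: "AE f in P. f 0 = 0"
    unfolding P_def
  proof (subst AE_distr_iff[OF Y])
    have "{f \<in> space ?B. f 0 = (0 :: real ^ 'd)} = (\<lambda>f. f 0) -` {0} \<inter> space ?B" by auto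
    then show "{f \<in> space ?B. f 0 = (0 :: real ^ 'd)} \<in> sets ?B"
      using measurable_sets[OF evalB[of 0], of "{0}"] by simp
    show "AE \<omega> in gauss_space. ?Y \<omega> 0 = 0" using W(3) by simp
  qed
  have gauss: "gaussian_vector P ((t - s) *\<^sub>R S) (\<lambda>f. f t - f s)" if st: "0 \<le> s" "s \<le> t" for s t
    unfolding gaussian_vector_def
  proof (intro conjI allI)
    have m: "(\<lambda>f. f t - f s) \<in> borel_measurable P"
      using st by (intro borel_measurable_diff eval) auto
    then show "(\<lambda>f. f t - f s) \<in> borel_measurable P" .
    fix u :: "real ^ 'd"
    let ?v = "(t - s) * cov u u"
    have v: "u \<bullet> (((t - s) *\<^sub>R S) *v u) = ?v"
      by (simp add: S[symmetric] scaleR_matrix_vector_assoc[symmetric])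
    have v0: "0 \<le> ?v" using st by (intro mult_nonneg_nonneg cov_nonneg) auto
    have mu: "(\<lambda>f. u \<bullet> (f t - f s)) \<in> borel_measurable P"
      using m by (intro borel_measurable_inner) auto
    have "char (distr P borel (\<lambda>f. u \<bullet> (f t - f s))) \<theta> = char (normal_law 0 ?v) \<theta>" for \<theta>
    proof -
      have "char (distr P borel (\<lambda>f. u \<bullet> (f t - f s))) \<theta> = (CLINT f|P. iexp (\<Sum>i<1::nat. (\<theta> *\<^sub>R u) \<bullet> (f t - f s)))"
        unfolding char_def by (subst integral_distr[OF mu]) auto
      also have "\<dots> = exp (- (\<Sum>i<1::nat. \<Sum>j<1::nat. cov (\<theta> *\<^sub>R u) (\<theta> *\<^sub>R u) * overlap s t s t) / 2)"
        using st by (intro iexp) auto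
      also have "\<dots> = char (normal_law 0 ?v) \<theta>"
        unfolding normal_law_char(2)[OF v0] using st
        by (simp add: cov_scaleR_left cov_scaleR_right overlap_def power2_eq_square mult_ac)
      finally show ?thesis .
    qed
    then show "distr P borel (\<lambda>f. u \<bullet> (f t - f s)) = normal_law 0 (u \<bullet> (((t - s) *\<^sub>R S) *v u))"
      unfolding v by (intro Levy_uniqueness ext normal_law_char(1)[OF v0] P.real_distribution_distr mu)
  qed
  have indep: "P.indep_vars (\<lambda>_. borel) (\<lambda>i f. f (t (Suc i)) - f (t i)) {..<k}"
    if t0: "0 \<le> t 0" and mono: "mono_on {..k} t" for k :: nat and t :: "nat \<Rightarrow> real"
  proof -
    \<comment> \<open>Freezing the times after \<open>k\<close> extends the increments to an infinite sequence by zeros.\<close>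
    define t' where "t' i = t (min i k)" for i
    have mono': "t' i \<le> t' j" if "i \<le> j" for i j
      unfolding t'_def using that by (intro mono_onD[OF mono]) auto
    have t'0: "0 \<le> t' i" for i using mono'[of 0 i] t0 by (simp add: t'_def)
    have ab: "0 \<le> t' i \<and> t' i \<le> t' (Suc i)" for i using t'0 mono' by simp
    have ov: "overlap (t' i) (t' (Suc i)) (t' j) (t' (Suc j)) = (if i = j then t' (Suc i) - t' i else 0)" for i j
    proof (cases i j rule: linorder_cases)
      case less
      then show ?thesis using mono'[of "Suc i" j] by (simp add: overlap_def)
    next
      case equal
      then show ?thesis using mono'[of i "Suc i"] by (simp add: overlap_def)
    next
      case greater
      then show ?thesis using mono'[of "Suc j" i] by (simp add: overlap_def)
    qed
    let ?Z = "\<lambda>\<omega> i. sqrt (t' (Suc i) - t' i) *\<^sub>R noise (0, i) \<omega>"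
    have law: "distr P borel (\<lambda>f i. f (t' (Suc i)) - f (t' i)) = distr gauss_space borel ?Z"
    proof (rule sequence_law_eq[OF P.prob_space_axioms prob_space_gauss_space])
      show "(\<lambda>f. f (t' (Suc i)) - f (t' i)) \<in> borel_measurable P" for i
        by (intro borel_measurable_diff eval t'0)
      show "(\<lambda>\<omega>. ?Z \<omega> i) \<in> borel_measurable gauss_space" for i by measurable
      fix N :: nat and u :: "nat \<Rightarrow> real ^ 'd"
      have inj: "inj_on (Pair (0::nat)) {..<N}" by (simp add: inj_on_def)
      have "(CLINT f|P. iexp (\<Sum>i<N. u i \<bullet> (f (t' (Suc i)) - f (t' i))))
          = exp (- (\<Sum>i<N. \<Sum>j<N. cov (u i) (u j) * overlap (t' i) (t' (Suc i)) (t' j) (t' (Suc j))) / 2)"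
        by (rule iexp[OF ab])
      also have "(\<Sum>i<N. \<Sum>j<N. cov (u i) (u j) * overlap (t' i) (t' (Suc i)) (t' j) (t' (Suc j)))
          = (\<Sum>i<N. cov (u i) (u i) * (t' (Suc i) - t' i))"
        unfolding ov by (intro sum.cong refl) (simp add: if_distrib cong: if_cong)
      also have "\<dots> = (\<Sum>i<N. cov (sqrt (t' (Suc i) - t' i) *\<^sub>R u i) (sqrt (t' (Suc i) - t' i) *\<^sub>R u i))"
        using ab by (intro sum.cong refl) (simp add: cov_scaleR_left cov_scaleR_right mult.assoc[symmetric] mult.commute)
      also have "complex_of_real (exp (- \<dots> / 2))
          = (CLINT \<omega>|gauss_space. iexp (\<Sum>n\<in>Pair 0 ` {..<N}. (sqrt (t' (Suc (snd n)) - t' (snd n)) *\<^sub>R u (snd n)) \<bullet> noise n \<omega>))"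
        by (subst noise_linear_iexp) (auto simp: sum.reindex[OF inj])
      also have "\<dots> = (CLINT \<omega>|gauss_space. iexp (\<Sum>i<N. u i \<bullet> ?Z \<omega> i))"
        by (simp add: sum.reindex[OF inj])
      finally show "(CLINT f|P. iexp (\<Sum>i<N. u i \<bullet> (f (t' (Suc i)) - f (t' i)))) = (CLINT \<omega>|gauss_space. iexp (\<Sum>i<N. u i \<bullet> ?Z \<omega> i))" .
    qed
    have "P.indep_vars (\<lambda>_. borel) (\<lambda>i f. f (t' (Suc i)) - f (t' i)) UNIV"
    proof (rule indep_vars_of_law_eq[OF P.prob_space_axioms prob_space_gauss_space _ _ law])
      show "(\<lambda>f. f (t' (Suc i)) - f (t' i)) \<in> borel_measurable P" for i
        by (intro borel_measurable_diff eval t'0)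
      show "gauss.indep_vars (\<lambda>_. borel) (\<lambda>i \<omega>. ?Z \<omega> i) UNIV" by (rule scaled_noise_indep)
    qed
    then have "P.indep_vars (\<lambda>_. borel) (\<lambda>i f. f (t' (Suc i)) - f (t' i)) {..<k}"
      by (rule P.indep_vars_subset) simp
    then show ?thesis
      by (rule P.indep_vars_cong[THEN iffD1, rotated 3]) (auto simp: t'_def)
  qed
  have bm: "brownian_motion P S (\<lambda>t f. f t)"
  proof
    show "continuous_on {0..} (\<lambda>t. f t)" if "f \<in> space P" for f
      using that by (simp add: space_P cont_paths_def)
  qed (use eval start gauss indep in auto)
  show thesis
  proof (rule that[OF bm sets_P space_P], intro allI impI)
    fix k :: nat and u :: "nat \<Rightarrow> real ^ 'd" and t :: "nat \<Rightarrow> real" assume "\<forall>i. 0 \<le> t i"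
    then have t: "0 \<le> t i" for i by blast
    have m: "(\<lambda>f. f s :: real ^ 'd) \<in> borel_measurable P" if "0 \<le> s" for s by (rule eval[OF that])
    have m1: "(\<lambda>f. \<Sum>i<k. u i \<bullet> f (t i)) \<in> borel_measurable P"
      by (intro borel_measurable_sum borel_measurable_inner m t) auto
    have m2: "(\<lambda>f. \<Sum>i<k. u i \<bullet> (f (t i) - f 0)) \<in> borel_measurable P"
      by (intro borel_measurable_sum borel_measurable_inner borel_measurable_diff m t) auto
    have "(CLINT f|P. iexp (\<Sum>i<k. u i \<bullet> f (t i))) = (CLINT f|P. iexp (\<Sum>i<k. u i \<bullet> (f (t i) - f 0)))"
    proof (rule integral_cong_AE)
      show "AE f in P. iexp (\<Sum>i<k. u i \<bullet> f (t i)) = iexp (\<Sum>i<k. u i \<bullet> (f (t i) - f 0))"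
        using start by eventually_elim simp
    qed (use m1 m2 in measurable)
    also have "\<dots> = exp (- (\<Sum>i<k. \<Sum>j<k. cov (u i) (u j) * overlap 0 (t i) 0 (t j)) / 2)"
      using t by (intro iexp) auto
    also have "(\<Sum>i<k. \<Sum>j<k. cov (u i) (u j) * overlap 0 (t i) 0 (t j))
        = (\<Sum>i<k. \<Sum>j<k. cov (u i) (u j) * min (t i) (t j))"
      using t by (intro sum.cong refl) (simp add: overlap_def)
    finally show "(CLINT f|P. iexp (\<Sum>i<k. u i \<bullet> f (t i))) = exp (- (\<Sum>i<k. \<Sum>j<k. cov (u i) (u j) * min (t i) (t j)) / 2)" .
  qed
qed

end

section \<open>Donsker's theorem for bounded steps\<close>

definition ramp :: "nat \<Rightarrow> real \<Rightarrow> real" where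
  "ramp i x = max 0 (min 1 (x - real i))"

lemma ramp_bounds: "0 \<le> ramp i x" "ramp i x \<le> 1"
  by (auto simp: ramp_def)

lemma ramp_mono: "x \<le> y \<Longrightarrow> ramp i x \<le> ramp i y"
  by (auto simp: ramp_def)

lemma sum_ramp:
  assumes "0 \<le> x" "x \<le> real m"
  shows "(\<Sum>i<m. ramp i x) = x"
proof -
  have "polygon 1 real x = x"
  proof -
    obtain k where k: "real k \<le> x" "x < real (k + 1)" using segment_index[OF assms(1)] .
    then show ?thesis by (subst polygon_segment[of k]) auto
  qed
  then show ?thesis
    using polygon_eq_ramps[of 1 x m real] assms by (simp add: ramp_def)
qed

text \<open>Only the cell that contains \<open>y\<close> has a weight \<open>ramp i x\<close> that is positive while
  \<open>ramp i y\<close> is below \<open>1\<close>.\<close>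

lemma sum_ramp_mult:
  assumes "0 \<le> x" "x \<le> y" "y \<le> real m"
  shows "\<bar>(\<Sum>i<m. ramp i x * ramp i y) - x\<bar> \<le> 1"
proof -
  define j where "j = nat \<lfloor>y\<rfloor>"
  have y0: "0 \<le> y" using assms by simp
  have d: "0 \<le> ramp i x - ramp i x * ramp i y" "ramp i x - ramp i x * ramp i y \<le> (if i = j then 1 else 0)" for i
  proof -
    show "0 \<le> ramp i x - ramp i x * ramp i y"
      using mult_left_le[OF ramp_bounds(2) ramp_bounds(1)] by simp
    have p: "0 \<le> ramp i x * ramp i y" by (intro mult_nonneg_nonneg ramp_bounds)
    show "ramp i x - ramp i x * ramp i y \<le> (if i = j then 1 else 0)"
    proof (cases "i = j")
      case True
      then show ?thesis using p ramp_bounds(2)[of i x] by simp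
    next
      case False
      have "real i \<ge> y \<or> y \<ge> real i + 1" using False y0 unfolding j_def by linarith
      then have "ramp i x = 0 \<or> ramp i y = 1" using assms(2) by (auto simp: ramp_def)
      then show ?thesis using False by auto
    qed
  qed
  have "x - (\<Sum>i<m. ramp i x * ramp i y) = (\<Sum>i<m. ramp i x - ramp i x * ramp i y)"
    using sum_ramp[of x m] assms by (simp add: sum_subtractf)
  moreover have "0 \<le> (\<Sum>i<m. ramp i x - ramp i x * ramp i y)" by (intro sum_nonneg d)
  moreover have "(\<Sum>i<m. ramp i x - ramp i x * ramp i y) \<le> (\<Sum>i<m. if i = j then 1 else 0)"
    by (intro sum_mono d)
  moreover have "(\<Sum>i<m. if i = j then 1 else 0) \<le> (1::real)" by simp
  ultimately show ?thesis by linarith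
qed

locale bounded_centered_iid = prob_space M
  for M :: "'a measure" and \<xi> :: "nat \<Rightarrow> 'a \<Rightarrow> real ^ 'd" and K :: real +
  assumes indep: "indep_vars (\<lambda>_. borel) \<xi> {1..}"
    and ident: "\<And>n. 1 \<le> n \<Longrightarrow> distr M borel (\<xi> n) = distr M borel (\<xi> 1)"
    and bounded: "\<And>n \<omega>. 1 \<le> n \<Longrightarrow> \<omega> \<in> space M \<Longrightarrow> norm (\<xi> n \<omega>) \<le> K"
    and mean: "\<And>n. 1 \<le> n \<Longrightarrow> expectation (\<xi> n) = 0"
begin

definition step_cov :: "real ^ 'd \<Rightarrow> real ^ 'd \<Rightarrow> real" where
  "step_cov u v = expectation (\<lambda>\<omega>. (u \<bullet> \<xi> 1 \<omega>) * (v \<bullet> \<xi> 1 \<omega>))"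

lemma \<xi>_measurable: "1 \<le> n \<Longrightarrow> \<xi> n \<in> borel_measurable M"
  using indep by (auto simp: indep_vars_def)

lemma K_nonneg: "0 \<le> K"
proof -
  obtain \<omega> where "\<omega> \<in> space M" using not_empty by blast
  from bounded[OF order_refl this] show ?thesis using norm_ge_zero[of "\<xi> 1 \<omega>"] by linarith
qed

lemma \<xi>_integrable: "1 \<le> n \<Longrightarrow> integrable M (\<xi> n)"
  by (rule integrable_const_bound[of _ K]) (auto intro!: AE_I2 bounded \<xi>_measurable)

lemma inner_bounded: "1 \<le> n \<Longrightarrow> \<omega> \<in> space M \<Longrightarrow> \<bar>u \<bullet> \<xi> n \<omega>\<bar> \<le> norm u * K"
  by (rule order_trans[OF Cauchy_Schwarz_ineq2 mult_left_mono[OF bounded]]) auto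

lemma inner_mean: "1 \<le> n \<Longrightarrow> expectation (\<lambda>\<omega>. u \<bullet> \<xi> n \<omega>) = 0"
  using \<xi>_integrable mean by simp

lemma inner_mult_integrable:
  assumes "1 \<le> n" shows "integrable M (\<lambda>\<omega>. (u \<bullet> \<xi> n \<omega>) * (v \<bullet> \<xi> n \<omega>))"
proof (rule integrable_const_bound[of _ "(norm u * K) * (norm v * K)"])
  show "AE \<omega> in M. norm ((u \<bullet> \<xi> n \<omega>) * (v \<bullet> \<xi> n \<omega>)) \<le> (norm u * K) * (norm v * K)"
    using assms K_nonneg by (auto simp: abs_mult intro!: AE_I2 mult_mono inner_bounded)
  show "(\<lambda>\<omega>. (u \<bullet> \<xi> n \<omega>) * (v \<bullet> \<xi> n \<omega>)) \<in> borel_measurable M"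
    using \<xi>_measurable[OF assms] by measurable
qed

lemma inner_mult_expectation:
  assumes n: "1 \<le> n" shows "expectation (\<lambda>\<omega>. (u \<bullet> \<xi> n \<omega>) * (v \<bullet> \<xi> n \<omega>)) = step_cov u v"
proof -
  have m: "(\<lambda>z. (u \<bullet> z) * (v \<bullet> z)) \<in> borel_measurable borel" by measurable
  have "expectation (\<lambda>\<omega>. (u \<bullet> \<xi> n \<omega>) * (v \<bullet> \<xi> n \<omega>)) = (\<integral>z. (u \<bullet> z) * (v \<bullet> z) \<partial>distr M borel (\<xi> n))"
    by (rule integral_distr[symmetric, OF \<xi>_measurable[OF n] m])
  also have "\<dots> = step_cov u v"
    unfolding step_cov_def ident[OF n] by (rule integral_distr[OF \<xi>_measurable m]) simp
  finally show ?thesis .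
qed

lemma step_cov_sum: "step_cov (\<Sum>k\<in>I. c k *\<^sub>R u k) (\<Sum>l\<in>J. e l *\<^sub>R v l) = (\<Sum>k\<in>I. \<Sum>l\<in>J. c k * e l * step_cov (u k) (v l))"
proof -
  have "step_cov (\<Sum>k\<in>I. c k *\<^sub>R u k) (\<Sum>l\<in>J. e l *\<^sub>R v l)
      = expectation (\<lambda>\<omega>. \<Sum>k\<in>I. \<Sum>l\<in>J. (c k * e l) * ((u k \<bullet> \<xi> 1 \<omega>) * (v l \<bullet> \<xi> 1 \<omega>)))"
    unfolding step_cov_def by (simp add: inner_sum_left sum_product mult_ac)
  also have "\<dots> = (\<Sum>k\<in>I. \<Sum>l\<in>J. expectation (\<lambda>\<omega>. (c k * e l) * ((u k \<bullet> \<xi> 1 \<omega>) * (v l \<bullet> \<xi> 1 \<omega>))))"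
    by (subst Bochner_Integration.integral_sum; (intro sum.cong refl Bochner_Integration.integral_sum)?)
       (intro Bochner_Integration.integrable_sum integrable_mult_right inner_mult_integrable order_refl)+
  finally show ?thesis by (simp add: step_cov_def)
qed

lemma weighted_inner_indep:
  "indep_vars (\<lambda>_. borel) (\<lambda>i \<omega>. c i \<bullet> \<xi> i \<omega>) {1..m}"
  by (rule indep_vars_compose2[OF indep_vars_subset[OF indep]]) auto

text \<open>The weights are at most \<open>1\<close> in modulus, so the sum of their squares, which controls the variance, is
  bounded by the sum of their moduli. For the path weights the latter is just the elapsed time.\<close>

lemma weighted_sum_fourth_moment:
  assumes c: "\<And>i. i \<in> {1..m} \<Longrightarrow> \<bar>c i\<bar> \<le> 1" and s: "(\<Sum>i\<in>{1..m}. \<bar>c i\<bar>) \<le> s" and q: "0 \<le> q"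
  shows "integrable M (\<lambda>\<omega>. norm (\<Sum>i\<in>{1..m}. (q * c i) *\<^sub>R \<xi> i \<omega>) ^ 4)"
    and "expectation (\<lambda>\<omega>. norm (\<Sum>i\<in>{1..m}. (q * c i) *\<^sub>R \<xi> i \<omega>) ^ 4) \<le> (real CARD('d))\<^sup>2 * (3 * (K\<^sup>2 * q\<^sup>2 * s)\<^sup>2)"
proof -
  let ?T = "\<lambda>\<omega>. \<Sum>i\<in>{1..m}. (q * c i) *\<^sub>R \<xi> i \<omega>"
  have T: "?T \<in> borel_measurable M"
    by (intro borel_measurable_sum borel_measurable_scaleR \<xi>_measurable) auto
  have comp: "integrable M (\<lambda>\<omega>. (?T \<omega> $ j) ^ 4)" "expectation (\<lambda>\<omega>. (?T \<omega> $ j) ^ 4) \<le> 3 * (K\<^sup>2 * q\<^sup>2 * s)\<^sup>2" for j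
  proof -
    let ?X = "\<lambda>i \<omega>. (q * c i) * \<xi> i \<omega> $ j"
    let ?s = "\<lambda>i. K\<^sup>2 * q\<^sup>2 * (c i)\<^sup>2"
    have "indep_vars (\<lambda>_. borel) (\<lambda>i \<omega>. ((q * c i) *\<^sub>R axis j 1) \<bullet> \<xi> i \<omega>) {1..m}" by (rule weighted_inner_indep)
    then have ind: "indep_vars (\<lambda>_. borel) ?X {1..m}" by (simp add: inner_axis' mult.assoc)
    have Xm: "?X i \<in> borel_measurable M" if "i \<in> {1..m}" for i
      using ind that by (auto simp: indep_vars_def)
    have Xb: "(?X i \<omega>)\<^sup>2 \<le> ?s i" if "i \<in> {1..m}" "\<omega> \<in> space M" for i \<omega>
    proof -
      have "\<bar>\<xi> i \<omega> $ j\<bar> \<le> K" using component_le_norm_cart[of "\<xi> i \<omega>" j] bounded[of i \<omega>] that by auto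
      then have "(\<xi> i \<omega> $ j)\<^sup>2 \<le> K\<^sup>2" using power_mono[of "\<bar>\<xi> i \<omega> $ j\<bar>" K 2] by simp
      then have "(q * c i)\<^sup>2 * (\<xi> i \<omega> $ j)\<^sup>2 \<le> (q * c i)\<^sup>2 * K\<^sup>2" by (intro mult_left_mono) auto
      then show ?thesis by (simp add: power_mult_distrib mult_ac)
    qed
    have X4: "?X i \<omega> ^ 4 \<le> (?s i)\<^sup>2" if "i \<in> {1..m}" "\<omega> \<in> space M" for i \<omega>
    proof -
      have "((?X i \<omega>)\<^sup>2)\<^sup>2 \<le> (?s i)\<^sup>2" using Xb[OF that] by (intro power_mono) auto
      then show ?thesis by simp
    qed
    have i2: "integrable M (\<lambda>\<omega>. (?X i \<omega>)\<^sup>2)" if "i \<in> {1..m}" for i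
      using Xb[OF that] Xm[OF that] by (intro integrable_const_bound[of _ "?s i"] AE_I2 borel_measurable_power) auto
    have i4: "integrable M (\<lambda>\<omega>. ?X i \<omega> ^ 4)" if "i \<in> {1..m}" for i
      using X4[OF that] Xm[OF that] by (intro integrable_const_bound[of _ "(?s i)\<^sup>2"] AE_I2 borel_measurable_power) auto
    have res: "integrable M (\<lambda>\<omega>. (\<Sum>i\<in>{1..m}. ?X i \<omega>) ^ 4) \<and> expectation (\<lambda>\<omega>. \<Sum>i\<in>{1..m}. ?X i \<omega>) = 0 \<and>
      expectation (\<lambda>\<omega>. (\<Sum>i\<in>{1..m}. ?X i \<omega>)\<^sup>2) \<le> (\<Sum>i\<in>{1..m}. ?s i) \<and>
      expectation (\<lambda>\<omega>. (\<Sum>i\<in>{1..m}. ?X i \<omega>) ^ 4) \<le> 3 * (\<Sum>i\<in>{1..m}. ?s i)\<^sup>2"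
    proof (rule fourth_moment_sum[OF _ ind i4])
      fix i assume i: "i \<in> {1..m}"
      have "expectation (\<lambda>\<omega>. ((q * c i) *\<^sub>R axis j 1) \<bullet> \<xi> i \<omega>) = 0" using i by (intro inner_mean) auto
      then show "expectation (?X i) = 0" by (simp add: inner_axis' mult.assoc)
      have "expectation (\<lambda>\<omega>. (?X i \<omega>)\<^sup>2) \<le> expectation (\<lambda>_. ?s i)"
        by (intro integral_mono i2[OF i] Xb[OF i]) auto
      then show "expectation (\<lambda>\<omega>. (?X i \<omega>)\<^sup>2) \<le> ?s i" by (simp add: prob_space)
      have "expectation (\<lambda>\<omega>. ?X i \<omega> ^ 4) \<le> expectation (\<lambda>_. (?s i)\<^sup>2)"
        by (intro integral_mono i4[OF i] X4[OF i]) auto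
      also have "\<dots> \<le> 3 * (?s i)\<^sup>2" by (simp add: prob_space)
      finally show "expectation (\<lambda>\<omega>. ?X i \<omega> ^ 4) \<le> 3 * (?s i)\<^sup>2" .
    qed auto
    have "(\<Sum>i\<in>{1..m}. ?s i) = K\<^sup>2 * q\<^sup>2 * (\<Sum>i\<in>{1..m}. (c i)\<^sup>2)" by (simp only: sum_distrib_left)
    also have "\<dots> \<le> K\<^sup>2 * q\<^sup>2 * s"
    proof (intro mult_left_mono order_trans[OF sum_mono s])
      fix i assume "i \<in> {1..m}"
      then have "\<bar>c i\<bar> * \<bar>c i\<bar> \<le> \<bar>c i\<bar>" by (intro mult_left_le c) auto
      then show "(c i)\<^sup>2 \<le> \<bar>c i\<bar>" by (simp add: power2_eq_square)
    qed auto
    finally have "(\<Sum>i\<in>{1..m}. ?s i)\<^sup>2 \<le> (K\<^sup>2 * q\<^sup>2 * s)\<^sup>2" by (intro power_mono sum_nonneg) auto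
    then show "integrable M (\<lambda>\<omega>. (?T \<omega> $ j) ^ 4)" "expectation (\<lambda>\<omega>. (?T \<omega> $ j) ^ 4) \<le> 3 * (K\<^sup>2 * q\<^sup>2 * s)\<^sup>2"
      using res by auto
  qed
  show "integrable M (\<lambda>\<omega>. norm (?T \<omega>) ^ 4)" by (rule vector_fourth_moment[OF T comp])
  show "expectation (\<lambda>\<omega>. norm (?T \<omega>) ^ 4) \<le> (real CARD('d))\<^sup>2 * (3 * (K\<^sup>2 * q\<^sup>2 * s)\<^sup>2)"
    by (rule vector_fourth_moment[OF T comp])
qed

definition walk_path :: "nat \<Rightarrow> real \<Rightarrow> 'a \<Rightarrow> real ^ 'd" where
  "walk_path n t \<omega> = polygon (real n) (\<lambda>k. (\<Sum>i = 1..k. \<xi> i \<omega>) /\<^sub>R sqrt (real n)) t"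

lemma walk_path_ramps:
  assumes "0 \<le> t" "real n * t \<le> real m"
  shows "walk_path n t \<omega> = (\<Sum>i\<in>{1..m}. (inverse (sqrt (real n)) * ramp (i - 1) (real n * t)) *\<^sub>R \<xi> i \<omega>)"
proof -
  have "walk_path n t \<omega> = (\<Sum>i<m. (inverse (sqrt (real n)) * ramp i (real n * t)) *\<^sub>R \<xi> (Suc i) \<omega>)"
    unfolding walk_path_def using assms
    by (subst polygon_eq_ramps[of _ _ m]) (auto simp: ramp_def scaleR_diff_right[symmetric] mult.commute)
  also have "\<dots> = (\<Sum>i\<in>{1..m}. (inverse (sqrt (real n)) * ramp (i - 1) (real n * t)) *\<^sub>R \<xi> i \<omega>)"
    using sum.atLeast1_atMost_eq[of "\<lambda>i. (inverse (sqrt (real n)) * ramp (i - 1) (real n * t)) *\<^sub>R \<xi> i \<omega>" m]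
    by simp
  finally show ?thesis .
qed

lemma walk_path_measurable: "walk_path n t \<in> borel_measurable M"
  unfolding walk_path_def[abs_def] polygon_def Let_def
  by (intro borel_measurable_add borel_measurable_scaleR borel_measurable_diff borel_measurable_sum \<xi>_measurable
      borel_measurable_const) auto

lemma sum_ramp_shift: "(\<Sum>i\<in>{1..m}. f (i - 1)) = (\<Sum>i<m. f i)" for f :: "nat \<Rightarrow> real"
  using sum.atLeast1_atMost_eq[of "\<lambda>i. f (i - 1)" m] by simp

definition dev_const :: real where
  "dev_const = (real CARD('d))\<^sup>2 * (3 * (K\<^sup>2)\<^sup>2)"

lemma inverse_sqrt_power: "1 \<le> n \<Longrightarrow> (inverse (sqrt (real n)))\<^sup>2 * (real n * x) = x"
  by (simp add: power_inverse)

lemma walk_path_fourth_moment: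
  assumes n: "1 \<le> n" and t: "0 \<le> t"
  shows "integrable M (\<lambda>\<omega>. norm (walk_path n t \<omega>) ^ 4)"
    and "expectation (\<lambda>\<omega>. norm (walk_path n t \<omega>) ^ 4) \<le> dev_const * t\<^sup>2"
proof -
  obtain m :: nat where m: "real n * t \<le> real m" using real_arch_simple by blast
  have s: "(\<Sum>i\<in>{1..m}. \<bar>ramp (i - 1) (real n * t)\<bar>) \<le> real n * t"
    using sum_ramp[of "real n * t" m] m t sum_ramp_shift[of "\<lambda>i. ramp i (real n * t)" m]
    by (simp add: ramp_bounds)
  note * = weighted_sum_fourth_moment[of m "\<lambda>i. ramp (i - 1) (real n * t)", OF _ s, of "inverse (sqrt (real n))"]
  show "integrable M (\<lambda>\<omega>. norm (walk_path n t \<omega>) ^ 4)"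
    unfolding walk_path_ramps[OF t m] by (rule *) (auto simp: ramp_bounds)
  have "expectation (\<lambda>\<omega>. norm (walk_path n t \<omega>) ^ 4) \<le>
      (real CARD('d))\<^sup>2 * (3 * (K\<^sup>2 * (inverse (sqrt (real n)))\<^sup>2 * (real n * t))\<^sup>2)"
    unfolding walk_path_ramps[OF t m] by (rule *) (auto simp: ramp_bounds)
  then show "expectation (\<lambda>\<omega>. norm (walk_path n t \<omega>) ^ 4) \<le> dev_const * t\<^sup>2"
    unfolding mult.assoc inverse_sqrt_power[OF n] by (simp add: dev_const_def power_mult_distrib mult_ac)
qed

text \<open>The deviation of a new node from the chord is a weighted sum of steps; the modulus of each weight is
  at most the weight of that step in the increment over the whole dyadic interval.\<close>

lemma walk_path_dyadic_process:
  assumes n: "1 \<le> n"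
  shows "dyadic_process M (\<lambda>l k \<omega>. walk_path n (real k / 2 ^ l) \<omega>) dev_const"
proof
  fix l k
  show "(\<lambda>\<omega>. walk_path n (real k / 2 ^ l) \<omega>) \<in> borel_measurable M" by (rule walk_path_measurable)
  show "walk_path n (real (2 * k) / 2 ^ Suc l) \<omega> = walk_path n (real k / 2 ^ l) \<omega>" for \<omega> by simp
  define s where "s = real k / 2 ^ l"
  define h where "h = real (2 * k + 1) / 2 ^ Suc l"
  define e where "e = real (k + 1) / 2 ^ l"
  have ord: "0 \<le> s" "s \<le> h" "h \<le> e" and len: "e - s = 1 / 2 ^ l"
    unfolding s_def h_def e_def by (simp_all add: field_simps)
  obtain m :: nat where m: "real n * e \<le> real m" using real_arch_simple by blast
  have mono: "real n * s \<le> real n * h" "real n * h \<le> real n * e" using ord by (auto intro: mult_left_mono)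
  define c where "c i = ramp (i - 1) (real n * h) - (1/2) * (ramp (i - 1) (real n * s) + ramp (i - 1) (real n * e))" for i
  have c: "\<bar>c i\<bar> \<le> ramp (i - 1) (real n * e) - ramp (i - 1) (real n * s)" for i
  proof -
    have "\<bar>y - (1/2) * (x + z)\<bar> \<le> z - x" if "x \<le> y" "y \<le> z" for x y z :: real
      using that by (simp add: abs_if field_simps)
    from this[OF ramp_mono[OF mono(1)] ramp_mono[OF mono(2)]] show ?thesis unfolding c_def .
  qed
  have dev: "walk_path n h \<omega> - (1/2) *\<^sub>R (walk_path n s \<omega> + walk_path n e \<omega>)
      = (\<Sum>i\<in>{1..m}. (inverse (sqrt (real n)) * c i) *\<^sub>R \<xi> i \<omega>)" for \<omega>
  proof -
    let ?q = "inverse (sqrt (real n))"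
    have w: "walk_path n r \<omega> = (\<Sum>i\<in>{1..m}. (?q * ramp (i - 1) (real n * r)) *\<^sub>R \<xi> i \<omega>)"
      if "r = s \<or> r = h \<or> r = e" for r
      using that ord mono m by (intro walk_path_ramps) auto
    have "walk_path n h \<omega> - (1/2) *\<^sub>R (walk_path n s \<omega> + walk_path n e \<omega>)
        = (\<Sum>i\<in>{1..m}. (?q * ramp (i - 1) (real n * h)) *\<^sub>R \<xi> i \<omega>
            - (1/2) *\<^sub>R ((?q * ramp (i - 1) (real n * s)) *\<^sub>R \<xi> i \<omega> + (?q * ramp (i - 1) (real n * e)) *\<^sub>R \<xi> i \<omega>))"
      by (simp only: w simp_thms scaleR_sum_right sum.distrib[symmetric] sum_subtractf[symmetric])
    also have "\<dots> = (\<Sum>i\<in>{1..m}. (?q * c i) *\<^sub>R \<xi> i \<omega>)"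
    proof (intro sum.cong refl)
      fix i
      have "?q * c i = ?q * ramp (i - 1) (real n * h)
          - (1/2) * (?q * ramp (i - 1) (real n * s) + ?q * ramp (i - 1) (real n * e))"
        by (simp add: c_def algebra_simps)
      then show "(?q * ramp (i - 1) (real n * h)) *\<^sub>R \<xi> i \<omega>
            - (1/2) *\<^sub>R ((?q * ramp (i - 1) (real n * s)) *\<^sub>R \<xi> i \<omega> + (?q * ramp (i - 1) (real n * e)) *\<^sub>R \<xi> i \<omega>)
          = (?q * c i) *\<^sub>R \<xi> i \<omega>"
        by (simp only: scaleR_diff_left scaleR_add_left scaleR_scaleR[symmetric])
    qed
    finally show ?thesis .
  qed
  have c1: "\<bar>c i\<bar> \<le> 1" for i using c[of i] ramp_bounds[of "i - 1"] by (smt (verit))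
  have "(\<Sum>i\<in>{1..m}. \<bar>c i\<bar>) \<le> (\<Sum>i\<in>{1..m}. ramp (i - 1) (real n * e) - ramp (i - 1) (real n * s))"
    by (intro sum_mono c)
  also have "\<dots> = (\<Sum>i<m. ramp i (real n * e)) - (\<Sum>i<m. ramp i (real n * s))"
    unfolding sum_ramp_shift[of "\<lambda>i. ramp i (real n * e) - ramp i (real n * s)"] by (rule sum_subtractf)
  also have "\<dots> = real n * e - real n * s"
    using ord mono m by (simp add: sum_ramp)
  also have "\<dots> = real n * (1 / 2 ^ l)" using len by (simp add: right_diff_distrib[symmetric])
  finally have cs: "(\<Sum>i\<in>{1..m}. \<bar>c i\<bar>) \<le> real n * (1 / 2 ^ l)" .
  have q0: "0 \<le> inverse (sqrt (real n))" by simp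
  show "integrable M (\<lambda>\<omega>. norm (walk_path n (real (2 * k + 1) / 2 ^ Suc l) \<omega>
      - (1/2) *\<^sub>R (walk_path n (real k / 2 ^ l) \<omega> + walk_path n (real (k + 1) / 2 ^ l) \<omega>)) ^ 4)"
    unfolding s_def[symmetric] h_def[symmetric] e_def[symmetric] dev
    by (rule weighted_sum_fourth_moment[OF c1 cs q0])
  have "expectation (\<lambda>\<omega>. norm (\<Sum>i\<in>{1..m}. (inverse (sqrt (real n)) * c i) *\<^sub>R \<xi> i \<omega>) ^ 4)
      \<le> (real CARD('d))\<^sup>2 * (3 * (K\<^sup>2 * (inverse (sqrt (real n)))\<^sup>2 * (real n * (1 / 2 ^ l)))\<^sup>2)"
    by (rule weighted_sum_fourth_moment[OF c1 cs q0])
  also have "\<dots> = dev_const / (2 ^ l)\<^sup>2"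
    unfolding mult.assoc inverse_sqrt_power[OF n] by (simp add: dev_const_def power_mult_distrib power_divide)
  also have "(2 ^ l)\<^sup>2 = (4 :: real) ^ l" by (simp add: power2_eq_square flip: power_mult_distrib)
  finally show "expectation (\<lambda>\<omega>. norm (walk_path n (real (2 * k + 1) / 2 ^ Suc l) \<omega>
      - (1/2) *\<^sub>R (walk_path n (real k / 2 ^ l) \<omega> + walk_path n (real (k + 1) / 2 ^ l) \<omega>)) ^ 4) \<le> dev_const / 4 ^ l"
    unfolding s_def[symmetric] h_def[symmetric] e_def[symmetric] dev .
qed

text \<open>Collecting the contributions of all times, the exponent is a sum of about \<open>n\<close> independent centred
  variables of size \<open>O(1 / sqrt n)\<close>, so the Gaussian approximation has error \<open>O(1 / sqrt n)\<close>. The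
  variance of the sum converges since its coefficients are \<open>(\<Sum>i. ramp i (n * s) * ramp i (n * t)) / n\<close>,
  which differ from \<open>min s t\<close> by at most \<open>1 / n\<close>.\<close>

lemma walk_path_iexp_limit:
  fixes u :: "nat \<Rightarrow> real ^ 'd" and t :: "nat \<Rightarrow> real"
  assumes t: "\<And>k. 0 \<le> t k"
  shows "(\<lambda>n. CLINT \<omega>|M. iexp (\<Sum>k<N. u k \<bullet> walk_path (Suc n) (t k) \<omega>))
    \<longlonglongrightarrow> exp (- (\<Sum>k<N. \<Sum>l<N. step_cov (u k) (u l) * min (t k) (t l)) / 2)"
proof -
  \<comment> \<open>All the times are covered by the first \<open>(n + 1) * T\<close> steps.\<close>
  obtain T :: nat where T: "(\<Sum>k<N. t k) \<le> real T" using real_arch_simple by blast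
  have tT: "t k \<le> real T" if "k < N" for k
    using member_le_sum[of k "{..<N}" t] t T that by simp
  define U where "U = (\<Sum>k<N. norm (u k)) * K"
  define c where "c n i = (\<Sum>k<N. ramp (i - 1) (real (Suc n) * t k) *\<^sub>R u k)" for n i
  define q where "q n = inverse (sqrt (real (Suc n)))" for n
  define m where "m n = Suc n * T" for n
  have q: "0 \<le> q n" "(q n)\<^sup>2 = 1 / real (Suc n)" for n
    by (simp_all add: q_def inverse_eq_divide power_divide del: of_nat_Suc)
  have mt: "real (Suc n) * t k \<le> real (m n)" if "k < N" for n k
    unfolding m_def of_nat_mult using tT[OF that] by (intro mult_left_mono) auto
  have lin: "(\<Sum>k<N. u k \<bullet> walk_path (Suc n) (t k) \<omega>) = (\<Sum>i\<in>{1..m n}. (q n *\<^sub>R c n i) \<bullet> \<xi> i \<omega>)" for n \<omega>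
  proof -
    have "(\<Sum>k<N. u k \<bullet> walk_path (Suc n) (t k) \<omega>)
        = (\<Sum>k<N. \<Sum>i\<in>{1..m n}. q n * ramp (i - 1) (real (Suc n) * t k) * (u k \<bullet> \<xi> i \<omega>))"
    proof (intro sum.cong refl)
      fix k assume "k \<in> {..<N}"
      then show "u k \<bullet> walk_path (Suc n) (t k) \<omega>
          = (\<Sum>i\<in>{1..m n}. q n * ramp (i - 1) (real (Suc n) * t k) * (u k \<bullet> \<xi> i \<omega>))"
        unfolding q_def by (subst walk_path_ramps[OF t mt]) (auto simp: inner_sum_right)
    qed
    also have "\<dots> = (\<Sum>i\<in>{1..m n}. \<Sum>k<N. q n * ramp (i - 1) (real (Suc n) * t k) * (u k \<bullet> \<xi> i \<omega>))"
      by (rule sum.swap)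
    finally show ?thesis by (simp add: c_def inner_sum_left sum_distrib_left mult.assoc)
  qed
  have cb: "norm (c n i) * K \<le> U" for n i
  proof -
    have "norm (c n i) \<le> (\<Sum>k<N. norm (ramp (i - 1) (real (Suc n) * t k) *\<^sub>R u k))"
      unfolding c_def by (rule norm_sum)
    also have "\<dots> \<le> (\<Sum>k<N. norm (u k))"
      by (intro sum_mono) (simp add: ramp_bounds mult_left_le_one_le)
    finally show ?thesis unfolding U_def using K_nonneg by (intro mult_right_mono) auto
  qed
  have xb: "\<bar>(q n *\<^sub>R c n i) \<bullet> \<xi> i \<omega>\<bar> \<le> q n * U" if "i \<in> {1..m n}" "\<omega> \<in> space M" for n i \<omega>
  proof -
    have "\<bar>(q n *\<^sub>R c n i) \<bullet> \<xi> i \<omega>\<bar> \<le> norm (q n *\<^sub>R c n i) * K"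
      using that by (intro inner_bounded) auto
    also have "\<dots> = q n * (norm (c n i) * K)" using q by simp
    also have "\<dots> \<le> q n * U" by (intro mult_left_mono cb q)
    finally show ?thesis .
  qed
  define v where "v n = (\<Sum>i\<in>{1..m n}. expectation (\<lambda>\<omega>. ((q n *\<^sub>R c n i) \<bullet> \<xi> i \<omega>)\<^sup>2))" for n
  have approx: "cmod ((CLINT \<omega>|M. iexp (\<Sum>k<N. u k \<bullet> walk_path (Suc n) (t k) \<omega>)) - exp (- v n / 2))
      \<le> real T * (U ^ 3 * q n + U ^ 4 * (q n)\<^sup>2)" for n
  proof -
    have "cmod ((CLINT \<omega>|M. iexp (\<Sum>k<N. u k \<bullet> walk_path (Suc n) (t k) \<omega>)) - exp (- v n / 2))
        \<le> real (card {1..m n}) * ((q n * U) ^ 3 + (q n * U) ^ 4)"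
      unfolding lin v_def by (rule iexp_sum_bounded_approx[OF weighted_inner_indep xb]) (auto intro: inner_mean)
    also have "\<dots> = real T * (real (Suc n) * (q n)\<^sup>2) * (U ^ 3 * q n + U ^ 4 * (q n)\<^sup>2)"
    proof -
      have "(q n * U) ^ 3 = (q n)\<^sup>2 * (U ^ 3 * q n)" "(q n * U) ^ 4 = (q n)\<^sup>2 * (U ^ 4 * (q n)\<^sup>2)"
        by (simp_all add: power_mult_distrib power2_eq_square power3_eq_cube power4_eq_xxxx mult_ac)
      moreover have "real (card {1..m n}) = real (Suc n) * real T"
        by (simp only: card_atLeastAtMost m_def diff_Suc_1 of_nat_mult)
      ultimately show ?thesis by (simp only: ring_distribs mult_ac)
    qed
    also have "real (Suc n) * (q n)\<^sup>2 = 1" unfolding q by simp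
    finally show ?thesis by simp
  qed
  have q_lim: "q \<longlonglongrightarrow> 0"
  proof -
    have "(\<lambda>n. inverse (sqrt (real n))) \<longlonglongrightarrow> 0"
      by (rule tendsto_inverse_0_at_top, rule filterlim_compose[OF sqrt_at_top filterlim_real_sequentially])
    from LIMSEQ_Suc[OF this] show ?thesis unfolding q_def .
  qed
  have "(\<lambda>n. real T * (U ^ 3 * q n + U ^ 4 * (q n)\<^sup>2)) \<longlonglongrightarrow> real T * (U ^ 3 * 0 + U ^ 4 * 0\<^sup>2)"
    by (intro tendsto_intros q_lim)
  then have err0: "(\<lambda>n. real T * (U ^ 3 * q n + U ^ 4 * (q n)\<^sup>2)) \<longlonglongrightarrow> 0" by simp
  have err: "(\<lambda>n. (CLINT \<omega>|M. iexp (\<Sum>k<N. u k \<bullet> walk_path (Suc n) (t k) \<omega>))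
      - complex_of_real (exp (- v n / 2))) \<longlonglongrightarrow> 0"
    by (rule Lim_null_comparison[OF always_eventually err0]) (intro allI approx)
  have v_eq: "v n = (\<Sum>k<N. \<Sum>l<N. step_cov (u k) (u l) *
      ((\<Sum>i<m n. ramp i (real (Suc n) * t k) * ramp i (real (Suc n) * t l)) / real (Suc n)))" for n
  proof -
    have "expectation (\<lambda>\<omega>. ((q n *\<^sub>R c n i) \<bullet> \<xi> i \<omega>)\<^sup>2)
        = (\<Sum>k<N. \<Sum>l<N. ramp (i - 1) (real (Suc n) * t k) * ramp (i - 1) (real (Suc n) * t l) * step_cov (u k) (u l)) / real (Suc n)"
      if "i \<in> {1..m n}" for i
    proof -
      have i: "1 \<le> i" using that by simp
      have "expectation (\<lambda>\<omega>. ((q n *\<^sub>R c n i) \<bullet> \<xi> i \<omega>)\<^sup>2) = (q n)\<^sup>2 * step_cov (c n i) (c n i)"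
        unfolding inner_mult_expectation[OF i, symmetric] by (simp add: power2_eq_square mult_ac)
      then show ?thesis unfolding q c_def step_cov_sum by simp
    qed
    then have "v n = (\<Sum>i\<in>{1..m n}. (\<Sum>k<N. \<Sum>l<N. ramp (i - 1) (real (Suc n) * t k) * ramp (i - 1) (real (Suc n) * t l) * step_cov (u k) (u l)) / real (Suc n))"
      unfolding v_def by (intro sum.cong refl)
    also have "\<dots> = (\<Sum>i<m n. (\<Sum>k<N. \<Sum>l<N. ramp i (real (Suc n) * t k) * ramp i (real (Suc n) * t l) * step_cov (u k) (u l)) / real (Suc n))"
      by (rule sum_ramp_shift)
    also have "\<dots> = (\<Sum>i<m n. \<Sum>k<N. \<Sum>l<N. step_cov (u k) (u l) * (ramp i (real (Suc n) * t k) * ramp i (real (Suc n) * t l)) / real (Suc n))"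
      by (simp only: sum_divide_distrib mult.commute)
    also have "\<dots> = (\<Sum>k<N. \<Sum>i<m n. \<Sum>l<N. step_cov (u k) (u l) * (ramp i (real (Suc n) * t k) * ramp i (real (Suc n) * t l)) / real (Suc n))"
      by (rule sum.swap)
    also have "\<dots> = (\<Sum>k<N. \<Sum>l<N. \<Sum>i<m n. step_cov (u k) (u l) * (ramp i (real (Suc n) * t k) * ramp i (real (Suc n) * t l)) / real (Suc n))"
      by (intro sum.cong refl sum.swap)
    finally show ?thesis by (simp only: sum_distrib_left sum_divide_distrib times_divide_eq_right)
  qed
  have cell: "(\<lambda>n. (\<Sum>i<m n. ramp i (real (Suc n) * t k) * ramp i (real (Suc n) * t l)) / real (Suc n)) \<longlonglongrightarrow> min (t k) (t l)"
    if kl: "k < N" "l < N" for k l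
  proof -
    have "\<bar>(\<Sum>i<m n. ramp i (real (Suc n) * t k) * ramp i (real (Suc n) * t l)) / real (Suc n) - min (t k) (t l)\<bar> \<le> 1 / real (Suc n)" for n
    proof -
      have "\<bar>(\<Sum>i<m n. ramp i (real (Suc n) * t k) * ramp i (real (Suc n) * t l)) - real (Suc n) * min (t k) (t l)\<bar> \<le> 1"
      proof (cases "t k \<le> t l")
        case True
        have "real (Suc n) * t k \<le> real (Suc n) * t l" using True by (intro mult_left_mono) auto
        then show ?thesis using True t[of k] mt[OF kl(2)] sum_ramp_mult[of "real (Suc n) * t k" "real (Suc n) * t l" "m n"]
          by (simp add: min_def del: of_nat_Suc)
      next
        case False
        then have "real (Suc n) * t l \<le> real (Suc n) * t k" by (intro mult_left_mono) auto
        then show ?thesis using False t[of l] mt[OF kl(1)] sum_ramp_mult[of "real (Suc n) * t l" "real (Suc n) * t k" "m n"]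
          by (simp add: min_def mult.commute del: of_nat_Suc)
      qed
      then have "\<bar>(\<Sum>i<m n. ramp i (real (Suc n) * t k) * ramp i (real (Suc n) * t l)) - real (Suc n) * min (t k) (t l)\<bar> / real (Suc n) \<le> 1 / real (Suc n)"
        by (intro divide_right_mono) auto
      moreover have "(\<Sum>i<m n. ramp i (real (Suc n) * t k) * ramp i (real (Suc n) * t l)) / real (Suc n) - min (t k) (t l)
          = ((\<Sum>i<m n. ramp i (real (Suc n) * t k) * ramp i (real (Suc n) * t l)) - real (Suc n) * min (t k) (t l)) / real (Suc n)"
        by (simp add: diff_divide_distrib del: of_nat_Suc)
      ultimately show ?thesis by (simp del: of_nat_Suc)
    qed
    then have "(\<lambda>n. (\<Sum>i<m n. ramp i (real (Suc n) * t k) * ramp i (real (Suc n) * t l)) / real (Suc n) - min (t k) (t l)) \<longlonglongrightarrow> 0"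
      by (intro Lim_null_comparison[OF always_eventually LIMSEQ_Suc[OF lim_1_over_n]]) (simp del: of_nat_Suc)
    then show ?thesis by (simp add: LIM_zero_iff)
  qed
  have "v \<longlonglongrightarrow> (\<Sum>k<N. \<Sum>l<N. step_cov (u k) (u l) * min (t k) (t l))"
    unfolding v_eq by (intro tendsto_intros cell) auto
  then have "(\<lambda>n. complex_of_real (exp (- v n / 2))) \<longlonglongrightarrow> complex_of_real (exp (- (\<Sum>k<N. \<Sum>l<N. step_cov (u k) (u l) * min (t k) (t l)) / 2))"
    by (intro tendsto_intros) auto
  from tendsto_add[OF err this] show ?thesis by simp
qed

end

lemma limit_interchange:
  fixes A :: "nat \<Rightarrow> real" and A' :: "nat \<Rightarrow> nat \<Rightarrow> real"
  assumes close: "\<And>n j. 1 \<le> n \<Longrightarrow> \<bar>A n - A' n j\<bar> \<le> \<tau> j" and \<tau>: "\<tau> \<longlonglongrightarrow> 0"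
    and inner: "\<And>j. (\<lambda>n. A' n j) \<longlonglongrightarrow> B' j" and outer: "B' \<longlonglongrightarrow> B"
  shows "A \<longlonglongrightarrow> B"
proof (rule LIMSEQ_I)
  fix r :: real assume r: "0 < r"
  have "\<forall>\<^sub>F j in sequentially. \<tau> j < r / 3" by (rule order_tendstoD(2)[OF \<tau>]) (use r in simp)
  moreover have "\<forall>\<^sub>F j in sequentially. dist (B' j) B < r / 3" by (rule tendstoD[OF outer]) (use r in simp)
  ultimately have "\<forall>\<^sub>F j in sequentially. \<tau> j < r / 3 \<and> dist (B' j) B < r / 3" by (rule eventually_conj)
  from eventually_happens'[OF sequentially_bot this]
  obtain j where j: "\<tau> j < r / 3" "\<bar>B' j - B\<bar> < r / 3" by (auto simp: dist_real_def)
  have "\<forall>\<^sub>F n in sequentially. dist (A' n j) (B' j) < r / 3" by (rule tendstoD[OF inner]) (use r in simp)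
  then obtain n0 where n0: "\<And>n. n0 \<le> n \<Longrightarrow> \<bar>A' n j - B' j\<bar> < r / 3"
    by (auto simp: eventually_sequentially dist_real_def)
  have "norm (A n - B) < r" if "max 1 n0 \<le> n" for n
  proof -
    have "\<bar>A n - A' n j\<bar> < r / 3" using close[of n j] that j(1) by simp
    moreover have "\<bar>A' n j - B' j\<bar> < r / 3" using n0 that by simp
    ultimately have "\<bar>A n - B\<bar> < r / 3 + r / 3 + r / 3" using j(2) by linarith
    then show ?thesis by simp
  qed
  then show "\<exists>n0. \<forall>n\<ge>n0. norm (A n - B) < r" by blast
qed

lemma chain_error_tail: "(\<lambda>j. \<Sum>l. chain_error C (l + j)) \<longlonglongrightarrow> 0"
  by (rule suminf_exist_split2[OF summable_chain_error])

context bounded_centered_iid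
begin

lemma walk_path_in_cont_paths: "1 \<le> n \<Longrightarrow> path_of (\<lambda>t. walk_path n t \<omega>) \<in> cont_paths"
  unfolding walk_path_def by (intro path_of_in_cont_paths continuous_on_polygon) simp

lemma measurable_walk_path: "1 \<le> n \<Longrightarrow> (\<lambda>\<omega>. path_of (\<lambda>t. walk_path n t \<omega>)) \<in> measurable M (borel_of path_topology)"
  by (rule measurable_pathI) (auto simp: walk_path_measurable walk_path_in_cont_paths)

text \<open>Interpolate at the times \<open>k / 2 ^ j\<close>. For fixed \<open>j\<close> the interpolated walks converge in
  distribution to the interpolated limit, and the error of the interpolation tends to \<open>0\<close> with \<open>j\<close>,
  uniformly in \<open>n\<close> for the walks.\<close>

theorem donsker_lipschitz:
  fixes P :: "(real \<Rightarrow> real ^ 'd) measure" and g :: "(real \<Rightarrow> real ^ 'd) \<Rightarrow> real"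
  assumes P: "prob_space P" and sets_P: "sets P = sets (borel_of path_topology)" and space_P: "space P = cont_paths"
    and iexp: "\<And>(k::nat) u t. (\<And>i. 0 \<le> t i) \<Longrightarrow>
      (CLINT f|P. iexp (\<Sum>i<k. u i \<bullet> f (t i))) = exp (- (\<Sum>i<k. \<Sum>j<k. step_cov (u i) (u j) * min (t i) (t j)) / 2)"
    and lip: "\<And>f h. f \<in> cont_paths \<Longrightarrow> h \<in> cont_paths \<Longrightarrow> \<bar>g f - g h\<bar> \<le> L * path_dist f h"
    and B: "\<And>f. f \<in> cont_paths \<Longrightarrow> \<bar>g f\<bar> \<le> B" and L: "0 \<le> L"
  shows "(\<lambda>n. \<integral>\<omega>. g (path_of (\<lambda>t. walk_path n t \<omega>)) \<partial>M) \<longlonglongrightarrow> (\<integral>f. g f \<partial>P)"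
proof -
  interpret P: prob_space P by fact
  let ?\<Phi> = "\<lambda>j (x :: nat \<Rightarrow> real ^ 'd). path_of (polygon (2 ^ j) x)"
  have \<Phi>: "?\<Phi> j x \<in> cont_paths" for j x by (intro path_of_in_cont_paths continuous_on_polygon) simp
  have gcont: "continuous_map path_topology euclideanreal g"
    by (rule path.continuous_map_lipschitz[where L=L]) (rule lip)
  have gm: "g \<in> borel_measurable (borel_of path_topology)" by (rule continuous_map_measurable_real[OF gcont])
  have g\<Phi>: "continuous_on UNIV (\<lambda>x. g (?\<Phi> j x))" for j
    using continuous_map_compose[OF continuous_map_polygon gcont, of "2 ^ j"]
    by (simp add: comp_def)
  have eval: "(\<lambda>f. f t) \<in> borel_measurable P" if "0 \<le> t" for t
    using measurable_eval[OF that] by (simp add: measurable_cong_sets[OF sets_P refl])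
  show ?thesis
  proof (rule limit_interchange)
    fix n j :: nat assume n: "1 \<le> n"
    interpret D: dyadic_process M "\<lambda>l k \<omega>. walk_path n (real k / 2 ^ l) \<omega>" dev_const
      by (rule walk_path_dyadic_process[OF n])
    have d: "D.dyadic_path l \<omega> = polygon (2 ^ l) (\<lambda>k. walk_path n (real k / 2 ^ l) \<omega>)" for l \<omega>
      by (simp add: D.dyadic_path_def)
    have "\<bar>(\<integral>\<omega>. g (path_of (\<lambda>t. walk_path n t \<omega>)) \<partial>M) - (\<integral>\<omega>. g (path_of (D.dyadic_path j \<omega>)) \<partial>M)\<bar>
        \<le> L * (\<Sum>l. chain_error dev_const (l + j))"
    proof (rule D.dyadic_approximation_error[OF measurable_walk_path[OF n] _ lip B L])
      show "(\<lambda>l. path_dist (path_of (D.dyadic_path l \<omega>)) (path_of (\<lambda>t. walk_path n t \<omega>))) \<longlonglongrightarrow> 0" for \<omega>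
        using dyadic_polygon_tendsto[OF walk_path_in_cont_paths[OF n], of \<omega>] by (simp add: d)
    qed
    then show "\<bar>(\<integral>\<omega>. g (path_of (\<lambda>t. walk_path n t \<omega>)) \<partial>M) - (\<integral>\<omega>. g (?\<Phi> j (\<lambda>k. walk_path n (real k / 2 ^ j) \<omega>)) \<partial>M)\<bar>
        \<le> L * (\<Sum>l. chain_error dev_const (l + j))"
      by (simp only: d)
  next
    show "(\<lambda>j. L * (\<Sum>l. chain_error dev_const (l + j))) \<longlonglongrightarrow> 0"
      using tendsto_mult_left[OF chain_error_tail, of L] by simp
  next
    fix j :: nat
    have "(\<lambda>n. \<integral>\<omega>. g (?\<Phi> j (\<lambda>k. walk_path (Suc n) (real k / 2 ^ j) \<omega>)) \<partial>M)
        \<longlonglongrightarrow> (\<integral>f. g (?\<Phi> j (\<lambda>k. f (real k / 2 ^ j))) \<partial>P)"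
    proof (rule sequence_weak_convergence[OF prob_space_axioms P _ _ _ _ g\<Phi> B[OF \<Phi>]])
      show "(\<lambda>\<omega>. walk_path (Suc n) (real i / 2 ^ j) \<omega>) \<in> borel_measurable M" for n i by (rule walk_path_measurable)
      show "(\<lambda>f. f (real i / 2 ^ j)) \<in> borel_measurable P" for i by (rule eval) simp
      show "\<exists>R. \<forall>n. measure M {\<omega> \<in> space M. R < norm (walk_path (Suc n) (real i / 2 ^ j) \<omega>)} \<le> e"
        if e: "0 < e" for i and e :: real
      proof -
        let ?t = "real i / 2 ^ j"
        define c where "c = dev_const * ?t\<^sup>2"
        have c: "0 \<le> c" by (simp add: c_def dev_const_def)
        define R where "R = (c + 1) / e + 1"
        have R: "1 \<le> R" using c e by (simp add: R_def)
        have "measure M {\<omega> \<in> space M. R < norm (walk_path (Suc n) ?t \<omega>)} \<le> e" for n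
        proof -
          let ?Y = "\<lambda>\<omega>. norm (walk_path (Suc n) ?t \<omega>) ^ 4"
          have Y: "integrable M ?Y" "expectation ?Y \<le> c"
            unfolding c_def by (rule walk_path_fourth_moment; simp)+
          have [measurable]: "walk_path (Suc n) ?t \<in> borel_measurable M" by (rule walk_path_measurable)
          have "measure M {\<omega> \<in> space M. R < norm (walk_path (Suc n) ?t \<omega>)} \<le> measure M {\<omega> \<in> space M. R \<le> ?Y \<omega>}"
          proof (rule finite_measure_mono)
            show "{\<omega> \<in> space M. R < norm (walk_path (Suc n) ?t \<omega>)} \<subseteq> {\<omega> \<in> space M. R \<le> ?Y \<omega>}"
            proof safe
              fix \<omega> assume lt: "R < norm (walk_path (Suc n) ?t \<omega>)"
              have "norm (walk_path (Suc n) ?t \<omega>) ^ 1 \<le> ?Y \<omega>"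
                using lt R by (intro power_increasing) auto
              then show "R \<le> ?Y \<omega>" using lt by simp
            qed
          qed measurable
          also have "\<dots> \<le> expectation ?Y / R"
            by (rule integral_Markov_inequality_measure[OF Y(1), of "{}"]) (use R in auto)
          also have "\<dots> \<le> c / R" using Y(2) R by (intro divide_right_mono) auto
          also have "\<dots> \<le> e"
            using R e c by (simp add: R_def field_simps)
          finally show ?thesis .
        qed
        then show ?thesis by blast
      qed
      show "(\<lambda>n. CLINT \<omega>|M. iexp (\<Sum>i<k. u i \<bullet> walk_path (Suc n) (real i / 2 ^ j) \<omega>))
          \<longlonglongrightarrow> (CLINT f|P. iexp (\<Sum>i<k. u i \<bullet> f (real i / 2 ^ j)))" for k :: nat and u :: "nat \<Rightarrow> real ^ 'd"
      proof -
        have "(CLINT f|P. iexp (\<Sum>i<k. u i \<bullet> f (real i / 2 ^ j)))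
            = exp (- (\<Sum>i<k. \<Sum>l<k. step_cov (u i) (u l) * min (real i / 2 ^ j) (real l / 2 ^ j)) / 2)"
          by (rule iexp) simp
        then show ?thesis by (simp only:) (rule walk_path_iexp_limit, simp)
      qed
    qed
    then show "(\<lambda>n. \<integral>\<omega>. g (?\<Phi> j (\<lambda>k. walk_path n (real k / 2 ^ j) \<omega>)) \<partial>M)
        \<longlonglongrightarrow> (\<integral>f. g (?\<Phi> j (\<lambda>k. f (real k / 2 ^ j))) \<partial>P)"
      by (rule LIMSEQ_imp_Suc)
  next
    show "(\<lambda>j. \<integral>f. g (?\<Phi> j (\<lambda>k. f (real k / 2 ^ j))) \<partial>P) \<longlonglongrightarrow> (\<integral>f. g f \<partial>P)"
    proof (rule integral_dominated_convergence[where w="\<lambda>_. B"])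
      show "g \<in> borel_measurable P" using gm by (simp add: measurable_cong_sets[OF sets_P refl])
      show "(\<lambda>f. g (?\<Phi> j (\<lambda>k. f (real k / 2 ^ j)))) \<in> borel_measurable P" for j
        by (rule measurable_compose[OF measurable_path_of_polygon gm]) (auto intro!: eval)
      show "AE f in P. norm (g (?\<Phi> j (\<lambda>k. f (real k / 2 ^ j)))) \<le> B" for j using B[OF \<Phi>] by simp
      show "AE f in P. (\<lambda>j. g (?\<Phi> j (\<lambda>k. f (real k / 2 ^ j)))) \<longlonglongrightarrow> g f"
      proof (rule AE_I2)
        fix f assume "f \<in> space P"
        then have f: "f \<in> cont_paths" by (simp add: space_P)
        have d: "(\<lambda>j. L * path_dist (?\<Phi> j (\<lambda>k. f (real k / 2 ^ j))) f) \<longlonglongrightarrow> 0"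
          using tendsto_mult_left[OF dyadic_polygon_tendsto[OF f], of L] by simp
        have "(\<lambda>j. g (?\<Phi> j (\<lambda>k. f (real k / 2 ^ j))) - g f) \<longlonglongrightarrow> 0"
          by (rule Lim_null_comparison[OF always_eventually d]) (use lip[OF \<Phi> f] in simp)
        then show "(\<lambda>j. g (?\<Phi> j (\<lambda>k. f (real k / 2 ^ j)))) \<longlonglongrightarrow> g f" by (simp add: LIM_zero_iff)
      qed
    qed simp
  qed
qed

end

section \<open>The excitation is negligible\<close>

lemma sum_inverse_sqrt_le: "(\<Sum>i = 1..m. 1 / sqrt (real i)) \<le> 2 * sqrt (real m)"
proof (induction m)
  case (Suc m)
  have s: "0 < sqrt (real (Suc m))" "sqrt (real m) \<le> sqrt (real (Suc m))" by simp_all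
  have "(sqrt (real (Suc m)) - sqrt (real m)) * (sqrt (real (Suc m)) + sqrt (real m)) = 1"
    by (simp add: algebra_simps)
  also have "1 = (1 / (2 * sqrt (real (Suc m)))) * (2 * sqrt (real (Suc m)))" using s by simp
  finally have e: "(sqrt (real (Suc m)) - sqrt (real m)) * (sqrt (real (Suc m)) + sqrt (real m))
      = (1 / (2 * sqrt (real (Suc m)))) * (2 * sqrt (real (Suc m)))" .
  have "(sqrt (real (Suc m)) - sqrt (real m)) * (sqrt (real (Suc m)) + sqrt (real m))
      \<le> (sqrt (real (Suc m)) - sqrt (real m)) * (2 * sqrt (real (Suc m)))"
    using s by (intro mult_left_mono) auto
  then have "1 / (2 * sqrt (real (Suc m))) \<le> sqrt (real (Suc m)) - sqrt (real m)"
    unfolding e using s by (simp only: mult_le_cancel_right_pos zero_less_mult_iff zero_less_numeral simp_thms)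
  then have "1 / sqrt (real (Suc m)) \<le> 2 * (sqrt (real (Suc m)) - sqrt (real m))"
    using s(1) by (simp add: field_simps)
  then show ?case using Suc.IH by (simp del: of_nat_Suc)
qed simp

text \<open>Since \<open>\<beta> > 1 / 2\<close>, the summands are eventually at most \<open>e / sqrt i\<close>, and the sum of the latter is
  at most \<open>2 * e * sqrt (n * T + 1)\<close>.\<close>

lemma sum_powr_negligible:
  assumes \<beta>: "\<beta> > 1 / 2"
  shows "(\<lambda>n. (\<Sum>i = 1..n * T + 1. real i powr - \<beta>) / sqrt (real n)) \<longlonglongrightarrow> 0"
proof (rule LIMSEQ_I)
  fix r :: real assume r: "0 < r"
  \<comment> \<open>Then \<open>2 * e * sqrt (n * T + 1) / sqrt n \<le> r / 2\<close> for \<open>n \<ge> 1\<close>.\<close>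
  define e where "e = r / (4 * sqrt (real (T + 1)))"
  have e: "0 < e" using r by (simp add: e_def)
  have "(\<lambda>i. real i powr (1 / 2 - \<beta>)) \<longlonglongrightarrow> 0"
    using \<beta> by (intro tendsto_neg_powr filterlim_real_sequentially) auto
  from order_tendstoD(2)[OF this e]
  obtain i0 where i0: "\<And>i. i0 \<le> i \<Longrightarrow> real i powr (1 / 2 - \<beta>) < e"
    by (auto simp: eventually_sequentially)
  have summand: "real i powr - \<beta> \<le> (if i \<le> i0 then 1 else 0) + e * (1 / sqrt (real i))" if "1 \<le> i" for i
  proof (cases "i \<le> i0")
    case True
    have "real i powr - \<beta> \<le> real i powr 0" using that \<beta> by (intro powr_mono) auto
    then show ?thesis using True e that by (simp add: add_increasing2)
  next
    case False
    have "real i powr - \<beta> = real i powr (1 / 2 - \<beta>) * real i powr (- (1 / 2))"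
      by (simp flip: powr_add)
    also have "\<dots> \<le> e * real i powr (- (1 / 2))"
      using i0[of i] False by (intro mult_right_mono) auto
    also have "real i powr (- (1 / 2)) = 1 / sqrt (real i)"
      by (simp add: powr_minus powr_half_sqrt inverse_eq_divide)
    finally show ?thesis using False by simp
  qed
  have sum: "(\<Sum>i = 1..m. real i powr - \<beta>) \<le> real i0 + e * (2 * sqrt (real m))" for m
  proof -
    have "(\<Sum>i = 1..m. real i powr - \<beta>) \<le> (\<Sum>i = 1..m. (if i \<le> i0 then 1 else 0) + e * (1 / sqrt (real i)))"
      by (intro sum_mono summand) simp
    also have "\<dots> = (\<Sum>i = 1..m. if i \<le> i0 then 1 else 0) + e * (\<Sum>i = 1..m. 1 / sqrt (real i))"
      by (simp only: sum.distrib sum_distrib_left)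
    also have "(\<Sum>i = 1..m. if i \<le> i0 then 1 else 0) = real (card ({1..m} \<inter> {i. i \<le> i0}))"
      by (simp add: sum.If_cases)
    also have "\<dots> \<le> real (card {1..i0})" by (intro of_nat_mono card_mono) auto
    also have "e * (\<Sum>i = 1..m. 1 / sqrt (real i)) \<le> e * (2 * sqrt (real m))"
      using e by (intro mult_left_mono sum_inverse_sqrt_le) auto
    finally show ?thesis by simp
  qed
  have "(\<lambda>n. real i0 / sqrt (real n)) \<longlonglongrightarrow> 0"
    by (rule tendsto_divide_0[OF tendsto_const])
       (rule filterlim_at_top_imp_at_infinity, rule filterlim_compose[OF sqrt_at_top filterlim_real_sequentially])
  from order_tendstoD(2)[OF this, of "r / 2"] r
  obtain n0 where n0: "\<And>n. n0 \<le> n \<Longrightarrow> real i0 / sqrt (real n) < r / 2"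
    by (auto simp: eventually_sequentially)
  have "norm ((\<Sum>i = 1..n * T + 1. real i powr - \<beta>) / sqrt (real n) - 0) < r" if n: "max 1 n0 \<le> n" for n
  proof -
    have n1: "1 \<le> n" using n by simp
    then have s: "0 < sqrt (real n)" by simp
    have "real (n * T + 1) \<le> real n * real (T + 1)" using n1 by (simp add: algebra_simps)
    then have "sqrt (real (n * T + 1)) \<le> sqrt (real n) * sqrt (real (T + 1))"
      by (simp only: real_sqrt_mult[symmetric] real_sqrt_le_iff)
    then have "e * (2 * sqrt (real (n * T + 1))) \<le> e * (2 * (sqrt (real n) * sqrt (real (T + 1))))"
      using e by (intro mult_left_mono) auto
    also have "\<dots> = (r / 2) * sqrt (real n)" by (simp add: e_def)
    finally have "(\<Sum>i = 1..n * T + 1. real i powr - \<beta>) \<le> real i0 + (r / 2) * sqrt (real n)"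
      using sum[of "n * T + 1"] by linarith
    then have "(\<Sum>i = 1..n * T + 1. real i powr - \<beta>) / sqrt (real n) \<le> (real i0 + (r / 2) * sqrt (real n)) / sqrt (real n)"
      using s by (intro divide_right_mono) auto
    also have "\<dots> = real i0 / sqrt (real n) + r / 2" using s by (simp add: add_divide_distrib)
    also have "\<dots> < r / 2 + r / 2" using n by (intro add_strict_right_mono n0) simp
    finally have "(\<Sum>i = 1..n * T + 1. real i powr - \<beta>) / sqrt (real n) < r" by simp
    moreover have "0 \<le> (\<Sum>i = 1..n * T + 1. real i powr - \<beta>) / sqrt (real n)"
      by (intro divide_nonneg_nonneg sum_nonneg) auto
    ultimately show ?thesis by simp
  qed
  then show "\<exists>n0. \<forall>n\<ge>n0. norm ((\<Sum>i = 1..n * T + 1. real i powr - \<beta>) / sqrt (real n) - 0) < r" by blast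
qed

lemma rescaled_walk_eq_polygon:
  "rescaled_walk X n t \<omega> = polygon (real n) (\<lambda>k. X k \<omega> /\<^sub>R sqrt (real n)) t"
  by (simp add: rescaled_walk_def polygon_def Let_def scaleR_diff_right)

context pn_erw
begin

lemma \<xi>_measurable: "1 \<le> n \<Longrightarrow> \<xi> n \<in> borel_measurable M"
  using indep_\<xi> by (auto simp: indep_vars_def)

lemma \<gamma>_measurable: "1 \<le> n \<Longrightarrow> \<gamma> n \<in> borel_measurable M"
  using indep_\<gamma> by (auto simp: indep_vars_def)

lemma U_measurable: "1 \<le> n \<Longrightarrow> U n \<in> borel_measurable M"
  using indep_U by (auto simp: indep_vars_def)

lemma X_measurable: "X n \<in> borel_measurable M"
proof (induction n rule: less_induct)
  case (less n)
  have R: "revisit M X (i - 1) \<in> sets M" if i: "i \<in> {1..n}" for i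
  proof -
    have "revisit M X (i - 1) = (\<Union>k\<in>{..<i - 1}. {\<omega> \<in> space M. X k \<omega> = X (i - 1) \<omega>})"
      by (auto simp: revisit_def)
    also have "\<dots> \<in> sets M"
    proof (intro sets.finite_UN finite_lessThan)
      fix k assume "k \<in> {..<i - 1}"
      then have [measurable]: "X k \<in> borel_measurable M" "X (i - 1) \<in> borel_measurable M"
        using i by (auto intro!: less)
      show "{\<omega> \<in> space M. X k \<omega> = X (i - 1) \<omega>} \<in> sets M" by measurable
    qed
    finally show ?thesis .
  qed
  have Us: "{\<omega> \<in> space M. U i \<omega> > p i} \<in> sets M" "{\<omega> \<in> space M. U i \<omega> \<le> p i} \<in> sets M" if "i \<in> {1..n}" for i
    using U_measurable[of i] that by auto
  have "(\<lambda>\<omega>. \<Sum>i = 1..n.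
        indicator (revisit M X (i - 1)) \<omega> *\<^sub>R \<xi> i \<omega>
      + indicator ((space M - revisit M X (i - 1)) \<inter> {\<omega> \<in> space M. U i \<omega> > p i}) \<omega> *\<^sub>R \<xi> i \<omega>
      + indicator ((space M - revisit M X (i - 1)) \<inter> {\<omega> \<in> space M. U i \<omega> \<le> p i}) \<omega> *\<^sub>R \<gamma> i \<omega>) \<in> borel_measurable M"
    by (intro borel_measurable_sum borel_measurable_add borel_measurable_scaleR borel_measurable_indicator
        sets.Int sets.Diff sets.top R Us \<xi>_measurable \<gamma>_measurable) auto
  then show ?case by (subst measurable_cong[OF walk]) 
qed

text \<open>The walk uses \<open>\<gamma> i\<close> instead of \<open>\<xi> i\<close> at most on the event \<open>U i \<le> p i\<close>.\<close>

lemma X_minus_walk_le: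
  assumes K: "\<And>n \<omega>. 1 \<le> n \<Longrightarrow> \<omega> \<in> space M \<Longrightarrow> norm (\<xi> n \<omega>) \<le> K \<and> norm (\<gamma> n \<omega>) \<le> K"
    and \<omega>: "\<omega> \<in> space M"
  shows "norm (X n \<omega> - (\<Sum>i = 1..n. \<xi> i \<omega>)) \<le> (\<Sum>i = 1..n. 2 * K * indicator {\<omega> \<in> space M. U i \<omega> \<le> p i} \<omega>)"
proof -
  have "X n \<omega> - (\<Sum>i = 1..n. \<xi> i \<omega>) = (\<Sum>i = 1..n.
      indicator ((space M - revisit M X (i - 1)) \<inter> {\<omega> \<in> space M. U i \<omega> \<le> p i}) \<omega> *\<^sub>R (\<gamma> i \<omega> - \<xi> i \<omega>))"
    unfolding walk[OF \<omega>] sum_subtractf[symmetric]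
    by (intro sum.cong refl) (use \<omega> in \<open>auto simp: indicator_def not_less\<close>)
  also have "norm \<dots> \<le> (\<Sum>i = 1..n. 2 * K * indicator {\<omega> \<in> space M. U i \<omega> \<le> p i} \<omega>)"
  proof (rule sum_norm_le)
    fix i assume i: "i \<in> {1..n}"
    have "norm (\<gamma> i \<omega> - \<xi> i \<omega>) \<le> norm (\<gamma> i \<omega>) + norm (\<xi> i \<omega>)" by (rule norm_triangle_ineq4)
    also have "\<dots> \<le> 2 * K" using K[of i \<omega>] i \<omega> by auto
    finally have "norm (\<gamma> i \<omega> - \<xi> i \<omega>) \<le> 2 * K" .
    moreover from this have "0 \<le> K" using norm_ge_zero[of "\<gamma> i \<omega> - \<xi> i \<omega>"] by linarith
    ultimately show "norm (indicator ((space M - revisit M X (i - 1)) \<inter> {\<omega> \<in> space M. U i \<omega> \<le> p i}) \<omega> *\<^sub>R (\<gamma> i \<omega> - \<xi> i \<omega>))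
        \<le> 2 * K * indicator {\<omega> \<in> space M. U i \<omega> \<le> p i} \<omega>"
      by (auto simp: indicator_def)
  qed
  finally show ?thesis .
qed

lemma prob_excited:
  assumes i: "1 \<le> i"
  shows "prob {\<omega> \<in> space M. U i \<omega> \<le> p i} = p i"
proof -
  have "prob {\<omega> \<in> space M. U i \<omega> \<le> p i} = measure (distr M borel (U i)) {..p i}"
    by (subst measure_distr[OF U_measurable[OF i]]) (auto simp: vimage_def Int_def conj_commute)
  also have "\<dots> = measure lborel ({0..1} \<inter> {..p i}) / measure lborel {0..1::real}"
    unfolding uniform_U[OF i] by (rule measure_uniform_measure) auto
  also have "{0..1} \<inter> {..p i} = {0..p i}" using p_range[OF i] by auto
  finally show ?thesis using p_range[OF i] by simp
qed

lemma excitation_bound: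
  fixes K :: real
  shows "expectation (\<lambda>\<omega>. \<Sum>i = 1..m. 2 * K * indicator {\<omega> \<in> space M. U i \<omega> \<le> p i} \<omega>)
    = 2 * K * (\<Sum>i = 1..m. p i)"
    and "integrable M (\<lambda>\<omega>. \<Sum>i = 1..m. 2 * K * indicator {\<omega> \<in> space M. U i \<omega> \<le> p i} \<omega>)"
proof -
  have Us: "{\<omega> \<in> space M. U i \<omega> \<le> p i} \<in> sets M" if "i \<in> {1..m}" for i
    using U_measurable[of i] that by auto
  have int: "integrable M (\<lambda>\<omega>. 2 * K * indicator {\<omega> \<in> space M. U i \<omega> \<le> p i} \<omega>)" if "i \<in> {1..m}" for i
    using Us[OF that] by (intro integrable_mult_right integrable_real_indicator) (auto simp: less_top[symmetric])
  then show "integrable M (\<lambda>\<omega>. \<Sum>i = 1..m. 2 * K * indicator {\<omega> \<in> space M. U i \<omega> \<le> p i} \<omega>)"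
    by (intro Bochner_Integration.integrable_sum)
  have "expectation (\<lambda>\<omega>. \<Sum>i = 1..m. 2 * K * indicator {\<omega> \<in> space M. U i \<omega> \<le> p i} \<omega>)
      = (\<Sum>i = 1..m. expectation (\<lambda>\<omega>. 2 * K * indicator {\<omega> \<in> space M. U i \<omega> \<le> p i} \<omega>))"
    by (intro Bochner_Integration.integral_sum int)
  also have "\<dots> = (\<Sum>i = 1..m. 2 * K * p i)"
  proof (intro sum.cong refl)
    fix i assume i: "i \<in> {1..m}"
    have "{\<omega> \<in> space M. U i \<omega> \<le> p i} \<inter> space M = {\<omega> \<in> space M. U i \<omega> \<le> p i}" by auto
    then show "expectation (\<lambda>\<omega>. 2 * K * indicator {\<omega> \<in> space M. U i \<omega> \<le> p i} \<omega>) = 2 * K * p i"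
      using prob_excited[of i] i by simp
  qed
  finally show "expectation (\<lambda>\<omega>. \<Sum>i = 1..m. 2 * K * indicator {\<omega> \<in> space M. U i \<omega> \<le> p i} \<omega>)
    = 2 * K * (\<Sum>i = 1..m. p i)" by (simp only: sum_distrib_left)
qed

end

context pn_erw
begin

lemma rescaled_walk_path:
  assumes n: "1 \<le> n"
  shows "(\<lambda>\<omega>. path_of (\<lambda>t. rescaled_walk X n t \<omega>)) \<in> measurable M (borel_of path_topology)"
    and "path_of (\<lambda>t. rescaled_walk X n t \<omega>) \<in> cont_paths"
proof -
  have X: "(\<lambda>\<omega>. X k \<omega> /\<^sub>R sqrt (real n)) \<in> borel_measurable M" for k
    using X_measurable[of k] by measurable
  show "(\<lambda>\<omega>. path_of (\<lambda>t. rescaled_walk X n t \<omega>)) \<in> measurable M (borel_of path_topology)"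
    unfolding rescaled_walk_eq_polygon using n by (intro measurable_path_of_polygon X) simp
  show "path_of (\<lambda>t. rescaled_walk X n t \<omega>) \<in> cont_paths"
    unfolding rescaled_walk_eq_polygon using n by (intro path_of_in_cont_paths continuous_on_polygon) simp
qed

end

text \<open>On \<open>[0, T]\<close> the two paths differ by at most the rescaled number of excitations, whose mean vanishes
  as \<open>n\<close> grows. The contribution of later times is made small by the choice of \<open>T\<close>.\<close>

theorem erw_walk_comparison:
  fixes M :: "'a measure" and F :: "nat \<Rightarrow> 'a measure" and C \<beta> K :: real and dir :: "real ^ 'd"
    and \<xi> \<gamma> X :: "nat \<Rightarrow> 'a \<Rightarrow> real ^ 'd" and g :: "(real \<Rightarrow> real ^ 'd) \<Rightarrow> real"
  assumes \<beta>: "\<beta> > 1 / 2"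
    and erw: "pn_erw M F (\<lambda>n. min (C * real n powr (- \<beta>)) 1) dir \<xi> \<gamma> U X"
    and iid: "bounded_centered_iid M \<xi> K"
    and K: "\<And>n \<omega>. 1 \<le> n \<Longrightarrow> \<omega> \<in> space M \<Longrightarrow> norm (\<xi> n \<omega>) \<le> K \<and> norm (\<gamma> n \<omega>) \<le> K"
    and lip: "\<And>f h. f \<in> cont_paths \<Longrightarrow> h \<in> cont_paths \<Longrightarrow> \<bar>g f - g h\<bar> \<le> L * path_dist f h"
    and B: "\<And>f. f \<in> cont_paths \<Longrightarrow> \<bar>g f\<bar> \<le> B" and L: "0 \<le> L"
    and lim: "(\<lambda>n. \<integral>\<omega>. g (path_of (\<lambda>t. bounded_centered_iid.walk_path \<xi> n t \<omega>)) \<partial>M) \<longlonglongrightarrow> b"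
  shows "(\<lambda>n. \<integral>\<omega>. g (path_of (\<lambda>t. rescaled_walk X n t \<omega>)) \<partial>M) \<longlonglongrightarrow> b"
proof -
  define p where "p n = min (C * real n powr (- \<beta>)) 1" for n :: nat
  interpret E: pn_erw M F p dir \<xi> \<gamma> U X using erw by (simp add: p_def[abs_def])
  interpret W: bounded_centered_iid M \<xi> K by (rule iid)
  have K0: "0 \<le> K" by (rule W.K_nonneg)
  let ?ind = "\<lambda>i. indicator {\<omega> \<in> space M. U i \<omega> \<le> p i} :: 'a \<Rightarrow> real"
  define D where "D m \<omega> = (\<Sum>i = 1..m. 2 * K * ?ind i \<omega>)" for m :: nat and \<omega>
  have D_int: "integrable M (D m)" and D_exp: "E.expectation (D m) = 2 * K * (\<Sum>i = 1..m. p i)" for m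
    unfolding D_def[abs_def] by (rule E.excitation_bound)+
  have D_mono: "D k \<omega> \<le> D m \<omega>" if "k \<le> m" for k m \<omega>
    unfolding D_def using that K0 by (intro sum_mono2) auto
  have D0: "0 \<le> D m \<omega>" for m \<omega> using D_mono[of 0 m \<omega>] by (simp add: D_def)
  let ?a = "\<lambda>n. \<integral>\<omega>. g (path_of (\<lambda>t. rescaled_walk X n t \<omega>)) \<partial>M"
  let ?b = "\<lambda>n. \<integral>\<omega>. g (path_of (\<lambda>t. W.walk_path n t \<omega>)) \<partial>M"
  let ?s = "\<lambda>T n. (\<Sum>i = 1..n * T + 1. real i powr - \<beta>) / sqrt (real n)"
  have diff: "\<bar>?a n - ?b n\<bar> \<le> L * (2 * K * C * ?s T n + (1 / 2) ^ T)" if n: "1 \<le> n" for n T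
  proof -
    let ?H = "\<lambda>\<omega>. inverse (sqrt (real n)) * D (n * T + 1) \<omega> + (1 / 2) ^ T"
    have "path_dist (path_of (\<lambda>t. rescaled_walk X n t \<omega>)) (path_of (\<lambda>t. W.walk_path n t \<omega>)) \<le> ?H \<omega>"
      if \<omega>: "\<omega> \<in> space M" for \<omega>
    proof (rule path_dist_le)
      show "0 \<le> inverse (sqrt (real n)) * D (n * T + 1) \<omega>" using D0 by simp
      fix t :: real assume t: "0 \<le> t" "t \<le> real T"
      have "norm (polygon (real n) (\<lambda>k. X k \<omega> /\<^sub>R sqrt (real n) - (\<Sum>i = 1..k. \<xi> i \<omega>) /\<^sub>R sqrt (real n)) t)
          \<le> inverse (sqrt (real n)) * D (n * T + 1) \<omega>"
      proof (rule norm_polygon_le)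
        fix k assume k: "real k \<le> real n * t + 1"
        have "real n * t \<le> real n * real T" using t by (intro mult_left_mono) auto
        then have "real k \<le> real (n * T + 1)" using k by simp
        then have kn: "k \<le> n * T + 1" by (simp only: of_nat_le_iff)
        have "norm (X k \<omega> - (\<Sum>i = 1..k. \<xi> i \<omega>)) \<le> D k \<omega>"
          unfolding D_def by (rule E.X_minus_walk_le[OF K \<omega>])
        also have "\<dots> \<le> D (n * T + 1) \<omega>" by (rule D_mono[OF kn])
        finally have "inverse (sqrt (real n)) * norm (X k \<omega> - (\<Sum>i = 1..k. \<xi> i \<omega>))
            \<le> inverse (sqrt (real n)) * D (n * T + 1) \<omega>" by (intro mult_left_mono) auto
        then show "norm (X k \<omega> /\<^sub>R sqrt (real n) - (\<Sum>i = 1..k. \<xi> i \<omega>) /\<^sub>R sqrt (real n))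
            \<le> inverse (sqrt (real n)) * D (n * T + 1) \<omega>"
          unfolding scaleR_diff_right[symmetric] by simp
      qed (use t in auto)
      then show "norm (path_of (\<lambda>t. rescaled_walk X n t \<omega>) t - path_of (\<lambda>t. W.walk_path n t \<omega>) t)
          \<le> inverse (sqrt (real n)) * D (n * T + 1) \<omega>"
        using t by (simp add: rescaled_walk_eq_polygon W.walk_path_def polygon_diff)
    qed
    then have "\<bar>?a n - ?b n\<bar> \<le> L * E.expectation ?H"
      by (intro E.lipschitz_integral_diff[OF E.rescaled_walk_path(1)[OF n] W.measurable_walk_path[OF n] lip B L])
         (auto intro!: Bochner_Integration.integrable_add integrable_mult_right D_int)
    also have "E.expectation ?H = inverse (sqrt (real n)) * (2 * K * (\<Sum>i = 1..n * T + 1. p i)) + (1 / 2) ^ T"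
      using D_int by (simp add: D_exp E.prob_space del: sum.cl_ivl_Suc)
    also have "\<dots> \<le> inverse (sqrt (real n)) * (2 * K * (\<Sum>i = 1..n * T + 1. C * real i powr - \<beta>)) + (1 / 2) ^ T"
      using K0 by (intro add_right_mono mult_left_mono sum_mono) (auto simp: p_def)
    also have "\<dots> = 2 * K * C * ?s T n + (1 / 2) ^ T"
      by (simp only: sum_distrib_left[symmetric] divide_inverse mult_ac)
    finally show ?thesis using L by (simp add: mult_left_mono)
  qed
  have "(\<lambda>n. ?a n - ?b n) \<longlonglongrightarrow> 0"
  proof (rule LIMSEQ_I)
    fix r :: real assume r: "0 < r"
    have "(\<lambda>T. L * (1 / 2 :: real) ^ T) \<longlonglongrightarrow> 0"
      using tendsto_mult_left[OF LIMSEQ_power_zero[of "1 / 2 :: real"], of L] by simp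
    from eventually_happens'[OF sequentially_bot order_tendstoD(2)[OF this, of "r / 2"]] r
    obtain T where T: "L * (1 / 2) ^ T < r / 2" by auto
    have "(\<lambda>n. L * (2 * K * C * ?s T n)) \<longlonglongrightarrow> L * (2 * K * C * 0)"
      by (intro tendsto_mult_left sum_powr_negligible \<beta>)
    then have "(\<lambda>n. L * (2 * K * C * ?s T n)) \<longlonglongrightarrow> 0" by simp
    from order_tendstoD(2)[OF this, of "r / 2"] r
    obtain n0 where n0: "\<And>n. n0 \<le> n \<Longrightarrow> L * (2 * K * C * ?s T n) < r / 2"
      unfolding eventually_sequentially by auto
    have "norm (?a n - ?b n - 0) < r" if n: "max 1 n0 \<le> n" for n
    proof -
      have "\<bar>?a n - ?b n\<bar> \<le> L * (2 * K * C * ?s T n) + L * (1 / 2) ^ T"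
        using diff[of n T] n by (simp only: distrib_left max.bounded_iff)
      also have "\<dots> < r / 2 + r / 2" using n by (intro add_strict_mono n0 T) simp
      finally show ?thesis by simp
    qed
    then show "\<exists>n0. \<forall>n\<ge>n0. norm (?a n - ?b n - 0) < r" by blast
  qed
  from tendsto_add[OF this lim] show ?thesis by simp
qed

lemma finite_bounded_lattice: "finite {x :: real ^ 'd. x \<in> int_lattice \<and> norm x \<le> K}"
proof (rule finite_subset)
  let ?G = "PiE (UNIV :: 'd set) (\<lambda>_. {- \<lceil>K\<rceil>..\<lceil>K\<rceil>})"
  show "{x :: real ^ 'd. x \<in> int_lattice \<and> norm x \<le> K} \<subseteq> (\<lambda>h. \<chi> j. real_of_int (h j)) ` ?G"
  proof
    fix x :: "real ^ 'd" assume "x \<in> {x. x \<in> int_lattice \<and> norm x \<le> K}"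
    then have x: "\<And>j. x $ j \<in> \<int>" "norm x \<le> K" by (auto simp: int_lattice_def)
    define h where "h j = \<lfloor>x $ j\<rfloor>" for j
    have h: "real_of_int (h j) = x $ j" for j using x(1)[of j] by (simp add: h_def)
    have "- \<lceil>K\<rceil> \<le> h j \<and> h j \<le> \<lceil>K\<rceil>" for j
    proof -
      have "\<bar>real_of_int (h j)\<bar> \<le> K" unfolding h using component_le_norm_cart[of x j] x(2) by linarith
      then show ?thesis by linarith
    qed
    then have "h \<in> ?G" by (simp add: PiE_UNIV_domain)
    then show "x \<in> (\<lambda>h. \<chi> j. real_of_int (h j)) ` ?G"
      by (intro image_eqI[where x=h]) (simp_all add: vec_eq_iff h)
  qed
  show "finite ((\<lambda>h. \<chi> j. real_of_int (h j)) ` ?G :: (real ^ 'd) set)"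
    by (intro finite_imageI finite_PiE) auto
qed

section \<open>Convergence of the excited random walk\<close>

theorem corollary2p1:
  fixes M :: "'a measure" and F :: "nat \<Rightarrow> 'a measure"
    and C \<beta> :: real and dir :: "real ^ 'd"
    and \<xi> \<gamma> :: "nat \<Rightarrow> 'a \<Rightarrow> real ^ 'd" and U :: "nat \<Rightarrow> 'a \<Rightarrow> real"
    and X :: "nat \<Rightarrow> 'a \<Rightarrow> real ^ 'd"
  assumes "CARD('d) \<ge> 2" and "C > 0" and "\<beta> > 1 / 2"
    and "pn_erw M F (\<lambda>n. min (C * real n powr (- \<beta>)) 1) dir \<xi> \<gamma> U X"
  shows "\<exists>(N :: (real \<Rightarrow> real ^ 'd) measure) W.
    brownian_motion N (second_moment_matrix M (\<xi> 1)) W \<and>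
    converges_in_distribution path_topology
      M (\<lambda>n \<omega>. \<lambda>t\<in>{0..}. rescaled_walk X n t \<omega>)
      N (\<lambda>\<omega>. \<lambda>t\<in>{0..}. W t \<omega>)"
proof -
  interpret E: pn_erw M F "\<lambda>n. min (C * real n powr (- \<beta>)) 1" dir \<xi> \<gamma> U X by fact
  obtain K where K: "\<And>n \<omega>. 1 \<le> n \<Longrightarrow> \<omega> \<in> space M \<Longrightarrow> norm (\<xi> n \<omega>) \<le> K \<and> norm (\<gamma> n \<omega>) \<le> K"
    using E.bounded_steps by blast
  have iid: "bounded_centered_iid M \<xi> K"
  proof
    show "E.indep_vars (\<lambda>_. borel) \<xi> {1..}" by (rule E.indep_\<xi>)
    show "distr M borel (\<xi> n) = distr M borel (\<xi> 1)" if "1 \<le> n" for n by (rule E.ident_\<xi>[OF that])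
    show "norm (\<xi> n \<omega>) \<le> K" if "1 \<le> n" "\<omega> \<in> space M" for n \<omega> using K[OF that] by simp
    show "E.expectation (\<xi> n) = 0" if "1 \<le> n" for n using E.mean_\<xi>[OF that] by simp
  qed
  interpret W: bounded_centered_iid M \<xi> K by (rule iid)

  define A where "A = {x :: real ^ 'd. x \<in> int_lattice \<and> norm x \<le> K}"
  have A: "finite A" unfolding A_def by (rule finite_bounded_lattice)
  have \<xi>A: "\<xi> 1 \<omega> \<in> A" if "\<omega> \<in> space M" for \<omega>
    using that E.lattice_\<xi>[of 1] K[of 1] by (simp add: A_def)
  \<comment> \<open>Scaled like this, the vectors \<open>b x\<close> factor the covariance of \<open>\<xi> 1\<close>, as its law has finite support.\<close>
  define b where "b x = sqrt (E.prob {\<omega> \<in> space M. \<xi> 1 \<omega> = x}) *\<^sub>R x" for x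
  interpret G: gaussian_factors A b by unfold_locales (rule A)
  have cov: "G.cov u v = W.step_cov u v" for u v
  proof -
    have ev: "{\<omega> \<in> space M. \<xi> 1 \<omega> = x} \<in> sets M" for x
      using E.\<xi>_measurable[of 1] by measurable
    have "W.step_cov u v = E.expectation (\<lambda>\<omega>. \<Sum>x\<in>A. indicator {\<omega> \<in> space M. \<xi> 1 \<omega> = x} \<omega> * ((u \<bullet> x) * (v \<bullet> x)))"
      unfolding W.step_cov_def
    proof (rule Bochner_Integration.integral_cong[OF refl])
      fix \<omega> assume \<omega>: "\<omega> \<in> space M"
      have "(\<Sum>x\<in>A. indicator {\<omega> \<in> space M. \<xi> 1 \<omega> = x} \<omega> * ((u \<bullet> x) * (v \<bullet> x)))
          = (\<Sum>x\<in>A. if \<xi> 1 \<omega> = x then (u \<bullet> x) * (v \<bullet> x) else 0)"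
        using \<omega> by (intro sum.cong refl) (simp add: indicator_def)
      also have "\<dots> = (u \<bullet> \<xi> 1 \<omega>) * (v \<bullet> \<xi> 1 \<omega>)" using A \<xi>A[OF \<omega>] by simp
      finally show "(u \<bullet> \<xi> 1 \<omega>) * (v \<bullet> \<xi> 1 \<omega>)
          = (\<Sum>x\<in>A. indicator {\<omega> \<in> space M. \<xi> 1 \<omega> = x} \<omega> * ((u \<bullet> x) * (v \<bullet> x)))" by simp
    qed
    also have "\<dots> = (\<Sum>x\<in>A. E.expectation (\<lambda>\<omega>. indicator {\<omega> \<in> space M. \<xi> 1 \<omega> = x} \<omega> * ((u \<bullet> x) * (v \<bullet> x))))"
      using ev by (intro Bochner_Integration.integral_sum integrable_mult_left integrable_real_indicator)
        (auto simp: less_top[symmetric])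
    also have "\<dots> = (\<Sum>x\<in>A. E.prob {\<omega> \<in> space M. \<xi> 1 \<omega> = x} * ((u \<bullet> x) * (v \<bullet> x)))"
    proof (intro sum.cong refl)
      fix x
      have "{\<omega> \<in> space M. \<xi> 1 \<omega> = x} \<inter> space M = {\<omega> \<in> space M. \<xi> 1 \<omega> = x}" by auto
      then show "E.expectation (\<lambda>\<omega>. indicator {\<omega> \<in> space M. \<xi> 1 \<omega> = x} \<omega> * ((u \<bullet> x) * (v \<bullet> x)))
          = E.prob {\<omega> \<in> space M. \<xi> 1 \<omega> = x} * ((u \<bullet> x) * (v \<bullet> x))"
        by simp
    qed
    also have "\<dots> = G.cov u v"
      unfolding G.cov_def
    proof (intro sum.cong refl)
      fix x
      let ?p = "E.prob {\<omega> \<in> space M. \<xi> 1 \<omega> = x}"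
      have "(u \<bullet> b x) * (v \<bullet> b x) = (sqrt ?p * sqrt ?p) * ((u \<bullet> x) * (v \<bullet> x))"
        by (simp only: b_def inner_scaleR_right mult_ac)
      then show "?p * ((u \<bullet> x) * (v \<bullet> x)) = (u \<bullet> b x) * (v \<bullet> b x)" by simp
    qed
    finally show ?thesis by simp
  qed
  have S: "u \<bullet> (second_moment_matrix M (\<xi> 1) *v u) = G.cov u u" for u
  proof -
    have ent: "second_moment_matrix M (\<xi> 1) $ i $ j = W.step_cov (axis i 1) (axis j 1)" for i j
      by (simp add: second_moment_matrix_def W.step_cov_def inner_axis')
    have "u \<bullet> (second_moment_matrix M (\<xi> 1) *v u)
        = (\<Sum>i\<in>UNIV. \<Sum>j\<in>UNIV. u $ i * u $ j * W.step_cov (axis i 1) (axis j 1))"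
      by (simp add: inner_vec_def matrix_vector_mult_def ent[unfolded One_nat_def] sum_distrib_left mult_ac)
    also have "\<dots> = W.step_cov (\<Sum>i\<in>UNIV. u $ i *\<^sub>R axis i 1) (\<Sum>j\<in>UNIV. u $ j *\<^sub>R axis j 1)"
      by (rule W.step_cov_sum[symmetric])
    also have "(\<Sum>i\<in>UNIV. u $ i *\<^sub>R axis i 1) = u"
      using basis_expansion[of u] by (simp add: scalar_mult_eq_scaleR)
    finally show ?thesis by (simp add: cov)
  qed

  obtain P :: "(real \<Rightarrow> real ^ 'd) measure" where P: "brownian_motion P (second_moment_matrix M (\<xi> 1)) (\<lambda>t f. f t)"
    "sets P = sets (borel_of path_topology)" "space P = cont_paths"
    "\<forall>(k::nat) u t. (\<forall>i. 0 \<le> t i) \<longrightarrow>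
      (CLINT f|P. iexp (\<Sum>i<k. u i \<bullet> f (t i))) = exp (- (\<Sum>i<k. \<Sum>j<k. G.cov (u i) (u j) * min (t i) (t j)) / 2)"
    by (rule G.brownian_motion_exists[OF S]) (rule that)
  interpret P: brownian_motion P "second_moment_matrix M (\<xi> 1)" "\<lambda>t f. f t" by (rule P(1))
  have id: "path_of f = f" if "f \<in> space P" for f using that P(3) by (simp add: path_of_cont_path)
  have "converges_in_distribution path_topology M (\<lambda>n \<omega>. path_of (\<lambda>t. rescaled_walk X n t \<omega>)) P (\<lambda>f. path_of (\<lambda>t. f t))"
  proof (rule path.converges_in_distribution_lipschitzI[OF E.prob_space_axioms P.prob_space_axioms E.rescaled_walk_path(1)])
    have "(\<lambda>f. f) \<in> measurable P (borel_of path_topology)" using P(2) by (simp add: measurable_ident_sets)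
    then show "(\<lambda>f. path_of (\<lambda>t. f t)) \<in> measurable P (borel_of path_topology)"
      by (subst measurable_cong[OF id])
    fix g :: "(real \<Rightarrow> real ^ 'd) \<Rightarrow> real" and L B
    assume g: "\<And>f h. f \<in> cont_paths \<Longrightarrow> h \<in> cont_paths \<Longrightarrow> \<bar>g f - g h\<bar> \<le> L * path_dist f h"
      "\<And>f. f \<in> cont_paths \<Longrightarrow> \<bar>g f\<bar> \<le> B" "0 \<le> L"
    have "(\<lambda>n. \<integral>\<omega>. g (path_of (\<lambda>t. W.walk_path n t \<omega>)) \<partial>M) \<longlonglongrightarrow> (\<integral>f. g f \<partial>P)"
      by (rule W.donsker_lipschitz[OF P.prob_space_axioms P(2,3) _ g]) (use P(4) in \<open>simp add: cov\<close>)
    then have "(\<lambda>n. \<integral>\<omega>. g (path_of (\<lambda>t. rescaled_walk X n t \<omega>)) \<partial>M) \<longlonglongrightarrow> (\<integral>f. g f \<partial>P)"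
      by (intro erw_walk_comparison[OF assms(3,4) iid K g])
    also have "(\<integral>f. g f \<partial>P) = (\<integral>f. g (path_of (\<lambda>t. f t)) \<partial>P)"
      by (rule Bochner_Integration.integral_cong[OF refl]) (simp add: id)
    finally show "(\<lambda>n. \<integral>\<omega>. g (path_of (\<lambda>t. rescaled_walk X n t \<omega>)) \<partial>M) \<longlonglongrightarrow> (\<integral>f. g (path_of (\<lambda>t. f t)) \<partial>P)" .
  qed
  then show ?thesis
    unfolding path_of_def using P(1) by (intro exI[of _ P] exI[of _ "\<lambda>t f. f t"] conjI)
qed

end
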